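(* Let $X$ be a strictly convex finite dimensional (real) Banach space and let $\mu$ be a finite Borel measure on $X$. Then there exist a compact convex set $C\subset X$ and $\varepsilon>0$ such that whenever a $1$-Lipschitz map $f\colon X\to X$ satisfies $\sup_{x\in C}\lVert f(x)-x\rVert\le\varepsilon$, then $$\dim_T(f_\#\mu)\ge\dim_T\mu .$$
   Context: A normed space is strictly convex if its unit sphere contains no non-degenerate line segment. $f_\#\mu(A)=\mu(f^{-1}(A))$. Curve fragments: for a metric space $X$, $\Gamma(X)$ is the set of all Lipschitz maps $\gamma\colon\operatorname{Dom}\gamma\to X$ with $\operatorname{Dom}\gamma\subset[0,1]$ non-empty and compact. For a Lipschitz map $F\colon X\to\mathbb{R}^n$, $(F\circ\gamma)'(t)$ denotes the derivative (relative to $\operatorname{Dom}\gamma$), which exists for $\mathcal{H}^1$-a.e. $t\in\operatorname{Dom}\gamma$. Weak tangent fields: let $S\subset X$ be Borel, $F\colon X\to\mathbb{R}^n$ Lipschitz and $0\le d\le n$ an integer. A Borel map $\tau$ from $S$ to the Grassmannian of $d$-dimensional linear subspaces of $\mathbb{R}^n$ is a $d$-dimensional weak tangent field to $S$ with respect to $F$ if for every $\gamma\in\Gamma(X)$, $(F\circ\gamma)'(t)\in\tau(\gamma(t))$ for $\mathcal{H}^1$-a.e. $t\in\gamma^{-1}(S)$. The set $S$ admits a $d$-dimensional weak tangent field if for every $n\in\mathbb{N}$ with $n\ge d$ and every Lipschitz $F\colon X\to\mathbb{R}^n$ there exists a $d$-dimensional weak tangent field to $S$ with respect to $F$. Tangential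 dimension: $\dim_T(S)$ is the least integer $d\ge0$ such that $S$ admits a $d$-dimensional weak tangent field ($\infty$ if there is none). For a Borel measure $\mu$ on $X$, $\dim_T\mu$ is the least integer $d\ge 0$ for which there is a Borel $N\subset X$ with $\mu(N)=0$ and $\dim_T(X\setminus N)\le d$ ($\infty$ if there is none). *)

theory Defs
  imports "HOL-Analysis.Analysis" "HOL-Analysis.Finite_Function_Topology" "HOL-Library.Extended_Nat"
begin

section \<open>Euclidean space and its Grassmannians\<close>

text \<open>
  The dimension of the target space is quantified inside the definition of an admissible
  dimension, so it cannot be a type.  We realise \<open>\<real>\<^sup>n\<close> as the subspace of those finitely supported
  sequences whose support lies in \<open>{..<n}\<close>.  On this type the library norm is the sum of the
  absolute values of the coordinates; on \<open>\<real>\<^sup>n\<close> it is equivalent to the Euclidean one, so Lipschitz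
  maps, derivatives and the topology of the Grassmannian are the usual ones.
\<close>

definition Rn :: "nat \<Rightarrow> (nat \<Rightarrow>\<^sub>0 real) set" where
  "Rn n = {v. Poly_Mapping.keys v \<subseteq> {..<n}}"

definition Gr :: "nat \<Rightarrow> nat \<Rightarrow> (nat \<Rightarrow>\<^sub>0 real) set set" where
  "Gr n d = {V. subspace V \<and> V \<subseteq> Rn n \<and> dim V = d}"

text \<open>The Hausdorff distance between the closed unit balls of two subspaces.\<close>

definition gr_dist :: "(nat \<Rightarrow>\<^sub>0 real) set \<Rightarrow> (nat \<Rightarrow>\<^sub>0 real) set \<Rightarrow> real" where
  "gr_dist V W = max (SUP v\<in>V \<inter> cball 0 1. infdist v (W \<inter> cball 0 1))
                     (SUP w\<in>W \<inter> cball 0 1. infdist w (V \<inter> cball 0 1))"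

definition gr_open :: "nat \<Rightarrow> nat \<Rightarrow> (nat \<Rightarrow>\<^sub>0 real) set set \<Rightarrow> bool" where
  "gr_open n d U \<longleftrightarrow> U \<subseteq> Gr n d \<and> (\<forall>V\<in>U. \<exists>e>0. \<forall>W\<in>Gr n d. gr_dist V W < e \<longrightarrow> W \<in> U)"

definition gr_borel :: "nat \<Rightarrow> nat \<Rightarrow> (nat \<Rightarrow>\<^sub>0 real) set measure" where
  "gr_borel n d = sigma (Gr n d) {U. gr_open n d U}"

section \<open>Curve fragments and weak tangent fields\<close>

text \<open>
  A curve fragment is a pair of its domain \<open>K\<close> and a total function, of which only the values
  on \<open>K\<close> matter.
\<close>

definition curve_fragment :: "real set \<Rightarrow> (real \<Rightarrow> 'a::metric_space) \<Rightarrow> bool" where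
  "curve_fragment K \<gamma> \<longleftrightarrow> K \<noteq> {} \<and> compact K \<and> K \<subseteq> {0..1} \<and> (\<exists>L. L-lipschitz_on K \<gamma>)"

text \<open>
  On the real line \<open>\<H>\<^sup>1\<close> is Lebesgue measure.  At an isolated point of \<open>K\<close> every vector is a
  derivative relative to \<open>K\<close>, but there are only countably many such points, so they are
  irrelevant for a statement that holds almost everywhere.
\<close>

definition weak_tangent_field ::
  "nat \<Rightarrow> nat \<Rightarrow> 'a::metric_space set \<Rightarrow> ('a \<Rightarrow> (nat \<Rightarrow>\<^sub>0 real)) \<Rightarrow> ('a \<Rightarrow> (nat \<Rightarrow>\<^sub>0 real) set) \<Rightarrow> bool"
  where
  "weak_tangent_field n d S F \<tau> \<longleftrightarrow>
     \<tau> \<in> measurable (restrict_space borel S) (gr_borel n d) \<and>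
     (\<forall>K \<gamma>. curve_fragment K \<gamma> \<longrightarrow>
        (AE t in lebesgue. t \<in> K \<and> \<gamma> t \<in> S \<longrightarrow>
           (\<exists>v. ((F \<circ> \<gamma>) has_vector_derivative v) (at t within K) \<and> v \<in> \<tau> (\<gamma> t))))"

definition admits_weak_tangent_field :: "nat \<Rightarrow> 'a::metric_space set \<Rightarrow> bool" where
  "admits_weak_tangent_field d S \<longleftrightarrow>
     (\<forall>n\<ge>d. \<forall>F. range F \<subseteq> Rn n \<and> (\<exists>L. L-lipschitz_on UNIV F) \<longrightarrow>
        (\<exists>\<tau>. weak_tangent_field n d S F \<tau>))"

section \<open>Tangential dimension\<close>

text \<open>The infimum of the empty set of extended natural numbers is \<open>\<infinity>\<close>.\<close>

definition dim_T :: "'a::metric_space set \<Rightarrow> enat" where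
  "dim_T S = Inf {enat d | d. admits_weak_tangent_field d S}"

definition dim_T_measure :: "'a::metric_space measure \<Rightarrow> enat" where
  "dim_T_measure \<mu> =
     Inf {enat d | d. \<exists>N\<in>sets borel. emeasure \<mu> N = 0 \<and> dim_T (UNIV - N) \<le> enat d}"

end

theory Submission
  imports Defs "HOL-Probability.Probability_Mass_Function"
begin

text \<open>
  Fix \<open>d\<close> and suppose that \<open>1\<close>-Lipschitz maps \<open>f\<^sub>k\<close> converge to the identity locally uniformly while
  \<open>f\<^sub>k\<^sub>#\<mu>\<close> has tangential dimension at most \<open>d\<close>, with tangent fields \<open>\<tau>\<^sub>k\<close>.  For a Lipschitz curve \<open>\<gamma>\<close>,
  lower semicontinuity of length gives \<open>\<bar>(\<gamma> + f\<^sub>k \<circ> \<gamma>)' / 2\<bar> \<rightarrow> \<bar>\<gamma>'\<bar>\<close> in \<open>L\<^sup>1\<close>, so strict convexity forces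
  \<open>(f\<^sub>k \<circ> \<gamma>)' \<rightarrow> \<gamma>'\<close> in \<open>L\<^sup>1\<close>.  The seminorms \<open>v \<mapsto> dist(v, \<tau>\<^sub>k(f\<^sub>k x))\<close> vanish on \<open>(f\<^sub>k \<circ> \<gamma>)'\<close>; convex
  combinations of them converge \<open>\<mu>\<close>-almost everywhere to seminorms \<open>q x\<close> which vanish on \<open>\<gamma>'\<close> and whose
  kernels still have dimension at most \<open>d\<close>, since on \<open>d + 1\<close> independent vectors the distances to a
  \<open>d\<close>-dimensional space have a positive lower bound for their sum, and this bound is convex.

  The kernels handle the identity map off one null set.  For another Lipschitz map \<open>F\<close> no further null
  set may be removed.  At a point \<open>\<gamma> t\<close> at which the domain of \<open>\<gamma>\<close> is not porous, \<open>F\<close> has a directional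
  derivative along \<open>\<gamma>'\<close>.  If these derivatives violate a linear relation among \<open>d + 1\<close> directions, the
  points with this violation split into countably many pieces, each of which is null for all curves
  running in one of the directions.  Discarding these directions piece by piece leaves a countably generated,
  hence measurable, family of possible values of \<open>(F \<circ> \<gamma>)'\<close> of dimension at most \<open>d\<close>.
\<close>

section \<open>Differentiability of Lipschitz curves\<close>

text \<open>Subspaces cannot be averaged and the fields \<open>\<tau>\<^sub>k\<close> have no reason
  to converge at any point. Their distance seminorms form a convex class, so limits are taken there
  and subspaces return only as kernels. The \<open>\<mu>\<close>-null set has to be fixed before
  \<open>F\<close> is known, and there are uncountably many \<open>F\<close>; this is why the
  passage from the identity map to a general \<open>F\<close> cannot be made almost everywhere. The
  pieces where \<open>F\<close> violates a linear relation \<open>\<Sum> c u = 0\<close> are null in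
  some direction for the following reason. If such a piece had neighbours of its own in every
  direction \<open>u\<close> at all small scales, a chain of steps \<open>h c u\<close> inside it
  would return close to its start, while \<open>F\<close> would change by about
  \<open>h \<Sum> c a\<close>, against the Lipschitz condition. So some step meets a gap, and a gap
  at arbitrarily small scales is porosity along every curve in that direction. The compactness
  argument treats one dimension \<open>d\<close> at a time. Only the finitely many \<open>d\<close>
  up to the size of a spanning set matter, since for larger \<open>d\<close> the whole space admits
  a field; hence one ball and one tolerance suffice.\<close>

lemma Vitali_covering_theorem_Icc:
  fixes S :: "real set" and K :: "(real \<times> real) set"
  assumes K: "\<And>i. i \<in> K \<Longrightarrow> fst i < snd i"
    and S: "\<And>x d. x \<in> S \<Longrightarrow> 0 < d \<Longrightarrow> \<exists>i\<in>K. x \<in> {fst i..snd i} \<and> snd i - fst i < d"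
  obtains C where "countable C" "C \<subseteq> K" "disjoint_family_on (\<lambda>i. {fst i..snd i}) C"
    "negligible (S - (\<Union>i\<in>C. {fst i..snd i}))"
proof -
  \<comment> \<open>A closed interval is the closed ball about its midpoint. Indexing by pairs of
    endpoints lets the slope conditions of the covers below be read off the index.\<close>
  let ?a = "\<lambda>i::real \<times> real. (fst i + snd i) / 2" and ?r = "\<lambda>i::real \<times> real. (snd i - fst i) / 2"
  have cb: "cball (?a i) (?r i) = {fst i..snd i}" for i
    by (simp add: cball_eq_atLeastAtMost field_simps)
  have S': "\<exists>i. i \<in> K \<and> x \<in> cball (?a i) (?r i) \<and> ?r i < d" if xd: "x \<in> S" "0 < d" for x d
  proof -
    obtain i where "i \<in> K" "x \<in> {fst i..snd i}" "snd i - fst i < d"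
      using S[OF xd] by blast
    then show ?thesis using K[of i] unfolding cb by (intro exI[of _ i]) auto
  qed
  have rpos: "0 < ?r i" if "i \<in> K" for i using K[OF that] by simp
  obtain C where C: "countable C" "C \<subseteq> K"
     "pairwise (\<lambda>i j. disjnt (cball (?a i) (?r i)) (cball (?a j) (?r j))) C"
     "negligible (S - (\<Union>i \<in> C. cball (?a i) (?r i)))"
    using Vitali_covering_theorem_cballs[of K ?r S ?a, OF rpos S'] by blast
  have "disjoint_family_on (\<lambda>i. {fst i..snd i}) C"
    using C(3) unfolding cb disjoint_family_on_def pairwise_def disjnt_def by blast
  with C that show thesis unfolding cb by blast
qed

lemma emeasure_UN_countable_mono:
  assumes "countable C" and "disjoint_family_on X C"
    and "\<And>i. i \<in> C \<Longrightarrow> X i \<in> sets M" and "sets N = sets M"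
    and le: "\<And>i. i \<in> C \<Longrightarrow> emeasure M (X i) \<le> emeasure N (X i)"
  shows "emeasure M (\<Union>i\<in>C. X i) \<le> emeasure N (\<Union>i\<in>C. X i)"
  using assms by (auto simp: emeasure_UN_countable intro!: nn_integral_mono)

text \<open>Nested Vitali covers: the intervals of slope at least \<open>q\<close> are taken inside those of slope at most \<open>p\<close>.\<close>

lemma null_sets_slope_crossing:
  fixes f :: "real \<Rightarrow> real"
  assumes mono: "\<And>x y. x \<le> y \<Longrightarrow> f x \<le> f y" and cont: "continuous_on UNIV f"
    and pq: "0 \<le> p" "p < q"
    and E: "E \<in> sets borel" "bounded E"
    and lo: "\<And>t d. t \<in> E \<Longrightarrow> 0 < d \<Longrightarrow> \<exists>r s. r < t \<and> t < s \<and> s - r < d \<and> f s - f r \<le> p * (s - r)"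
    and hi: "\<And>t d. t \<in> E \<Longrightarrow> 0 < d \<Longrightarrow> \<exists>r s. r < t \<and> t < s \<and> s - r < d \<and> f s - f r \<ge> q * (s - r)"
  shows "E \<in> null_sets lborel"
proof -
  \<comment> \<open>A slope condition on an interval compares its Stieltjes measure with its length,
    and both measures are additive over disjoint families.\<close>
  let ?\<nu> = "interval_measure f"
  have nu: "emeasure ?\<nu> {a..b} = ennreal (f b - f a)" if "a \<le> b" for a b
    using emeasure_interval_measure_Icc[OF that mono cont] by simp
  have fin: "emeasure lborel E < \<infinity>"
    using emeasure_bounded_finite[OF E(2)] by simp
  have key: "ennreal q * emeasure lborel E \<le> ennreal p * (emeasure lborel E + ennreal e)" if e: "e > 0" for e
  proof -
    obtain U where U: "open U" "E \<subseteq> U" "emeasure lborel (U - E) < e"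
      using outer_regular_lborel[OF E(1) e] by blast
    let ?I = "\<lambda>i::real \<times> real. {fst i..snd i}"
    define K1 where "K1 = {(r, s). r < s \<and> {r..s} \<subseteq> U \<and> f s - f r \<le> p * (s - r)}"
    have "\<exists>i\<in>K1. x \<in> ?I i \<and> x \<in> {fst i<..<snd i} \<and> snd i - fst i < d" if x: "x \<in> E" "0 < d" for x d
    proof -
      obtain c where c: "c > 0" "ball x c \<subseteq> U" using U x open_contains_ball by blast
      obtain r s where rs: "r < x" "x < s" "s - r < min c d" "f s - f r \<le> p * (s - r)"
        using lo[of x "min c d"] x c by auto
      have "{r..s} \<subseteq> ball x c" using rs by (auto simp: dist_real_def)
      then show ?thesis using rs c x by (intro bexI[of _ "(r, s)"]) (auto simp: K1_def)
    qed
    then have c1: "\<And>x d. x \<in> E \<Longrightarrow> 0 < d \<Longrightarrow> \<exists>i\<in>K1. x \<in> ?I i \<and> snd i - fst i < d"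
      by blast
    have k1: "\<And>i. i \<in> K1 \<Longrightarrow> fst i < snd i" by (auto simp: K1_def)
    obtain C1 where C1: "countable C1" "C1 \<subseteq> K1" "disjoint_family_on ?I C1"
      "negligible (E - (\<Union>i\<in>C1. ?I i))"
      using Vitali_covering_theorem_Icc[OF k1 c1] by blast
    \<comment> \<open>Open intervals make \<open>V\<close> open, so that the second cover can be
      chosen inside it; only the countably many endpoints are lost.\<close>
    define V where "V = (\<Union>i\<in>C1. {fst i<..<snd i})"
    have VI: "V \<subseteq> (\<Union>i\<in>C1. ?I i)" by (auto simp: V_def)
    have sub: "E - V \<subseteq> (E - (\<Union>i\<in>C1. ?I i)) \<union> (fst ` C1 \<union> snd ` C1)"
      by (force simp: V_def less_le)
    have ng: "negligible (fst ` C1 \<union> snd ` C1)"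
      unfolding negligible_iff_null_sets using C1(1)
      by (auto intro!: null_sets_completionI[OF countable_imp_null_set_lborel])
    have negV: "negligible (E - V)"
      by (rule negligible_subset[OF negligible_Un[OF C1(4) ng] sub])
    define K2 where "K2 = {(r, s). r < s \<and> {r..s} \<subseteq> V \<and> f s - f r \<ge> q * (s - r)}"
    have c2: "\<exists>i\<in>K2. x \<in> ?I i \<and> snd i - fst i < d" if x: "x \<in> E \<inter> V" "0 < d" for x d
    proof -
      have "open V" by (auto simp: V_def)
      then obtain c where c: "c > 0" "ball x c \<subseteq> V" using x open_contains_ball by blast
      obtain r s where rs: "r < x" "x < s" "s - r < min c d" "f s - f r \<ge> q * (s - r)"
        using hi[of x "min c d"] x c by auto
      have "{r..s} \<subseteq> ball x c" using rs by (auto simp: dist_real_def)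
      then show ?thesis using rs c x by (intro bexI[of _ "(r, s)"]) (auto simp: K2_def)
    qed
    have k2: "\<And>i. i \<in> K2 \<Longrightarrow> fst i < snd i" by (auto simp: K2_def)
    obtain C2 where C2: "countable C2" "C2 \<subseteq> K2" "disjoint_family_on ?I C2"
      "negligible (E \<inter> V - (\<Union>i\<in>C2. ?I i))"
      using Vitali_covering_theorem_Icc[OF k2 c2] by blast
    have U1: "(\<Union>i\<in>C1. ?I i) \<in> sets borel" and U2: "(\<Union>i\<in>C2. ?I i) \<in> sets borel"
      using C1(1) C2(1) by (auto intro!: sets.countable_UN')
    have U2V: "(\<Union>i\<in>C2. ?I i) \<subseteq> V" using C2(2) by (force simp: K2_def)
    have "negligible (E - (\<Union>i\<in>C2. ?I i))"
      by (rule negligible_subset[OF negligible_Un[OF negV C2(4)]]) blast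
    then have "emeasure lborel (E - (\<Union>i\<in>C2. ?I i)) = 0"
      using U2 E(1) by (auto simp: negligible_iff_emeasure0)
    then have nE: "E - (\<Union>i\<in>C2. ?I i) \<in> null_sets lborel"
      using U2 E(1) by (auto simp: null_sets_def)
    have "emeasure lborel E \<le> emeasure lborel ((\<Union>i\<in>C2. ?I i) \<union> (E - (\<Union>i\<in>C2. ?I i)))"
      using U2 E(1) by (intro emeasure_mono) auto
    also have "\<dots> = emeasure lborel (\<Union>i\<in>C2. ?I i)"
      using U2 nE by (intro emeasure_Un_null_set) auto
    finally have "emeasure lborel E \<le> emeasure lborel (\<Union>i\<in>C2. ?I i)" .
    \<comment> \<open>The chain runs \<open>q |E| \<le> q |C2| \<le> \<nu>(C2) \<le> \<nu>(C1) \<le>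
      p |C1| \<le> p |U| \<le> p (|E| + e)\<close>, with \<open>C1\<close>, \<open>C2\<close>
      standing for the unions of the two covers.\<close>
    then have "ennreal q * emeasure lborel E \<le> ennreal q * emeasure lborel (\<Union>i\<in>C2. ?I i)"
      by (simp add: mult_left_mono)
    also have "\<dots> = emeasure (scale_measure q lborel) (\<Union>i\<in>C2. ?I i)"
      by simp
    also have "\<dots> \<le> emeasure ?\<nu> (\<Union>i\<in>C2. ?I i)"
    proof (rule emeasure_UN_countable_mono[OF C2(1) C2(3)])
      fix i assume "i \<in> C2"
      then have i: "i \<in> K2" using C2(2) by blast
      have "ennreal q * ennreal (snd i - fst i) \<le> ennreal (f (snd i) - f (fst i))"
        using i pq by (auto simp: K2_def ennreal_mult'[symmetric] intro!: ennreal_leI)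
      then show "emeasure (scale_measure q lborel) (?I i) \<le> emeasure ?\<nu> (?I i)"
        using k2[OF i] by (simp add: nu)
    qed auto
    also have "\<dots> \<le> emeasure ?\<nu> (\<Union>i\<in>C1. ?I i)"
      using U2V VI U1 by (intro emeasure_mono) auto
    also have "\<dots> \<le> emeasure (scale_measure p lborel) (\<Union>i\<in>C1. ?I i)"
    proof (rule emeasure_UN_countable_mono[OF C1(1) C1(3)])
      fix i assume "i \<in> C1"
      then have i: "i \<in> K1" using C1(2) by blast
      have "ennreal (f (snd i) - f (fst i)) \<le> ennreal p * ennreal (snd i - fst i)"
        using i pq by (auto simp: K1_def ennreal_mult'[symmetric] intro!: ennreal_leI)
      then show "emeasure ?\<nu> (?I i) \<le> emeasure (scale_measure p lborel) (?I i)"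
        using k1[OF i] by (simp add: nu)
    qed auto
    also have "\<dots> = ennreal p * emeasure lborel (\<Union>i\<in>C1. ?I i)" by simp
    also have "\<dots> \<le> ennreal p * emeasure lborel U"
      using C1(2) U(1) by (intro mult_left_mono emeasure_mono) (force simp: K1_def)+
    also have "\<dots> \<le> ennreal p * (emeasure lborel E + ennreal e)"
    proof (intro mult_left_mono)
      have "emeasure lborel U = emeasure lborel (E \<union> (U - E))" using U(2) by (simp add: Un_absorb1)
      also have "\<dots> \<le> emeasure lborel E + emeasure lborel (U - E)"
        using E(1) U(1) by (intro emeasure_subadditive) auto
      also have "\<dots> \<le> emeasure lborel E + ennreal e"
        using U(3) by (intro add_left_mono) auto
      finally show "emeasure lborel U \<le> emeasure lborel E + ennreal e" .
    qed simp
    finally show ?thesis .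
  qed
  define m where "m = measure lborel E"
  have m: "emeasure lborel E = ennreal m" "m \<ge> 0"
    using fin by (auto simp: m_def emeasure_eq_ennreal_measure less_top)
  have *: "q * m \<le> p * (m + e)" if "e > 0" for e
  proof -
    have "ennreal (q * m) = ennreal q * emeasure lborel E"
      unfolding m(1) using pq m(2) by (intro ennreal_mult) auto
    also have "\<dots> \<le> ennreal p * (emeasure lborel E + ennreal e)" using key that by blast
    also have "\<dots> = ennreal p * ennreal (m + e)"
      unfolding m(1) using m(2) that by (subst ennreal_plus) auto
    also have "\<dots> = ennreal (p * (m + e))" using pq m(2) that by (intro ennreal_mult[symmetric]) auto
    finally have "ennreal (q * m) \<le> ennreal (p * (m + e))" .
    moreover have "0 \<le> p * (m + e)" using pq m(2) that by simp
    ultimately show ?thesis by (simp only: ennreal_le_iff)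
  qed
  have "q * m \<le> p * m"
  proof (rule field_le_epsilon)
    fix e :: real assume "e > 0"
    then have "q * m \<le> p * (m + e / (p + 1))" using pq by (intro *) (auto simp: divide_pos_pos)
    also have "\<dots> \<le> p * m + e" using pq \<open>e > 0\<close> by (simp add: field_simps)
    finally show "q * m \<le> p * m + e" .
  qed
  then have "m = 0" using pq m(2)
    by (metis less_eq_real_def mult_le_cancel_right not_less)
  then show ?thesis using m E by (simp add: null_sets_def)
qed

text \<open>If the lower derivative at \<open>t\<close> is below the upper one, rationals
  \<open>p < q\<close> fit in between and \<open>t\<close> lies in a slope-crossing set. Countably
  many of these null sets occur. The Lipschitz bound keeps the upper derivative finite.\<close>

lemma mono_Lipschitz_differentiable_AE:
  fixes f :: "real \<Rightarrow> real"
  assumes mono: "\<And>x y. x \<le> y \<Longrightarrow> f x \<le> f y" and lip: "L-lipschitz_on UNIV f"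
  shows "AE t in lborel. \<exists>D. (f has_real_derivative D) (at t)"
proof -
  have cont: "continuous_on UNIV f" using lip by (rule lipschitz_on_continuous_on)
  \<comment> \<open>Points interior to a short interval of slope below \<open>p\<close>. As unions
    of open intervals these sets are open, which gives the measurability of \<open>E\<close> at
    once.\<close>
  define Lo where "Lo p n = \<Union>{{r<..<s} | r s. s - r < inverse (real (Suc n)) \<and> f s - f r < p * (s - r)}" for p n
  define Hi where "Hi p n = \<Union>{{r<..<s} | r s. s - r < inverse (real (Suc n)) \<and> f s - f r > p * (s - r)}" for p n
  have op: "open (Lo p n)" "open (Hi p n)" for p n by (auto simp: Lo_def Hi_def)
  define E where "E p q N = {-real N<..<real N} \<inter> (\<Inter>n. Lo p n) \<inter> (\<Inter>n. Hi q n)" for p q N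
  have E: "E p q N \<in> null_sets lborel" if "0 \<le> p" "p < q" for p q N
  proof (rule null_sets_slope_crossing[OF mono cont that])
    show "E p q N \<in> sets borel" unfolding E_def using op by (intro sets.Int sets.countable_INT) auto
    show "bounded (E p q N)" by (rule bounded_subset[of "{-real N<..<real N}"]) (auto simp: E_def)
  next
    fix t d :: real assume t: "t \<in> E p q N" "0 < d"
    then obtain n where n: "inverse (real (Suc n)) < d" using reals_Archimedean by blast
    have "t \<in> Lo p n" "t \<in> Hi q n" using t by (auto simp: E_def)
    then show "\<exists>r s. r < t \<and> t < s \<and> s - r < d \<and> f s - f r \<le> p * (s - r)"
      "\<exists>r s. r < t \<and> t < s \<and> s - r < d \<and> f s - f r \<ge> q * (s - r)"
      using n unfolding Lo_def Hi_def by fastforce+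
  qed
  have "AE t in lborel. t \<notin> (\<Union>p\<in>\<rat> \<inter> {0..}. \<Union>q\<in>\<rat> \<inter> {p<..}. \<Union>N. E p q N)"
  proof (rule AE_not_in, intro null_sets_UN')
    show "countable (\<rat> \<inter> {0::real..})" "countable (\<rat> \<inter> {p<..})" for p :: real
      by (simp_all add: countable_rat countable_Int1)
  qed (use E in auto)
  moreover have "\<exists>D. (f has_real_derivative D) (at t)"
    if t: "t \<notin> (\<Union>p\<in>\<rat> \<inter> {0..}. \<Union>q\<in>\<rat> \<inter> {p<..}. \<Union>N. E p q N)" for t
  proof -
    define Q where "Q h = (f (t + h) - f t) / h" for h
    have Q0: "0 \<le> Q h" for h
      using mono[of t "t + h"] mono[of "t + h" t] by (cases "h \<ge> 0") (auto simp: Q_def divide_nonneg_nonneg divide_nonpos_nonpos)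
    have QL: "Q h \<le> L" if "h \<noteq> 0" for h
    proof -
      have "\<bar>Q h\<bar> \<le> L"
        using lipschitz_onD[OF lip, of "t + h" t] that by (simp add: Q_def dist_real_def divide_le_eq)
      then show ?thesis by simp
    qed
    \<comment> \<open>A difference quotient at \<open>t\<close> uses an interval with
      \<open>t\<close> as an endpoint, whereas \<open>Lo\<close> and \<open>Hi\<close> want
      \<open>t\<close> in the interior. \<open>G p h u\<close> is the excess over slope
      \<open>p\<close> after widening by \<open>u\<close> on both sides; at \<open>u = 0\<close> it
      has the sign of \<open>Q h - p\<close>, and continuity keeps this sign for small
      \<open>u\<close>.\<close>
    define G where "G p h u = f (t + max h 0 + u) - f (t + min h 0 - u) - p * (\<bar>h\<bar> + 2 * u)" for p h u
    have G0: "G p h 0 = \<bar>h\<bar> * (Q h - p)" if "h \<noteq> 0" for p h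
      using that by (auto simp: G_def Q_def max_def min_def field_simps)
    have contG: "(G p h \<longlongrightarrow> G p h 0) (at_right 0)" for p h
    proof -
      have "continuous_on UNIV (G p h)" unfolding G_def
        by (intro continuous_intros continuous_on_compose2[OF cont]) auto
      then have "(G p h \<longlongrightarrow> G p h 0) (at 0 within UNIV)" by (simp add: continuous_on_def)
      then show ?thesis by (rule tendsto_within_subset) simp
    qed
    have small: "\<forall>\<^sub>F u in at_right 0. 0 < u \<and> \<bar>h\<bar> + 2 * u < c" if "\<bar>h\<bar> < c" for h c :: real
      using that unfolding eventually_at_right_field by (intro exI[of _ "(c - \<bar>h\<bar>) / 2"]) (auto simp: field_simps)
    have slope_lo: "t \<in> Lo p n" if h: "h \<noteq> 0" "Q h < p" "\<bar>h\<bar> < inverse (real (Suc n))" for h p n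
    proof -
      have "\<forall>\<^sub>F u in at_right 0. G p h u < 0"
        using contG by (rule order_tendstoD) (use h in \<open>simp add: G0 mult_pos_neg\<close>)
      with small[OF h(3)] have "\<forall>\<^sub>F u in at_right 0. G p h u < 0 \<and> 0 < u \<and> \<bar>h\<bar> + 2 * u < inverse (real (Suc n))"
        by eventually_elim auto
      then obtain u where "G p h u < 0" "0 < u" "\<bar>h\<bar> + 2 * u < inverse (real (Suc n))"
        using eventually_happens'[OF trivial_limit_at_right_real] by blast
      moreover have "t + max h 0 + u - (t + min h 0 - u) = \<bar>h\<bar> + 2 * u" by (auto simp: max_def min_def)
      ultimately show ?thesis unfolding Lo_def G_def
        by (intro UnionI[of "{t + min h 0 - u<..<t + max h 0 + u}"]) (force simp: min_def max_def)+
    qed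
    have slope_hi: "t \<in> Hi p n" if h: "h \<noteq> 0" "Q h > p" "\<bar>h\<bar> < inverse (real (Suc n))" for h p n
    proof -
      have "\<forall>\<^sub>F u in at_right 0. G p h u > 0"
        using contG by (rule order_tendstoD) (use h in \<open>simp add: G0\<close>)
      with small[OF h(3)] have "\<forall>\<^sub>F u in at_right 0. G p h u > 0 \<and> 0 < u \<and> \<bar>h\<bar> + 2 * u < inverse (real (Suc n))"
        by eventually_elim auto
      then obtain u where "G p h u > 0" "0 < u" "\<bar>h\<bar> + 2 * u < inverse (real (Suc n))"
        using eventually_happens'[OF trivial_limit_at_right_real] by blast
      moreover have "t + max h 0 + u - (t + min h 0 - u) = \<bar>h\<bar> + 2 * u" by (auto simp: max_def min_def)
      ultimately show ?thesis unfolding Hi_def G_def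
        by (intro UnionI[of "{t + min h 0 - u<..<t + max h 0 + u}"]) (force simp: min_def max_def)+
    qed
    have near: "\<forall>\<^sub>F h in at 0. h \<noteq> 0 \<and> \<bar>h\<bar> < inverse (real (Suc n))" for n
      unfolding eventually_at by (intro exI[of _ "inverse (real (Suc n))"]) auto
    have lim: "\<exists>D. (Q \<longlongrightarrow> D) (at 0)"
    proof -
      define l where "l = Liminf (at 0) (\<lambda>h. ereal (Q h))"
      define u where "u = Limsup (at 0) (\<lambda>h. ereal (Q h))"
      have "l \<le> u" unfolding l_def u_def by (intro Liminf_le_Limsup) auto
      have "0 \<le> l" unfolding l_def using Q0 by (intro Liminf_bounded) auto
      have "u \<le> ereal L" unfolding u_def
        using QL by (intro Limsup_bounded) (auto simp: eventually_at intro!: exI[of _ 1])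
      have "\<not> l < u"
      proof
        assume "l < u"
        then obtain b where b: "l < ereal b" "ereal b < u" using ereal_dense2 by blast
        obtain c where c: "ereal b < ereal c" "ereal c < u" using ereal_dense2[OF b(2)] by blast
        obtain q where q: "q \<in> \<rat>" "b < q" "q < c" using Rats_dense_in_real[of b c] c by auto
        obtain p where p: "p \<in> \<rat>" "b < p" "p < q" using Rats_dense_in_real[of b q] q by auto
        have "0 \<le> p" using \<open>0 \<le> l\<close> b(1) p(2)
          by (metis ereal_less_eq(5) less_eq_real_def less_trans not_le order_le_less_trans zero_ereal_def ereal_less(2))
        have "t \<in> Lo p n" for n
        proof -
          have "\<not> (\<forall>\<^sub>F h in at 0. ereal p \<le> ereal (Q h))"
          proof
            assume "\<forall>\<^sub>F h in at 0. ereal p \<le> ereal (Q h)"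
            then have "ereal p \<le> l" unfolding l_def by (rule Liminf_bounded)
            then have "ereal p < ereal b" using b(1) by (rule order_le_less_trans)
            then show False using p(2) by simp
          qed
          then have "\<exists>\<^sub>F h in at 0. Q h < p" by (simp add: frequently_def not_less)
          from frequently_ex[OF frequently_eventually_conj[OF this near[of n]]] obtain h where "Q h < p" "h \<noteq> 0" "\<bar>h\<bar> < inverse (real (Suc n))"
            by blast
          then show ?thesis using slope_lo by blast
        qed
        moreover have "t \<in> Hi q n" for n
        proof -
          have "\<not> (\<forall>\<^sub>F h in at 0. ereal (Q h) \<le> ereal q)"
          proof
            assume "\<forall>\<^sub>F h in at 0. ereal (Q h) \<le> ereal q"
            then have "u \<le> ereal q" unfolding u_def by (rule Limsup_bounded)
            with c(2) have "ereal c < ereal q" by (rule order_less_le_trans)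
            then show False using q(3) by simp
          qed
          then have "\<exists>\<^sub>F h in at 0. Q h > q" by (simp add: frequently_def not_less)
          from frequently_ex[OF frequently_eventually_conj[OF this near[of n]]] obtain h where "Q h > q" "h \<noteq> 0" "\<bar>h\<bar> < inverse (real (Suc n))"
            by blast
          then show ?thesis using slope_hi by blast
        qed
        moreover obtain N :: nat where "\<bar>t\<bar> < real N" using reals_Archimedean2 by blast
        ultimately have "t \<in> E p q N" by (auto simp: E_def)
        moreover have "p \<in> \<rat> \<inter> {0..}" "q \<in> \<rat> \<inter> {p<..}" using p q \<open>0 \<le> p\<close> by auto
        ultimately show False using t by blast
      qed
      then have "l = u" using \<open>l \<le> u\<close> by simp
      then obtain D where "l = ereal D" "u = ereal D"
        using \<open>0 \<le> l\<close> \<open>u \<le> ereal L\<close> by (cases l) auto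
      then have "((\<lambda>h. ereal (Q h)) \<longlongrightarrow> ereal D) (at 0)"
        unfolding l_def u_def by (intro Liminf_eq_Limsup) auto
      then show ?thesis by auto
    qed
    then show ?thesis unfolding DERIV_def Q_def by blast
  qed
  ultimately show ?thesis by (auto elim: eventually_mono)
qed

text \<open>Adding \<open>L * x\<close> makes an \<open>L\<close>-Lipschitz function nondecreasing
  and does not affect differentiability.\<close>

lemma Lipschitz_differentiable_AE:
  fixes f :: "real \<Rightarrow> real"
  assumes lip: "L-lipschitz_on UNIV f"
  shows "AE t in lborel. \<exists>D. (f has_real_derivative D) (at t)"
proof -
  have "mono (\<lambda>x. f x + L * x)"
  proof (rule monoI)
    fix x y :: real assume "x \<le> y"
    then show "f x + L * x \<le> f y + L * y"
      using lipschitz_onD[OF lip, of x y] by (simp add: dist_real_def algebra_simps)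
  qed
  moreover have "(L + L)-lipschitz_on UNIV (\<lambda>x. f x + L * x)"
  proof (intro lipschitz_on_add lip)
    show "L-lipschitz_on UNIV ((*) L)"
      using lipschitz_on_nonneg[OF lip]
      by (auto intro!: lipschitz_onI simp: dist_real_def abs_mult simp flip: right_diff_distrib)
  qed
  ultimately have "AE t in lborel. \<exists>D. ((\<lambda>x. f x + L * x) has_real_derivative D) (at t)"
    by (intro mono_Lipschitz_differentiable_AE) (auto dest: monoD)
  then show ?thesis
  proof (rule eventually_mono)
    fix t assume "\<exists>D. ((\<lambda>x. f x + L * x) has_real_derivative D) (at t)"
    then obtain D where "((\<lambda>x. f x + L * x) has_real_derivative D) (at t)" by blast
    then have "((\<lambda>x. (f x + L * x) - L * x) has_real_derivative (D - L * 1)) (at t)"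
      by (intro DERIV_diff DERIV_cmult DERIV_ident)
    then show "\<exists>D. (f has_real_derivative D) (at t)" by auto
  qed
qed

lemma infdist_lessE:
  assumes "infdist x A < e" "A \<noteq> {}"
  obtains a where "a \<in> A" "dist x a < e"
  using assms cInf_less_iff[of "dist x ` A" e] by (auto simp: infdist_notempty bdd_below_image_dist)

text \<open>The distance to \<open>B\<close> is minimal at points of \<open>B\<close>, so where it is differentiable its derivative there is \<open>0\<close>.\<close>

lemma AE_not_porous:
  fixes B :: "real set"
  shows "AE t in lborel. t \<in> B \<longrightarrow> (\<forall>\<eta>>0. \<exists>\<delta>>0. \<forall>s. 0 < \<bar>s\<bar> \<and> \<bar>s\<bar> < \<delta> \<longrightarrow> (\<exists>s'. t + s' \<in> B \<and> \<bar>s' - s\<bar> < \<eta> * \<bar>s\<bar>))"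
proof (cases "B = {}")
  case False
  have "1-lipschitz_on UNIV (\<lambda>t. infdist t B)"
    by (intro lipschitz_onI) (auto simp: dist_real_def[of "infdist _ _"] infdist_triangle_abs)
  then have "AE t in lborel. \<exists>D. ((\<lambda>t. infdist t B) has_real_derivative D) (at t)"
    by (rule Lipschitz_differentiable_AE)
  then show ?thesis
  proof (rule eventually_mono, intro impI allI)
    fix t \<eta> :: real
    assume "\<exists>D. ((\<lambda>t. infdist t B) has_real_derivative D) (at t)" and t: "t \<in> B" and "\<eta> > 0"
    then obtain D where D: "((\<lambda>t. infdist t B) has_real_derivative D) (at t)" by blast
    have "D = 0"
      by (rule DERIV_local_min[OF D, of 1]) (use t in \<open>auto simp: infdist_nonneg\<close>)
    then have "((\<lambda>h. (infdist (t + h) B - infdist t B) / h) \<longlongrightarrow> 0) (at 0)"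
      using D by (simp add: DERIV_def)
    then have "\<forall>\<^sub>F h in at 0. dist ((infdist (t + h) B - infdist t B) / h) 0 < \<eta>"
      using \<open>\<eta> > 0\<close> by (rule tendstoD)
    then obtain \<delta> where \<delta>: "\<delta> > 0" "\<And>h. h \<noteq> 0 \<Longrightarrow> \<bar>h\<bar> < \<delta> \<Longrightarrow> infdist (t + h) B / \<bar>h\<bar> < \<eta>"
      using t unfolding eventually_at by (auto simp: infdist_nonneg)
    show "\<exists>\<delta>>0. \<forall>s. 0 < \<bar>s\<bar> \<and> \<bar>s\<bar> < \<delta> \<longrightarrow> (\<exists>s'. t + s' \<in> B \<and> \<bar>s' - s\<bar> < \<eta> * \<bar>s\<bar>)"
    proof (rule exI[of _ \<delta>], intro conjI allI impI)
      fix s assume s: "0 < \<bar>s\<bar> \<and> \<bar>s\<bar> < \<delta>"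
      then have "infdist (t + s) B < \<eta> * \<bar>s\<bar>" using \<delta>(2)[of s] by (simp add: divide_less_eq)
      then obtain y where "y \<in> B" "dist (t + s) y < \<eta> * \<bar>s\<bar>"
        using False by (rule infdist_lessE)
      then show "\<exists>s'. t + s' \<in> B \<and> \<bar>s' - s\<bar> < \<eta> * \<bar>s\<bar>"
        by (intro exI[of _ "y - t"]) (auto simp: dist_real_def)
    qed fact
  qed
qed simp

section \<open>Finite-dimensional subspaces of normed spaces and quantitative independence\<close>

lemma compact_cball_Int_imp_closed:
  fixes S :: "'v::real_normed_vector set"
  assumes S: "\<And>R. compact (S \<inter> cball 0 R)"
  shows "closed S"
  unfolding closed_sequential_limits
proof (intro allI impI, elim conjE)
  fix x l assume x: "\<forall>n. x n \<in> S" "x \<longlonglongrightarrow> l"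
  then obtain R where "\<And>n. norm (x n) \<le> R"
    by (meson Bseq_def convergentI convergent_imp_Bseq)
  then have "\<forall>n. x n \<in> S \<inter> cball 0 R" using x by auto
  then have "l \<in> S \<inter> cball 0 R"
    using compact_imp_closed[OF S] x(2) closed_sequential_limits by blast
  then show "l \<in> S" by blast
qed

text \<open>Induction on \<open>B\<close>: if \<open>b\<close> lies outside the closed space
  \<open>span B\<close>, its distance \<open>\<delta>\<close> to that space bounds the coefficient
  of \<open>b\<close> in a vector of norm at most \<open>R\<close>, so the ball is cut out of a
  continuous image of a compact product. The ambient space may have infinite dimension; that
  \<open>span B\<close> is closed comes from the induction hypothesis.\<close>

lemma compact_span_Int_cball:
  fixes B :: "'v::real_normed_vector set"
  assumes "finite B"
  shows "compact (span B \<inter> cball 0 R)"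
  using assms
proof (induction B arbitrary: R rule: finite_induct)
  case empty
  then show ?case by (cases "R \<ge> 0") auto
next
  case (insert b B)
  show ?case
  proof (cases "b \<in> span B")
    case True
    then show ?thesis using insert.IH by (simp add: span_redundant)
  next
    case False
    have closed: "closed (span B)"
      using insert.IH by (rule compact_cball_Int_imp_closed)
    define \<delta> where "\<delta> = infdist b (span B)"
    have \<delta>: "\<delta> > 0"
      using infdist_pos_not_in_closed[OF closed _ False] span_0 by (force simp: \<delta>_def)
    have bound: "\<bar>k\<bar> * \<delta> \<le> norm (v + k *\<^sub>R b)" if v: "v \<in> span B" for k v
    proof (cases "k = 0")
      case False
      have "\<delta> \<le> dist b (- (inverse k *\<^sub>R v))"
        unfolding \<delta>_def by (intro infdist_le span_neg span_scale v)
      also have "\<bar>k\<bar> * dist b (- (inverse k *\<^sub>R v)) = norm (k *\<^sub>R (b + inverse k *\<^sub>R v))"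
        by (simp add: dist_norm)
      also have "\<dots> = norm (v + k *\<^sub>R b)" using False by (simp add: algebra_simps)
      finally show ?thesis by (simp add: mult_left_mono)
    qed simp
    let ?M = "\<bar>R\<bar> / \<delta>"
    let ?f = "\<lambda>(v, k). v + k *\<^sub>R b"
    let ?D = "(span B \<inter> cball 0 (\<bar>R\<bar> + ?M * norm b)) \<times> {- ?M..?M}"
    have "compact (?f ` ?D \<inter> cball 0 R)"
      by (intro compact_Int_closed compact_continuous_image compact_Times insert.IH)
        (auto intro!: continuous_intros simp: split_beta)
    moreover have "span (insert b B) \<inter> cball 0 R = ?f ` ?D \<inter> cball 0 R"
    proof (intro equalityI subsetI)
      fix x assume x: "x \<in> span (insert b B) \<inter> cball 0 R"
      then obtain k where k: "x - k *\<^sub>R b \<in> span B" by (auto simp: span_insert)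
      have "\<bar>k\<bar> * \<delta> \<le> norm x" using bound[OF k, of k] by simp
      also have "norm x \<le> \<bar>R\<bar>" using x by auto
      finally have kM: "\<bar>k\<bar> \<le> ?M" using \<delta> by (simp add: pos_le_divide_eq)
      have "norm (x - k *\<^sub>R b) \<le> norm x + \<bar>k\<bar> * norm b"
        using norm_triangle_ineq4[of x "k *\<^sub>R b"] by simp
      also have "\<dots> \<le> \<bar>R\<bar> + ?M * norm b"
        using x kM by (intro add_mono mult_right_mono) auto
      finally have "(x - k *\<^sub>R b, k) \<in> ?D" using k kM by auto
      then show "x \<in> ?f ` ?D \<inter> cball 0 R" using x by (force intro: image_eqI[of _ _ "(x - k *\<^sub>R b, k)"])
    next
      fix x assume "x \<in> ?f ` ?D \<inter> cball 0 R"
      then show "x \<in> span (insert b B) \<inter> cball 0 R"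
        by (auto intro!: span_add span_scale intro: span_base subsetD[OF span_mono[of B]])
    qed
    ultimately show ?thesis by simp
  qed
qed

lemma closed_span_finite:
  fixes B :: "'v::real_normed_vector set"
  assumes "finite B"
  shows "closed (span B)"
  using compact_span_Int_cball[OF assms] by (rule compact_cball_Int_imp_closed)

text \<open>Independence of a finite family, repetitions excluded. Indexing keeps the coefficients
  available under linear maps, perturbations and limits, where a set of vectors could lose
  members.\<close>

definition indep_upto :: "nat \<Rightarrow> (nat \<Rightarrow> 'v::real_vector) \<Rightarrow> bool" where
  "indep_upto d v \<longleftrightarrow> (\<forall>c. (\<Sum>i<d. c i *\<^sub>R v i) = 0 \<longrightarrow> (\<forall>i<d. c i = (0::real)))"

lemma indep_uptoD: "indep_upto d v \<Longrightarrow> (\<Sum>i<d. c i *\<^sub>R v i) = 0 \<Longrightarrow> i < d \<Longrightarrow> c i = 0"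
  by (auto simp: indep_upto_def)

lemma span_image_lessThan:
  fixes v :: "nat \<Rightarrow> 'v::real_vector"
  shows "span (v ` {..<d}) = range (\<lambda>c. \<Sum>i<d. c i *\<^sub>R v i)"
proof (induction d)
  case (Suc d)
  have "span (v ` {..<Suc d}) = {x. \<exists>k. x - k *\<^sub>R v d \<in> range (\<lambda>c. \<Sum>i<d. c i *\<^sub>R v i)}"
    by (simp add: lessThan_Suc span_insert Suc)
  also have "\<dots> = range (\<lambda>c. \<Sum>i<Suc d. c i *\<^sub>R v i)"
  proof (intro equalityI subsetI)
    fix x assume "x \<in> {x. \<exists>k. x - k *\<^sub>R v d \<in> range (\<lambda>c. \<Sum>i<d. c i *\<^sub>R v i)}"
    then obtain k c where "x - k *\<^sub>R v d = (\<Sum>i<d. c i *\<^sub>R v i)" by auto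
    then have "x = (\<Sum>i<Suc d. (c(d := k)) i *\<^sub>R v i)"
      by (simp add: algebra_simps)
    then show "x \<in> range (\<lambda>c. \<Sum>i<Suc d. c i *\<^sub>R v i)" by blast
  next
    fix x assume "x \<in> range (\<lambda>c. \<Sum>i<Suc d. c i *\<^sub>R v i)"
    then obtain c where "x = (\<Sum>i<Suc d. c i *\<^sub>R v i)" by blast
    then have "x - c d *\<^sub>R v d = (\<Sum>i<d. c i *\<^sub>R v i)" by simp
    then show "x \<in> {x. \<exists>k. x - k *\<^sub>R v d \<in> range (\<lambda>c. \<Sum>i<d. c i *\<^sub>R v i)}" by blast
  qed
  finally show ?case .
qed simp

text \<open>Induction on \<open>d\<close>: the last coefficient is controlled by the distance of
  \<open>v d\<close> to the span of the others, and subtracting its term reduces the rest to the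
  induction hypothesis. In this form independence is visibly stable under small perturbations of the
  vectors.\<close>

lemma indep_upto_lower_bound:
  fixes v :: "nat \<Rightarrow> 'v::real_normed_vector"
  assumes "indep_upto d v"
  shows "\<exists>\<kappa>>0. \<forall>c. \<kappa> * (\<Sum>i<d. \<bar>c i\<bar>) \<le> norm (\<Sum>i<d. c i *\<^sub>R v i)"
  using assms
proof (induction d)
  case 0
  then show ?case by (auto intro: exI[of _ 1])
next
  case (Suc d)
  have "indep_upto d v"
    unfolding indep_upto_def
  proof (intro allI impI)
    fix c i assume "(\<Sum>i<d. c i *\<^sub>R v i) = 0" "i < d"
    then show "c i = 0" using indep_uptoD[OF Suc.prems, of "c(d := 0)" i] by simp
  qed
  then obtain \<kappa> where \<kappa>: "\<kappa> > 0" "\<And>c. \<kappa> * (\<Sum>i<d. \<bar>c i\<bar>) \<le> norm (\<Sum>i<d. c i *\<^sub>R v i)"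
    using Suc.IH by blast
  let ?W = "span (v ` {..<d})"
  have closed: "closed ?W" by (intro closed_span_finite) simp
  have nin: "v d \<notin> ?W"
  proof
    assume "v d \<in> ?W"
    then obtain c where "v d = (\<Sum>i<d. c i *\<^sub>R v i)" unfolding span_image_lessThan by auto
    then show False using indep_uptoD[OF Suc.prems, of "c(d := -1)" d] by simp
  qed
  define \<delta> where "\<delta> = infdist (v d) ?W"
  have \<delta>: "\<delta> > 0"
    using infdist_pos_not_in_closed[OF closed _ nin] span_0 by (force simp: \<delta>_def)
  have bound: "\<bar>k\<bar> * \<delta> \<le> norm (w + k *\<^sub>R v d)" if w: "w \<in> ?W" for k w
  proof (cases "k = 0")
    case False
    have "\<delta> \<le> dist (v d) (- (inverse k *\<^sub>R w))"
      unfolding \<delta>_def by (intro infdist_le span_neg span_scale w)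
    also have "\<bar>k\<bar> * dist (v d) (- (inverse k *\<^sub>R w)) = norm (k *\<^sub>R (v d + inverse k *\<^sub>R w))"
      by (simp add: dist_norm)
    also have "\<dots> = norm (w + k *\<^sub>R v d)" using False by (simp add: algebra_simps)
    finally show ?thesis by (simp add: mult_left_mono)
  qed simp
  \<comment> \<open>The two summands bound the first \<open>d\<close> coefficients and the last one,
    in units of the norm of the whole combination.\<close>
  define C where "C = (1 + norm (v d) / \<delta>) / \<kappa> + 1 / \<delta>"
  have "C > 0" using \<delta> \<kappa>(1) by (auto simp: C_def intro!: add_nonneg_pos divide_nonneg_pos)
  show ?case
  proof (intro exI[of _ "1 / C"] conjI allI)
    fix c
    let ?w = "\<Sum>i<d. c i *\<^sub>R v i" and ?N = "norm (\<Sum>i<Suc d. c i *\<^sub>R v i)"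
    have "?w \<in> ?W" unfolding span_image_lessThan by blast
    then have "\<bar>c d\<bar> * \<delta> \<le> ?N" using bound[of ?w "c d"] by simp
    then have cd: "\<bar>c d\<bar> \<le> ?N / \<delta>" using \<delta> by (simp add: pos_le_divide_eq)
    have "\<kappa> * (\<Sum>i<d. \<bar>c i\<bar>) \<le> norm ?w" by (rule \<kappa>)
    also have "\<dots> \<le> ?N + \<bar>c d\<bar> * norm (v d)"
      using norm_triangle_ineq4[of "\<Sum>i<Suc d. c i *\<^sub>R v i" "c d *\<^sub>R v d"] by simp
    also have "\<dots> \<le> ?N + ?N / \<delta> * norm (v d)" using cd by (intro add_left_mono mult_right_mono) auto
    finally have "(\<Sum>i<d. \<bar>c i\<bar>) \<le> ?N * ((1 + norm (v d) / \<delta>) / \<kappa>)"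
      using \<kappa>(1) by (simp add: field_simps)
    then have "(\<Sum>i<Suc d. \<bar>c i\<bar>) \<le> ?N * C" using cd by (simp add: C_def distrib_left)
    then show "1 / C * (\<Sum>i<Suc d. \<bar>c i\<bar>) \<le> ?N" using \<open>C > 0\<close> by (simp add: field_simps)
  qed (use \<open>C > 0\<close> in simp)
qed

lemma indep_upto_inj_independent:
  fixes v :: "nat \<Rightarrow> 'v::real_vector"
  assumes v: "indep_upto d v"
  shows "inj_on v {..<d}" "independent (v ` {..<d})"
proof -
  show inj: "inj_on v {..<d}"
  proof (rule inj_onI, rule ccontr)
    fix i j assume ij: "i \<in> {..<d}" "j \<in> {..<d}" "v i = v j" "i \<noteq> j"
    have "(\<Sum>k<d. (if k = i then 1 else if k = j then -1 else 0) *\<^sub>R v k)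
        = (\<Sum>k<d. (if k = i then v i else 0) + (if k = j then - v j else 0))"
      using ij by (intro sum.cong) auto
    also have "\<dots> = 0" using ij by (simp add: sum.distrib)
    finally show False
      using indep_uptoD[OF v, of "\<lambda>k. if k = i then 1 else if k = j then -1 else 0" i] ij by auto
  qed
  show "independent (v ` {..<d})"
  proof
    assume "dependent (v ` {..<d})"
    then obtain u w where "w \<in> v ` {..<d}" "u w \<noteq> 0" "(\<Sum>w\<in>v ` {..<d}. u w *\<^sub>R w) = 0"
      using dependent_finite[of "v ` {..<d}"] by blast
    then show False
      using indep_uptoD[OF v, of "\<lambda>i. u (v i)"] by (auto simp: sum.reindex[OF inj])
  qed
qed

lemma dim_span_image_lessThan:
  assumes "indep_upto d v"
  shows "dim (span (v ` {..<d})) = d"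
  using indep_upto_inj_independent[OF assms] by (simp add: dim_eq_card_independent card_image)

lemma indep_upto_le_card:
  assumes "indep_upto d v" "finite B" "v ` {..<d} \<subseteq> span B"
  shows "d \<le> card B"
  using independent_span_bound[OF assms(2) indep_upto_inj_independent(2)[OF assms(1)] assms(3)]
    indep_upto_inj_independent(1)[OF assms(1)] by (simp add: card_image)

lemma indep_upto_of_independent:
  fixes B :: "'v::real_vector set"
  assumes "finite B" "independent B"
  obtains v where "indep_upto (card B) v" "v ` {..<card B} = B"
proof -
  obtain v where v: "bij_betw v {0..<card B} B" using ex_bij_betw_nat_finite[OF assms(1)] by blast
  then have v: "inj_on v {..<card B}" "v ` {..<card B} = B"
    by (auto simp: bij_betw_def atLeast0LessThan)
  have "indep_upto (card B) v"
    unfolding indep_upto_def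
  proof (intro allI impI)
    fix c i assume c: "(\<Sum>i<card B. c i *\<^sub>R v i) = 0" "i < card B"
    let ?u = "\<lambda>w. c (the_inv_into {..<card B} v w)"
    have "(\<Sum>w\<in>v ` {..<card B}. ?u w *\<^sub>R w) = (\<Sum>i<card B. c i *\<^sub>R v i)"
      by (subst sum.reindex[OF v(1)]) (auto simp: the_inv_into_f_f[OF v(1)] intro!: sum.cong)
    then have "(\<Sum>w\<in>B. ?u w *\<^sub>R w) = (\<Sum>i<card B. c i *\<^sub>R v i)"
      by (simp only: v(2))
    then have "\<forall>w\<in>B. ?u w = 0"
      using dependent_finite[OF assms(1)] assms(2) c(1) by fastforce
    moreover have "v i \<in> B" using c(2) v(2) by blast
    ultimately have "?u (v i) = 0" by blast
    then show "c i = 0" using c(2) v(1) by (simp add: the_inv_into_f_f)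
  qed
  with v(2) that show thesis by blast
qed

text \<open>McShane's extension: the infimum of the upward cones of slope \<open>L\<close> based on
  the graph. One point \<open>z\<close> of \<open>K\<close> supplies the lower bound that makes the
  infimum finite.\<close>

lemma Lipschitz_extension_real:
  fixes f :: "'x::metric_space \<Rightarrow> real"
  assumes lip: "L-lipschitz_on K f"
  obtains g where "L-lipschitz_on UNIV g" "\<And>x. x \<in> K \<Longrightarrow> g x = f x"
proof (cases "K = {}")
  case True
  have "L-lipschitz_on UNIV (\<lambda>x. 0::real)" using lipschitz_on_nonneg[OF lip] by (auto intro!: lipschitz_onI)
  with True that show thesis by blast
next
  case False
  then obtain z where z: "z \<in> K" by blast
  have L: "L \<ge> 0" by (rule lipschitz_on_nonneg[OF lip])
  define g where "g x = (INF y\<in>K. f y + L * dist x y)" for x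
  have bdd: "bdd_below ((\<lambda>y. f y + L * dist x y) ` K)" for x
  proof (rule bdd_belowI2)
    fix y assume "y \<in> K"
    then have "f z - f y \<le> L * dist z y" using lipschitz_onD[OF lip z] by (force simp: dist_real_def)
    also have "\<dots> \<le> L * (dist z x + dist x y)" using L by (intro mult_left_mono dist_triangle) auto
    finally show "f z - L * dist z x \<le> f y + L * dist x y" by (simp add: algebra_simps)
  qed
  have le: "g x \<le> g x' + L * dist x x'" for x x'
  proof -
    have "g x - L * dist x x' \<le> g x'"
      unfolding g_def[of x']
    proof (rule cINF_greatest[OF False])
      fix y assume y: "y \<in> K"
      have "g x \<le> f y + L * dist x y" unfolding g_def by (rule cINF_lower[OF bdd y])
      also have "\<dots> \<le> f y + L * (dist x x' + dist x' y)"
        using L by (intro add_left_mono mult_left_mono dist_triangle) auto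
      finally show "g x - L * dist x x' \<le> f y + L * dist x' y" by (simp add: algebra_simps)
    qed
    then show ?thesis by simp
  qed
  have "L-lipschitz_on UNIV g"
  proof (rule lipschitz_onI)
    fix x y show "dist (g x) (g y) \<le> L * dist x y"
      using le[of x y] le[of y x] by (simp add: dist_real_def dist_commute)
  qed fact
  moreover have "g x = f x" if x: "x \<in> K" for x
  proof (rule antisym)
    show "g x \<le> f x" unfolding g_def using cINF_lower[OF bdd x, of x] by simp
    show "f x \<le> g x" unfolding g_def
      using lipschitz_onD[OF lip x] by (intro cINF_greatest[OF False]) (force simp: dist_real_def)
  qed
  ultimately show thesis by (rule that)
qed

text \<open>The coordinates in a basis of \<open>span B\<close> are Lipschitz by the lower bound for
  independent families and are extended one by one, at the price of a larger constant. A curve on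
  the whole line has increments of any fixed length and two-sided derivatives.\<close>

lemma Lipschitz_curve_extension:
  fixes \<gamma> :: "real \<Rightarrow> 'v::real_normed_vector"
  assumes lip: "L-lipschitz_on K \<gamma>" and B: "finite B" "\<gamma> ` K \<subseteq> span B"
  obtains \<gamma>' L' where "L'-lipschitz_on UNIV \<gamma>'" "\<And>t. t \<in> K \<Longrightarrow> \<gamma>' t = \<gamma> t"
    "AE t in lborel. \<exists>v\<in>span B. (\<gamma>' has_vector_derivative v) (at t)"
proof -
  obtain B' where "B' \<subseteq> B" "independent B'" "B \<subseteq> span B'"
    using maximal_independent_subset[of B] by blast
  then have "finite B'" "span B' = span B"
    using B(1) by (auto intro: finite_subset simp: span_eq span_superset subset_trans)
  then obtain b m where b: "indep_upto m b" "span (b ` {..<m}) = span B"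
    using indep_upto_of_independent[of B'] \<open>independent B'\<close> by metis
  obtain \<kappa> where \<kappa>: "\<kappa> > 0" "\<And>c. \<kappa> * (\<Sum>i<m. \<bar>c i\<bar>) \<le> norm (\<Sum>i<m. c i *\<^sub>R b i)"
    using indep_upto_lower_bound[OF b(1)] by blast
  have "\<exists>c. \<gamma> t = (\<Sum>i<m. c i *\<^sub>R b i)" if "t \<in> K" for t
    using that B(2) b(2) unfolding span_image_lessThan by blast
  then obtain c where c: "\<And>t. t \<in> K \<Longrightarrow> \<gamma> t = (\<Sum>i<m. c t i *\<^sub>R b i)" by metis
  have "(L / \<kappa>)-lipschitz_on K (\<lambda>t. c t i)" if i: "i < m" for i
  proof (rule lipschitz_onI)
    fix s t assume st: "s \<in> K" "t \<in> K"
    have "\<kappa> * \<bar>c s i - c t i\<bar> \<le> \<kappa> * (\<Sum>j<m. \<bar>c s j - c t j\<bar>)"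
      using i \<kappa>(1) by (intro mult_left_mono member_le_sum) auto
    also have "\<dots> \<le> norm (\<Sum>j<m. (c s j - c t j) *\<^sub>R b j)" by (rule \<kappa>)
    also have "\<dots> = dist (\<gamma> s) (\<gamma> t)"
      using st by (simp add: c dist_norm scaleR_diff_left sum_subtractf)
    also have "\<dots> \<le> L * dist s t" by (rule lipschitz_onD[OF lip st])
    finally show "dist (c s i) (c t i) \<le> L / \<kappa> * dist s t"
      using \<kappa>(1) by (simp add: dist_real_def field_simps)
  qed (use \<kappa>(1) lipschitz_on_nonneg[OF lip] in simp)
  then have "\<exists>g. (L / \<kappa>)-lipschitz_on UNIV g \<and> (\<forall>t\<in>K. g t = c t i)" if "i < m" for i
    using that by (metis Lipschitz_extension_real)
  then obtain g where g: "\<And>i. i < m \<Longrightarrow> (L / \<kappa>)-lipschitz_on UNIV (g i)"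
    "\<And>i t. i < m \<Longrightarrow> t \<in> K \<Longrightarrow> g i t = c t i"
    by metis
  define \<gamma>' where "\<gamma>' t = (\<Sum>i<m. g i t *\<^sub>R b i)" for t
  show thesis
  proof
    show "(\<Sum>i<m. L / \<kappa> * norm (b i))-lipschitz_on UNIV \<gamma>'"
    proof (rule lipschitz_onI)
      fix s t :: real
      have "dist (\<gamma>' s) (\<gamma>' t) = norm (\<Sum>i<m. (g i s - g i t) *\<^sub>R b i)"
        by (simp add: \<gamma>'_def dist_norm scaleR_diff_left sum_subtractf)
      also have "\<dots> \<le> (\<Sum>i<m. norm ((g i s - g i t) *\<^sub>R b i))" by (rule norm_sum)
      also have "\<dots> \<le> (\<Sum>i<m. (L / \<kappa> * dist s t) * norm (b i))"
      proof (rule sum_mono)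
        fix i assume "i \<in> {..<m}"
        then have "\<bar>g i s - g i t\<bar> \<le> L / \<kappa> * dist s t"
          using lipschitz_onD[OF g(1), of i s t] by (simp add: dist_real_def)
        then show "norm ((g i s - g i t) *\<^sub>R b i) \<le> (L / \<kappa> * dist s t) * norm (b i)"
          unfolding norm_scaleR by (rule mult_right_mono) simp
      qed
      finally show "dist (\<gamma>' s) (\<gamma>' t) \<le> (\<Sum>i<m. L / \<kappa> * norm (b i)) * dist s t"
        by (simp add: sum_distrib_left sum_distrib_right mult_ac)
    qed (use \<kappa>(1) lipschitz_on_nonneg[OF lip] in \<open>auto intro!: sum_nonneg\<close>)
    show "\<gamma>' t = \<gamma> t" if "t \<in> K" for t
      using that by (simp add: \<gamma>'_def g(2) c)
    have "AE t in lborel. \<forall>i\<in>{..<m}. \<exists>D. (g i has_real_derivative D) (at t)"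
      using g(1) by (intro AE_finite_allI) (auto intro: Lipschitz_differentiable_AE)
    then show "AE t in lborel. \<exists>v\<in>span B. (\<gamma>' has_vector_derivative v) (at t)"
    proof (rule eventually_mono)
      fix t assume "\<forall>i\<in>{..<m}. \<exists>D. (g i has_real_derivative D) (at t)"
      then obtain D where "\<And>i. i < m \<Longrightarrow> (g i has_real_derivative D i) (at t)" by (metis lessThan_iff)
      then have "(\<gamma>' has_vector_derivative (\<Sum>i<m. g i t *\<^sub>R 0 + D i *\<^sub>R b i)) (at t)"
        unfolding \<gamma>'_def by (intro has_vector_derivative_sum has_vector_derivative_scaleR) auto
      moreover have "(\<Sum>i<m. g i t *\<^sub>R 0 + D i *\<^sub>R b i) \<in> span B"
        unfolding b(2)[symmetric] by (intro span_sum span_add span_scale span_zero span_base) auto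
      ultimately show "\<exists>v\<in>span B. (\<gamma>' has_vector_derivative v) (at t)" by blast
    qed
  qed
qed

lemma Lipschitz_curve_differentiable_AE:
  fixes \<gamma> :: "real \<Rightarrow> 'v::real_normed_vector"
  assumes lip: "L-lipschitz_on K \<gamma>" and B: "finite B" "\<gamma> ` K \<subseteq> span B"
  shows "AE t in lborel. t \<in> K \<longrightarrow> (\<exists>v\<in>span B. (\<gamma> has_vector_derivative v) (at t within K))"
proof -
  obtain \<gamma>' L' where \<gamma>': "L'-lipschitz_on UNIV \<gamma>'" "\<And>t. t \<in> K \<Longrightarrow> \<gamma>' t = \<gamma> t"
    "AE t in lborel. \<exists>v\<in>span B. (\<gamma>' has_vector_derivative v) (at t)"
    using Lipschitz_curve_extension[OF assms] by blast
  from \<gamma>'(3) show ?thesis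
    by (rule eventually_mono)
      (metis \<gamma>'(2) has_vector_derivative_at_within has_vector_derivative_transform)
qed

section \<open>Length of curves and strict convexity\<close>

lemma has_vector_derivative_within_alt:
  "(c has_vector_derivative v) (at t within K) \<longleftrightarrow>
    (\<forall>e>0. \<exists>\<delta>>0. \<forall>s\<in>K. \<bar>s - t\<bar> < \<delta> \<longrightarrow> norm (c s - c t - (s - t) *\<^sub>R v) \<le> e * \<bar>s - t\<bar>)"
  unfolding has_vector_derivative_def has_derivative_within_alt
  by (simp add: bounded_linear_scaleR_left)

lemma has_vector_derivative_sequentially:
  fixes c :: "real \<Rightarrow> 'v::real_normed_vector"
  assumes "(c has_vector_derivative v) (at t)"
  shows "(\<lambda>n. (c (t + inverse (real (Suc n))) - c t) /\<^sub>R inverse (real (Suc n))) \<longlonglongrightarrow> v"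
proof (rule LIMSEQ_I)
  fix e :: real assume "e > 0"
  then obtain \<delta> where \<delta>: "\<delta> > 0" "\<And>s. \<bar>s - t\<bar> < \<delta> \<Longrightarrow> norm (c s - c t - (s - t) *\<^sub>R v) \<le> e / 2 * \<bar>s - t\<bar>"
    using assms unfolding has_vector_derivative_within_alt by (metis UNIV_I half_gt_zero)
  obtain N where N: "inverse (real (Suc N)) < \<delta>" using reals_Archimedean \<delta>(1) by blast
  show "\<exists>no. \<forall>n\<ge>no. norm ((c (t + inverse (real (Suc n))) - c t) /\<^sub>R inverse (real (Suc n)) - v) < e"
  proof (intro exI[of _ N] allI impI)
    fix n assume "N \<le> n"
    define h where "h = inverse (real (Suc n))"
    have "h \<le> inverse (real (Suc N))" unfolding h_def using \<open>N \<le> n\<close> by (intro le_imp_inverse_le) auto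
    then have "h < \<delta>" using N by (rule order_le_less_trans)
    have "0 < h" by (simp add: h_def)
    note h = this \<open>h < \<delta>\<close>
    have "norm ((c (t + h) - c t) /\<^sub>R h - v) = norm ((c (t + h) - c t - h *\<^sub>R v) /\<^sub>R h)"
      using h by (simp add: scaleR_diff_right)
    also have "\<dots> = norm (c (t + h) - c t - h *\<^sub>R v) / h" using h by (simp add: divide_inverse mult.commute)
    also have "\<dots> \<le> e / 2" using \<delta>(2)[of "t + h"] h by (simp add: pos_divide_le_eq)
    finally show "norm ((c (t + inverse (real (Suc n))) - c t) /\<^sub>R inverse (real (Suc n)) - v) < e"
      using \<open>e > 0\<close> by (simp add: h_def)
  qed
qed

text \<open>For a Lipschitz curve this limsup along fixed steps is measurable and bounded by the
  Lipschitz constant at every time, and it is the norm of the derivative wherever that exists. It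
  spares a measurable choice of derivatives.\<close>

definition speed :: "(real \<Rightarrow> 'v::real_normed_vector) \<Rightarrow> real \<Rightarrow> real" where
  "speed c t = real_of_ereal (limsup (\<lambda>n. ereal (norm ((c (t + inverse (real (Suc n))) - c t) /\<^sub>R inverse (real (Suc n))))))"

lemma speed_eq:
  assumes "(c has_vector_derivative v) (at t)"
  shows "speed c t = norm v"
proof -
  have "(\<lambda>n. ereal (norm ((c (t + inverse (real (Suc n))) - c t) /\<^sub>R inverse (real (Suc n))))) \<longlonglongrightarrow> ereal (norm v)"
    using tendsto_norm[OF has_vector_derivative_sequentially[OF assms]] by simp
  from lim_imp_Limsup[OF _ this] show ?thesis by (simp add: speed_def)
qed

lemma Lipschitz_quotient_le:
  fixes c :: "real \<Rightarrow> 'v::real_normed_vector"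
  assumes "L-lipschitz_on UNIV c"
  shows "norm ((c (t + h) - c t) /\<^sub>R h) \<le> L"
proof (cases "h = 0")
  case False
  then show ?thesis
    using lipschitz_onD[OF assms, of "t + h" t] unfolding norm_scaleR by (simp add: dist_norm field_simps)
qed (use lipschitz_on_nonneg[OF assms] in simp)

lemma borel_measurable_quotient:
  fixes c :: "real \<Rightarrow> 'v::real_normed_vector"
  assumes "L-lipschitz_on UNIV c"
  shows "(\<lambda>t. norm ((c (t + h) - c t) /\<^sub>R h)) \<in> borel_measurable borel"
  by (intro borel_measurable_continuous_onI continuous_intros
      continuous_on_compose2[OF lipschitz_on_continuous_on[OF assms]]) auto

lemma borel_measurable_speed:
  assumes "L-lipschitz_on UNIV c"
  shows "speed c \<in> borel_measurable borel"
  unfolding speed_def using borel_measurable_quotient[OF assms]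
  by (intro borel_measurable_real_of_ereal borel_measurable_limsup borel_measurable_ereal)

lemma speed_bounds:
  assumes "L-lipschitz_on UNIV c"
  shows "0 \<le> speed c t" "speed c t \<le> L"
proof -
  let ?q = "\<lambda>n. ereal (norm ((c (t + inverse (real (Suc n))) - c t) /\<^sub>R inverse (real (Suc n))))"
  have "limsup ?q \<le> ereal L"
    by (intro Limsup_bounded always_eventually allI) (simp only: ereal_less_eq Lipschitz_quotient_le[OF assms])
  moreover have "0 \<le> limsup ?q"
    by (intro le_Limsup always_eventually allI) auto
  ultimately show "0 \<le> speed c t" "speed c t \<le> L"
    unfolding speed_def by (cases "limsup ?q"; auto)+
qed

lemma bounded_measurable_integrable_Icc:
  fixes f :: "real \<Rightarrow> real"
  assumes "f \<in> borel_measurable borel" "\<And>t. \<bar>f t\<bar> \<le> L"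
  shows "set_integrable lborel {a..b} f" "f integrable_on {a..b}"
proof -
  show *: "set_integrable lborel {a..b} f"
    unfolding set_integrable_def
  proof (rule Bochner_Integration.integrable_bound)
    show "integrable lborel (\<lambda>t. indicator {a..b} t * L)"
      by (intro integrable_mult_left integrable_real_indicator) (auto simp: emeasure_lborel_Icc_eq)
  qed (use assms in \<open>auto simp: indicator_def intro: order_trans[OF _ abs_ge_self]\<close>)
  show "f integrable_on {a..b}" by (rule set_borel_integral_eq_integral(1)[OF *])
qed

lemma bounded_convergence_Icc:
  fixes f :: "nat \<Rightarrow> real \<Rightarrow> real"
  assumes f: "\<And>n. f n \<in> borel_measurable borel" "\<And>n t. \<bar>f n t\<bar> \<le> L"
    and g: "g \<in> borel_measurable borel" "\<And>t. \<bar>g t\<bar> \<le> L"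
    and lim: "AE t in lborel. t \<in> {a..b} \<longrightarrow> (\<lambda>n. f n t) \<longlonglongrightarrow> g t"
  shows "(\<lambda>n. integral {a..b} (f n)) \<longlonglongrightarrow> integral {a..b} g"
proof -
  have "(\<lambda>n. \<integral>t. indicator {a..b} t *\<^sub>R f n t \<partial>lborel) \<longlonglongrightarrow> (\<integral>t. indicator {a..b} t *\<^sub>R g t \<partial>lborel)"
  proof (rule integral_dominated_convergence)
    show "integrable lborel (\<lambda>t. indicator {a..b} t * L)"
      by (intro integrable_mult_left integrable_real_indicator) (auto simp: emeasure_lborel_Icc_eq)
    show "AE t in lborel. (\<lambda>n. indicator {a..b} t *\<^sub>R f n t) \<longlonglongrightarrow> indicator {a..b} t *\<^sub>R g t"
      using lim by (rule eventually_mono) (auto simp: indicator_def)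
  qed (use f g in \<open>auto simp: indicator_def intro: order_trans[OF _ abs_ge_self]\<close>)
  then show ?thesis
    using set_borel_integral_eq_integral(2)[OF bounded_measurable_integrable_Icc(1)[OF f]]
      set_borel_integral_eq_integral(2)[OF bounded_measurable_integrable_Icc(1)[OF g]]
    by (simp add: set_lebesgue_integral_def)
qed

lemma integral_quotient_tendsto_speed:
  fixes c :: "real \<Rightarrow> 'v::real_normed_vector"
  assumes lip: "L-lipschitz_on UNIV c" and diff: "AE t in lborel. \<exists>v. (c has_vector_derivative v) (at t)"
  shows "(\<lambda>n. integral {a..b} (\<lambda>t. norm ((c (t + inverse (real (Suc n))) - c t) /\<^sub>R inverse (real (Suc n)))))
    \<longlonglongrightarrow> integral {a..b} (speed c)"
proof (rule bounded_convergence_Icc[of _ L])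
  show "\<bar>norm ((c (t + inverse (real (Suc n))) - c t) /\<^sub>R inverse (real (Suc n)))\<bar> \<le> L" for n t
    using Lipschitz_quotient_le[OF lip] by (simp only: abs_norm_cancel)
  show "AE t in lborel. t \<in> {a..b} \<longrightarrow>
     (\<lambda>n. norm ((c (t + inverse (real (Suc n))) - c t) /\<^sub>R inverse (real (Suc n)))) \<longlonglongrightarrow> speed c t"
    using diff
  proof (rule eventually_mono, intro impI)
    fix t assume "\<exists>v. (c has_vector_derivative v) (at t)"
    then obtain v where v: "(c has_vector_derivative v) (at t)" by blast
    then show "(\<lambda>n. norm ((c (t + inverse (real (Suc n))) - c t) /\<^sub>R inverse (real (Suc n)))) \<longlonglongrightarrow> speed c t"
      unfolding speed_eq[OF v] by (intro tendsto_norm has_vector_derivative_sequentially)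
  qed
  show "(\<lambda>t. norm ((c (t + inverse (real (Suc n))) - c t) /\<^sub>R inverse (real (Suc n)))) \<in> borel_measurable borel" for n
    by (rule borel_measurable_quotient[OF lip])
qed (use borel_measurable_speed[OF lip] speed_bounds[OF lip] in auto)

lemma integral_shift_difference:
  fixes r :: "real \<Rightarrow> real"
  assumes cont: "continuous_on UNIV r" and "a \<le> b" "0 \<le> h"
  shows "integral {a..b} (\<lambda>t. r (t + h) - r t) = integral {b..b + h} r - integral {a..a + h} r"
proof -
  have int: "r integrable_on {u..v}" for u v
    using cont by (intro integrable_continuous_interval) (auto intro: continuous_on_subset)
  have ints: "(\<lambda>t. r (t + h)) integrable_on {u..v}" for u v
    by (intro integrable_continuous_interval continuous_on_compose2[OF cont] continuous_intros) auto
  have "integral {a..b} (\<lambda>t. r (t + h)) = integral {a + h..b + h} r"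
    using integral_shift_real_ivl[of "a + h" h "b + h" r] by simp
  moreover have "integral {a..a + h} r + integral {a + h..b + h} r = integral {a..b + h} r"
    by (rule Henstock_Kurzweil_Integration.integral_combine[OF _ _ int]) (use assms in auto)
  moreover have "integral {a..b} r + integral {b..b + h} r = integral {a..b + h} r"
    by (rule Henstock_Kurzweil_Integration.integral_combine[OF _ _ int]) (use assms in auto)
  moreover have "integral {a..b} (\<lambda>t. r (t + h) - r t) = integral {a..b} (\<lambda>t. r (t + h)) - integral {a..b} r"
    by (intro Henstock_Kurzweil_Integration.integral_diff int ints)
  ultimately show ?thesis by simp
qed

text \<open>The chord is at most the length. Let \<open>r\<close> be the distance from the starting
  point. Integrated over \<open>{a..b}\<close>, its increments of step \<open>h\<close> telescope to
  a window near \<open>b\<close> minus a window near \<open>a\<close>, and they are at most the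
  increments of \<open>c\<close>. Dividing by \<open>h\<close> and letting \<open>h\<close> tend to
  \<open>0\<close> gives the claim.\<close>

lemma norm_diff_le_integral_speed:
  fixes c :: "real \<Rightarrow> 'v::real_normed_vector"
  assumes lip: "L-lipschitz_on UNIV c" and diff: "AE t in lborel. \<exists>v. (c has_vector_derivative v) (at t)"
    and ab: "a \<le> b"
  shows "norm (c b - c a) \<le> integral {a..b} (speed c)"
proof -
  define r where "r t = norm (c t - c a)" for t
  have L: "L \<ge> 0" by (rule lipschitz_on_nonneg[OF lip])
  have cont: "continuous_on UNIV c" by (rule lipschitz_on_continuous_on[OF lip])
  have contr: "continuous_on S r" for S
    unfolding r_def by (intro continuous_intros continuous_on_subset[OF cont]) auto
  have int: "r integrable_on {u..v}" for u v by (rule integrable_continuous_interval[OF contr])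
  let ?h = "\<lambda>n. inverse (real (Suc n))"
  have mean: "\<bar>integral {u..u + h} r - h * r u\<bar> \<le> L * h * h" if "h \<ge> 0" for u h
  proof -
    have "\<bar>r t - r u\<bar> \<le> L * h" if t: "t \<in> {u..u + h}" for t
    proof -
      have "\<bar>r t - r u\<bar> \<le> norm (c t - c u)"
        unfolding r_def using norm_triangle_ineq3[of "c t - c a" "c u - c a"] by simp
      also have "\<dots> \<le> L * \<bar>t - u\<bar>"
        using lipschitz_onD[OF lip, of t u] by (simp add: dist_norm)
      also have "\<dots> \<le> L * h" using t L by (intro mult_left_mono) auto
      finally show ?thesis .
    qed
    then have "norm (integral {u..u + h} (\<lambda>t. r t - r u)) \<le> L * h * (u + h - u)"
      using that by (intro integral_bound continuous_intros contr) auto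
    moreover have "integral {u..u + h} (\<lambda>t. r t - r u) = integral {u..u + h} r - h * r u"
      using that by (subst Henstock_Kurzweil_Integration.integral_diff[OF int]) auto
    ultimately show ?thesis using that by (simp add: mult_ac)
  qed
  have le: "r b \<le> integral {a..b} (\<lambda>t. norm ((c (t + ?h n) - c t) /\<^sub>R ?h n)) + 2 * L * ?h n" for n
  proof -
    define h where "h = ?h n"
    have h: "h > 0" by (simp add: h_def)
    \<comment> \<open>Each of the two windows differs by at most \<open>L * h * h\<close> from
      \<open>h\<close> times the value of \<open>r\<close> at its left end, and
      \<open>r a = 0\<close>.\<close>
    have "h * r b \<le> integral {b..b + h} r - integral {a..a + h} r + 2 * (L * h * h)"
      using mean[of h b] mean[of h a] h by (simp add: r_def)
    also have "integral {b..b + h} r - integral {a..a + h} r = integral {a..b} (\<lambda>t. r (t + h) - r t)"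
      using ab h by (simp add: integral_shift_difference[OF contr])
    also have "\<dots> \<le> integral {a..b} (\<lambda>t. h * norm ((c (t + h) - c t) /\<^sub>R h))"
    proof (rule integral_le)
      show "(\<lambda>t. r (t + h) - r t) integrable_on {a..b}"
        by (intro integrable_continuous_interval continuous_intros contr continuous_on_compose2[OF contr[of UNIV]]) auto
      show "(\<lambda>t. h * norm ((c (t + h) - c t) /\<^sub>R h)) integrable_on {a..b}"
        by (intro integrable_continuous_interval continuous_intros continuous_on_compose2[OF cont]) auto
      show "r (t + h) - r t \<le> h * norm ((c (t + h) - c t) /\<^sub>R h)" for t
      proof -
        have eq: "h * norm ((c (t + h) - c t) /\<^sub>R h) = norm (c (t + h) - c t)" using h by simp
        show ?thesis
          using norm_triangle_ineq3[of "c (t + h) - c a" "c t - c a"] unfolding r_def eq by simp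
      qed
    qed
    also have "\<dots> = h * integral {a..b} (\<lambda>t. norm ((c (t + h) - c t) /\<^sub>R h))"
      by simp
    finally have "h * r b \<le> h * (integral {a..b} (\<lambda>t. norm ((c (t + h) - c t) /\<^sub>R h)) + 2 * L * h)"
      by (simp add: algebra_simps)
    then show ?thesis using h unfolding h_def by (simp only: mult_le_cancel_left_pos)
  qed
  have "(\<lambda>n. integral {a..b} (\<lambda>t. norm ((c (t + ?h n) - c t) /\<^sub>R ?h n)) + 2 * L * ?h n)
    \<longlonglongrightarrow> integral {a..b} (speed c) + 2 * L * 0"
    by (intro tendsto_intros integral_quotient_tendsto_speed[OF lip diff] LIMSEQ_inverse_real_of_nat)
  from LIMSEQ_le_const[OF this, of "r b"] le have "r b \<le> integral {a..b} (speed c) + 2 * L * 0" by blast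
  then show ?thesis by (simp add: r_def)
qed

text \<open>An increment is at most the integral of the speed over its window. Averaging the windows
  counts each point with weight at most one; the error \<open>L * h\<close> comes from windows that
  reach beyond \<open>1\<close>.\<close>

lemma integral_increment_le_integral_speed:
  fixes c :: "real \<Rightarrow> 'v::real_normed_vector"
  assumes lip: "L-lipschitz_on UNIV c" and diff: "AE t in lborel. \<exists>v. (c has_vector_derivative v) (at t)"
    and h: "h > 0"
  shows "integral {0..1} (\<lambda>t. norm ((c (t + h) - c t) /\<^sub>R h)) \<le> integral {0..1} (speed c) + L * h"
proof -
  have L: "L \<ge> 0" by (rule lipschitz_on_nonneg[OF lip])
  have cont: "continuous_on UNIV c" by (rule lipschitz_on_continuous_on[OF lip])
  note sp = borel_measurable_speed[OF lip] speed_bounds[OF lip]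
  have int: "speed c integrable_on {u..v}" for u v
    using sp by (intro bounded_measurable_integrable_Icc(2)[of _ L]) auto
  define G where "G t = integral {0..t} (speed c)" for t
  have G0: "0 \<le> G t" for t unfolding G_def using int sp by (intro Henstock_Kurzweil_Integration.integral_nonneg) auto
  have Gdiff: "G t - G s = integral {s..t} (speed c)" if "0 \<le> s" "s \<le> t" for s t
    unfolding G_def using Henstock_Kurzweil_Integration.integral_combine[OF that int] by simp
  have Gle: "integral {s..t} (speed c) \<le> L * (t - s)" "0 \<le> integral {s..t} (speed c)" if "s \<le> t" for s t
    using integral_le[OF int, of "\<lambda>_. L" s t] sp that int
    by (auto simp: mult.commute intro!: Henstock_Kurzweil_Integration.integral_nonneg)
  have "L-lipschitz_on {0..} G"
  proof (rule lipschitz_on_leI)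
    fix s t :: real assume "s \<in> {0..}" "t \<in> {0..}" "s \<le> t"
    then show "dist (G s) (G t) \<le> L * dist s t"
      using Gdiff[of s t] Gle[of s t] by (simp add: dist_real_def abs_if)
  qed fact
  then have contG: "continuous_on {0..} G" by (rule lipschitz_on_continuous_on)
  \<comment> \<open>The shift lemma takes a function that is continuous on the whole line, while
    \<open>G\<close> is controlled for nonnegative times only.\<close>
  then have contG': "continuous_on UNIV (\<lambda>t. G (max 0 t))"
    by (rule continuous_on_compose2) (auto intro!: continuous_intros)
  have inth: "(\<lambda>t. norm (c (t + h) - c t)) integrable_on {0..1}"
    by (intro integrable_continuous_interval continuous_intros continuous_on_compose2[OF cont]) auto
  have "integral {0..1} (\<lambda>t. norm (c (t + h) - c t)) \<le> integral {0..1} (\<lambda>t. G (max 0 (t + h)) - G (max 0 t))"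
  proof (rule integral_le[OF inth])
    show "(\<lambda>t. G (max 0 (t + h)) - G (max 0 t)) integrable_on {0..1}"
      by (intro integrable_continuous_interval continuous_intros continuous_on_compose2[OF contG]) auto
    fix t :: real assume t: "t \<in> {0..1}"
    have "norm (c (t + h) - c t) \<le> integral {t..t + h} (speed c)"
      using h by (intro norm_diff_le_integral_speed[OF lip diff]) auto
    then show "norm (c (t + h) - c t) \<le> G (max 0 (t + h)) - G (max 0 t)"
      using Gdiff[of t "t + h"] t h by simp
  qed
  also have "\<dots> = integral {1..1 + h} (\<lambda>t. G (max 0 t)) - integral {0..0 + h} (\<lambda>t. G (max 0 t))"
    using h by (intro integral_shift_difference[OF contG']) auto
  also have "\<dots> \<le> integral {1..1 + h} (\<lambda>t. G (max 0 t))"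
    using G0 by (auto intro!: Henstock_Kurzweil_Integration.integral_nonneg integrable_continuous_interval continuous_on_subset[OF contG'])
  also have "\<dots> \<le> integral {1..1 + h} (\<lambda>t. G 1 + L * h)"
  proof (rule integral_le)
    show "(\<lambda>t. G (max 0 t)) integrable_on {1..1 + h}"
      by (intro integrable_continuous_interval continuous_on_subset[OF contG']) auto
    fix t :: real assume t: "t \<in> {1..1 + h}"
    then have "G t - G 1 \<le> L * (t - 1)" using Gdiff[of 1 t] Gle[of 1 t] by simp
    also have "\<dots> \<le> L * h" using t L by (intro mult_left_mono) auto
    finally show "G (max 0 t) \<le> G 1 + L * h" using t by simp
  qed auto
  also have "\<dots> = h * (G 1 + L * h)" using h by simp
  finally have le: "integral {0..1} (\<lambda>t. norm (c (t + h) - c t)) \<le> h * (G 1 + L * h)" .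
  have "integral {0..1} (\<lambda>t. norm ((c (t + h) - c t) /\<^sub>R h)) = integral {0..1} (\<lambda>t. norm (c (t + h) - c t)) / h"
    using h by (simp add: divide_inverse mult.commute)
  also have "\<dots> \<le> G 1 + L * h" using le h by (simp add: pos_divide_le_eq mult.commute)
  finally show ?thesis by (simp add: G_def)
qed

text \<open>The step \<open>h\<close> is fixed first. At a fixed step the averaged increments of
  \<open>ck k\<close> converge to those of \<open>c\<close>, and they exceed the integral of the
  speed of \<open>ck k\<close> by at most \<open>L * h\<close>, uniformly in
  \<open>k\<close>.\<close>

lemma integral_speed_lower_semicontinuous:
  fixes c :: "real \<Rightarrow> 'v::real_normed_vector"
  assumes lip: "L-lipschitz_on UNIV c" and diff: "AE t in lborel. \<exists>v. (c has_vector_derivative v) (at t)"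
    and lipk: "\<And>k. L-lipschitz_on UNIV (ck k)"
    and diffk: "\<And>k. AE t in lborel. \<exists>v. (ck k has_vector_derivative v) (at t)"
    and lim: "\<And>t. (\<lambda>k. ck k t) \<longlonglongrightarrow> c t" and "e > 0"
  shows "\<forall>\<^sub>F k in sequentially. integral {0..1} (speed c) - e \<le> integral {0..1} (speed (ck k))"
proof -
  have L: "L \<ge> 0" by (rule lipschitz_on_nonneg[OF lip])
  let ?h = "\<lambda>n. inverse (real (Suc n))"
  have "\<forall>\<^sub>F n in sequentially. integral {0..1} (speed c) - e / 3
      < integral {0..1} (\<lambda>t. norm ((c (t + ?h n) - c t) /\<^sub>R ?h n))"
    using \<open>e > 0\<close> by (intro order_tendstoD(1)[OF integral_quotient_tendsto_speed[OF lip diff]]) auto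
  moreover have "\<forall>\<^sub>F n in sequentially. L * ?h n < e / 3"
  proof (rule order_tendstoD(2))
    show "(\<lambda>n. L * ?h n) \<longlonglongrightarrow> L * 0" by (intro tendsto_intros LIMSEQ_inverse_real_of_nat)
  qed (use \<open>e > 0\<close> in simp)
  ultimately have "\<forall>\<^sub>F n in sequentially. integral {0..1} (speed c) - e / 3
      < integral {0..1} (\<lambda>t. norm ((c (t + ?h n) - c t) /\<^sub>R ?h n)) \<and> L * ?h n < e / 3"
    by eventually_elim auto
  then obtain n where n: "integral {0..1} (speed c) - e / 3
      < integral {0..1} (\<lambda>t. norm ((c (t + ?h n) - c t) /\<^sub>R ?h n))" "L * ?h n < e / 3"
    using eventually_happens' sequentially_bot by blast
  define h where "h = ?h n"
  have "(\<lambda>k. integral {0..1} (\<lambda>t. norm ((ck k (t + h) - ck k t) /\<^sub>R h))) \<longlonglongrightarrow>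
     integral {0..1} (\<lambda>t. norm ((c (t + h) - c t) /\<^sub>R h))"
  proof (rule bounded_convergence_Icc[of _ L])
    show "\<bar>norm ((ck k (t + h) - ck k t) /\<^sub>R h)\<bar> \<le> L" "\<bar>norm ((c (t + h) - c t) /\<^sub>R h)\<bar> \<le> L" for k t
      using Lipschitz_quotient_le[OF lip] Lipschitz_quotient_le[OF lipk] by (simp_all only: abs_norm_cancel)
  qed (use borel_measurable_quotient[OF lip] borel_measurable_quotient[OF lipk] lim in
      \<open>auto intro!: tendsto_intros always_eventually simp del: scaleR_right_diff_distrib norm_scaleR\<close>)
  then have "\<forall>\<^sub>F k in sequentially. integral {0..1} (\<lambda>t. norm ((c (t + h) - c t) /\<^sub>R h)) - e / 3 <
      integral {0..1} (\<lambda>t. norm ((ck k (t + h) - ck k t) /\<^sub>R h))"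
    using \<open>e > 0\<close> by (intro order_tendstoD(1)) auto
  then show ?thesis
  proof (rule eventually_mono)
    fix k assume k: "integral {0..1} (\<lambda>t. norm ((c (t + h) - c t) /\<^sub>R h)) - e / 3 <
      integral {0..1} (\<lambda>t. norm ((ck k (t + h) - ck k t) /\<^sub>R h))"
    have "integral {0..1} (\<lambda>t. norm ((ck k (t + h) - ck k t) /\<^sub>R h)) \<le> integral {0..1} (speed (ck k)) + L * h"
      by (rule integral_increment_le_integral_speed[OF lipk diffk]) (simp add: h_def)
    with k n show "integral {0..1} (speed c) - e \<le> integral {0..1} (speed (ck k))"
      unfolding h_def by linarith
  qed
qed

text \<open>Normalised by \<open>norm v\<close>, both vectors lie in the unit ball and their sum has
  norm \<open>2\<close>. A point \<open>x\<close> of the segment and its mirror image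
  \<open>?y\<close> have the same sum, so both have norm \<open>1\<close>, and the whole segment
  lies on the sphere.\<close>

lemma strictly_convex_midpoint:
  fixes v w :: "'a::real_normed_vector"
  assumes strictly_convex: "\<And>x y::'a. closed_segment x y \<subseteq> sphere 0 1 \<Longrightarrow> x = y"
    and "norm w \<le> norm v" and mid: "norm ((1/2) *\<^sub>R (v + w)) = norm v"
  shows "w = v"
proof (cases "v = 0")
  case False
  define V W where "V = v /\<^sub>R norm v" and "W = w /\<^sub>R norm v"
  have V: "norm V = 1" and W: "norm W \<le> 1"
    using assms False by (auto simp: V_def W_def field_simps)
  have sum: "norm (V + W) = 2"
  proof -
    have VW: "V + W = (v + w) /\<^sub>R norm v" by (simp add: V_def W_def algebra_simps)
    have "norm (v + w) = 2 * norm v" using mid unfolding norm_scaleR by simp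
    then show ?thesis unfolding VW norm_scaleR using False by simp
  qed
  have "closed_segment V W \<subseteq> sphere 0 1"
  proof
    fix x assume "x \<in> closed_segment V W"
    then obtain s where s: "0 \<le> s" "s \<le> 1" "x = (1 - s) *\<^sub>R V + s *\<^sub>R W"
      by (auto simp: closed_segment_def)
    let ?y = "s *\<^sub>R V + (1 - s) *\<^sub>R W"
    have le: "norm (a *\<^sub>R V + b *\<^sub>R W) \<le> 1" if "0 \<le> a" "0 \<le> b" "a + b = 1" for a b
    proof -
      have "norm (a *\<^sub>R V + b *\<^sub>R W) \<le> a * norm V + b * norm W"
        using norm_triangle_ineq[of "a *\<^sub>R V" "b *\<^sub>R W"] that by simp
      also have "\<dots> \<le> a * 1 + b * 1" using V W that by (intro add_mono mult_left_mono) auto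
      finally show ?thesis using that by simp
    qed
    have "x + ?y = V + W" by (simp add: s algebra_simps)
    then have "2 \<le> norm x + norm ?y" using norm_triangle_ineq[of x ?y] sum by simp
    moreover have "norm x \<le> 1" "norm ?y \<le> 1" using le[of "1 - s" s] le[of s "1 - s"] s by auto
    ultimately show "x \<in> sphere 0 1" by simp
  qed
  then have "V = W" by (rule strictly_convex)
  then show ?thesis using False by (simp add: V_def W_def)
qed (use assms in simp)

text \<open>Compactness makes strict convexity uniform: among vectors of norm at most
  \<open>norm v\<close> and at distance at least \<open>e\<close> from \<open>v\<close>, the norm
  defect of the midpoint has a positive minimum.\<close>

lemma strictly_convex_tendsto:
  fixes v :: "'a::real_normed_vector"
  assumes strictly_convex: "\<And>x y::'a. closed_segment x y \<subseteq> sphere 0 1 \<Longrightarrow> x = y"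
    and compact: "\<And>R. compact (cball (0::'a) R)"
    and le: "\<And>k. norm (w k) \<le> norm v"
    and lim: "(\<lambda>k::nat. norm v - norm ((1/2) *\<^sub>R (v + w k))) \<longlonglongrightarrow> 0"
  shows "w \<longlonglongrightarrow> v"
proof (rule tendstoI)
  fix e :: real assume "e > 0"
  let ?K = "cball 0 (norm v) \<inter> {x. e \<le> dist x v}"
  let ?f = "\<lambda>x. norm v - norm ((1/2) *\<^sub>R (v + x))"
  have K: "compact ?K"
    by (intro compact_Int_closed compact closed_Collect_le continuous_intros)
  have pos: "?f x > 0" if "x \<in> ?K" for x
  proof -
    have "x \<noteq> v" "norm x \<le> norm v" using that \<open>e > 0\<close> by auto
    then have "norm ((1/2) *\<^sub>R (v + x)) \<noteq> norm v"
      using strictly_convex_midpoint[OF strictly_convex] by blast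
    moreover have "norm ((1/2) *\<^sub>R (v + x)) \<le> norm v"
      using norm_triangle_ineq[of v x] \<open>norm x \<le> norm v\<close> by simp
    ultimately show ?thesis by simp
  qed
  obtain \<eta> where \<eta>: "\<eta> > 0" "\<And>x. x \<in> ?K \<Longrightarrow> \<eta> \<le> ?f x"
  proof (cases "?K = {}")
    case True
    then show ?thesis using that[of 1] by auto
  next
    case False
    have "continuous_on ?K ?f" by (intro continuous_intros)
    from continuous_attains_inf[OF K False this] obtain x where "x \<in> ?K" "\<And>y. y \<in> ?K \<Longrightarrow> ?f x \<le> ?f y"
      by blast
    then show ?thesis using that[of "?f x"] pos by blast
  qed
  have "\<forall>\<^sub>F k in sequentially. ?f (w k) < \<eta>" using lim \<eta>(1) by (rule order_tendstoD)
  then show "\<forall>\<^sub>F k in sequentially. dist (w k) v < e"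
  proof (rule eventually_mono)
    fix k assume "?f (w k) < \<eta>"
    then have "w k \<notin> ?K" using \<eta>(2)[of "w k"] by linarith
    then show "dist (w k) v < e" using le by simp
  qed
qed

lemma has_vector_derivative_norm_le:
  fixes c g :: "real \<Rightarrow> 'v::real_normed_vector"
  assumes "(c has_vector_derivative v) (at t)" "(g has_vector_derivative w) (at t)"
    and le: "\<And>s. norm (g s - g t) \<le> norm (c s - c t)"
  shows "norm w \<le> norm v"
proof (rule LIMSEQ_le[OF tendsto_norm[OF has_vector_derivative_sequentially[OF assms(2)]]
      tendsto_norm[OF has_vector_derivative_sequentially[OF assms(1)]]])
  show "\<exists>N. \<forall>n\<ge>N. norm ((g (t + inverse (real (Suc n))) - g t) /\<^sub>R inverse (real (Suc n)))
      \<le> norm ((c (t + inverse (real (Suc n))) - c t) /\<^sub>R inverse (real (Suc n)))"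
    unfolding norm_scaleR using le by (intro exI allI impI mult_left_mono) auto
qed

text \<open>A 1-Lipschitz map does not increase speed, so the midpoint curve \<open>c k\<close> is
  no faster than \<open>\<gamma>\<close>. Since it converges to \<open>\<gamma>\<close>, lower
  semicontinuity of length sends the loss of speed \<open>u k\<close> to \<open>0\<close> in L1, and
  where the loss tends to \<open>0\<close>, strict convexity forces the velocities together.\<close>

lemma integral_speed_diff_tendsto_0:
  fixes \<gamma> :: "real \<Rightarrow> 'a::real_normed_vector" and f :: "nat \<Rightarrow> 'a \<Rightarrow> 'a"
  assumes strictly_convex: "\<And>x y::'a. closed_segment x y \<subseteq> sphere 0 1 \<Longrightarrow> x = y"
    and B: "finite B" "span B = (UNIV::'a set)"
    and lip: "L-lipschitz_on UNIV \<gamma>" and f: "\<And>k. 1-lipschitz_on UNIV (f k)"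
    and lim: "\<And>x. (\<lambda>k. f k x) \<longlonglongrightarrow> x"
  shows "(\<lambda>k. integral {0..1} (speed (\<lambda>t. \<gamma> t - f k (\<gamma> t)))) \<longlonglongrightarrow> 0"
proof -
  have compact: "compact (cball (0::'a) R)" for R
    using compact_span_Int_cball[OF B(1), of R] B(2) by simp
  have diff: "AE t in lborel. \<exists>v. (c has_vector_derivative v) (at t)"
    if "M-lipschitz_on UNIV c" for c :: "real \<Rightarrow> 'a" and M
    using Lipschitz_curve_differentiable_AE[OF that B(1)] B(2) by simp
  define c where "c k t = (1/2) *\<^sub>R (\<gamma> t + f k (\<gamma> t))" for k t
  define g where "g k t = \<gamma> t - f k (\<gamma> t)" for k t
  have L: "L \<ge> 0" by (rule lipschitz_on_nonneg[OF lip])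
  have lipf: "L-lipschitz_on UNIV (\<lambda>t. f k (\<gamma> t))" for k
    using lipschitz_on_compose2[OF lip, of 1 "f k"] lipschitz_on_subset[OF f[of k]] by simp
  have lipc: "L-lipschitz_on UNIV (c k)" for k
    using lipschitz_on_cmult_nonneg[OF lipschitz_on_add[OF lip lipf[of k]], of "1/2"]
    unfolding c_def by simp
  have lipg: "(2 * L)-lipschitz_on UNIV (g k)" for k
    using lipschitz_on_diff[OF lip lipf[of k]] unfolding g_def by simp
  have good: "AE t in lborel. \<exists>v w. (\<gamma> has_vector_derivative v) (at t) \<and> (\<forall>k. ((\<lambda>t. f k (\<gamma> t)) has_vector_derivative w k) (at t))"
  proof -
    have "AE t in lborel. \<forall>k. \<exists>w. ((\<lambda>t. f k (\<gamma> t)) has_vector_derivative w) (at t)"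
      unfolding AE_all_countable using diff[OF lipf] by blast
    with diff[OF lip] show ?thesis by eventually_elim metis
  qed
  have good': "AE t in lborel. \<exists>(v::'a) w. speed \<gamma> t = norm v \<and> (\<forall>k. norm (w k) \<le> norm v \<and>
      speed (c k) t = norm ((1/2) *\<^sub>R (v + w k)) \<and> speed (g k) t = norm (v - w k))"
    using good
  proof (rule eventually_mono, elim exE conjE)
    fix t v w assume v: "(\<gamma> has_vector_derivative v) (at t)"
      and w: "\<forall>k. ((\<lambda>t. f k (\<gamma> t)) has_vector_derivative w k) (at t)"
    have "norm (w k) \<le> norm v" for k
      using lipschitz_onD[OF f[of k]]
      by (intro has_vector_derivative_norm_le[OF v spec[OF w]]) (auto simp: dist_norm)
    moreover have "speed (c k) t = norm ((1/2) *\<^sub>R (v + w k))" for k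
      unfolding c_def using v w
      by (intro speed_eq bounded_linear.has_vector_derivative[OF bounded_linear_scaleR_right] has_vector_derivative_add) auto
    moreover have "speed (g k) t = norm (v - w k)" for k
      unfolding g_def using v w by (intro speed_eq has_vector_derivative_diff) auto
    ultimately show "\<exists>(v::'a) w. speed \<gamma> t = norm v \<and> (\<forall>k. norm (w k) \<le> norm v \<and>
      speed (c k) t = norm ((1/2) *\<^sub>R (v + w k)) \<and> speed (g k) t = norm (v - w k))"
      using speed_eq[OF v] by (intro exI[of _ v] exI[of _ w]) blast
  qed
  have int\<gamma>: "set_integrable lborel {0..1} (speed \<gamma>)"
    using speed_bounds[OF lip] by (intro bounded_measurable_integrable_Icc[of _ L] borel_measurable_speed[OF lip]) auto
  have intc: "set_integrable lborel {0..1} (speed (c k))" for k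
    using speed_bounds[OF lipc] by (intro bounded_measurable_integrable_Icc[of _ L] borel_measurable_speed[OF lipc]) auto
  define u where "u k t = indicator {0..1} t *\<^sub>R speed \<gamma> t - indicator {0..1} t *\<^sub>R speed (c k) t" for k and t :: real
  have intu: "integrable lborel (u k)" for k
    unfolding u_def using int\<gamma> intc by (intro Bochner_Integration.integrable_diff) (auto simp: set_integrable_def)
  have u0: "AE t in lborel. \<forall>k. 0 \<le> u k t"
    using good'
  proof (rule eventually_mono, elim exE conjE, intro allI)
    fix t and v :: 'a and w k
    assume "speed \<gamma> t = norm v" and w: "\<forall>k. norm (w k) \<le> norm v \<and>
      speed (c k) t = norm ((1/2) *\<^sub>R (v + w k)) \<and> speed (g k) t = norm (v - w k)"
    moreover have "norm ((1/2) *\<^sub>R (v + w k)) \<le> norm v"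
      using norm_triangle_ineq[of v "w k"] w[rule_format, of k] by simp
    ultimately have "speed (c k) t \<le> speed \<gamma> t" by metis
    then show "0 \<le> u k t" by (auto simp: u_def indicator_def)
  qed
  have Iu: "(\<integral>t. norm (u k t) \<partial>lborel) = integral {0..1} (speed \<gamma>) - integral {0..1} (speed (c k))" for k
  proof -
    have "(\<integral>t. norm (u k t) \<partial>lborel) = (\<integral>t. u k t \<partial>lborel)"
      using u0 intu by (intro integral_cong_AE) auto
    also have "\<dots> = (LINT t:{0..1}|lborel. speed \<gamma> t) - (LINT t:{0..1}|lborel. speed (c k) t)"
      unfolding u_def set_lebesgue_integral_def
      using int\<gamma> intc by (intro Bochner_Integration.integral_diff) (auto simp: set_integrable_def)
    finally show ?thesis
      using set_borel_integral_eq_integral(2)[OF int\<gamma>] set_borel_integral_eq_integral(2)[OF intc] by simp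
  qed
  have limc: "(\<lambda>k. c k t) \<longlonglongrightarrow> \<gamma> t" for t
  proof -
    have "(\<lambda>k. c k t) \<longlonglongrightarrow> (1/2) *\<^sub>R (\<gamma> t + \<gamma> t)" unfolding c_def by (intro tendsto_intros lim)
    then show ?thesis by (simp flip: scaleR_2)
  qed
  have Iu0: "(\<lambda>k. \<integral>t. norm (u k t) \<partial>lborel) \<longlonglongrightarrow> 0"
  proof (rule tendstoI)
    fix e :: real assume "e > 0"
    have "\<forall>\<^sub>F k in sequentially. integral {0..1} (speed \<gamma>) - e / 2 \<le> integral {0..1} (speed (c k))"
      using \<open>e > 0\<close> by (intro integral_speed_lower_semicontinuous[OF lip diff[OF lip] lipc diff[OF lipc] limc]) simp
    then show "\<forall>\<^sub>F k in sequentially. dist (\<integral>t. norm (u k t) \<partial>lborel) 0 < e"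
    proof (rule eventually_mono)
      fix k assume "integral {0..1} (speed \<gamma>) - e / 2 \<le> integral {0..1} (speed (c k))"
      moreover have "0 \<le> (\<integral>t. norm (u k t) \<partial>lborel)" by simp
      then have "0 \<le> integral {0..1} (speed \<gamma>) - integral {0..1} (speed (c k))" unfolding Iu .
      ultimately show "dist (\<integral>t. norm (u k t) \<partial>lborel) 0 < e"
        unfolding Iu dist_real_def using \<open>e > 0\<close> by linarith
    qed
  qed
  show ?thesis
  \<comment> \<open>L1 convergence gives convergence almost everywhere only along a subsequence. So
    a subsequence that stays away from \<open>0\<close> is assumed, and a further subsequence
    contradicts it.\<close>
  proof (rule ccontr)
    assume "\<not> ?thesis"
    then obtain e where e: "e > 0" "\<not> (\<forall>\<^sub>F k in sequentially. dist (integral {0..1} (speed (g k))) 0 < e)"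
      unfolding tendsto_iff g_def by blast
    from e(2) have "infinite {k. \<not> dist (integral {0..1} (speed (g k))) 0 < e}"
      unfolding cofinite_eq_sequentially[symmetric] eventually_cofinite .
    from infinite_enumerate[OF this] obtain r :: "nat \<Rightarrow> nat" where r: "strict_mono r"
      "\<And>k. \<not> dist (integral {0..1} (speed (g (r k)))) 0 < e" by auto
    have "(\<lambda>k. \<integral>t. norm (u (r k) t) \<partial>lborel) \<longlonglongrightarrow> 0"
      using LIMSEQ_subseq_LIMSEQ[OF Iu0 r(1)] by (simp add: o_def)
    from tendsto_L1_AE_subseq[OF intu this] obtain s where s: "strict_mono s"
      "AE t in lborel. (\<lambda>k. u (r (s k)) t) \<longlonglongrightarrow> 0" by blast
    have "(\<lambda>k. integral {0..1} (speed (g (r (s k))))) \<longlonglongrightarrow> integral {0..1} (\<lambda>_::real. 0)"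
    proof (rule bounded_convergence_Icc[of "\<lambda>k. speed (g (r (s k)))" "2 * L" "\<lambda>_. 0"])
      show "\<bar>speed (g (r (s k))) t\<bar> \<le> 2 * L" for k t using speed_bounds[OF lipg] by simp
      show "AE t in lborel. t \<in> {0..1} \<longrightarrow> (\<lambda>k. speed (g (r (s k))) t) \<longlonglongrightarrow> 0"
        using s(2) good'
      proof (eventually_elim, elim exE conjE, intro impI)
        fix t :: real and v :: 'a and w
        assume t: "t \<in> {0..1}" and "(\<lambda>k. u (r (s k)) t) \<longlonglongrightarrow> 0" and v: "speed \<gamma> t = norm v"
         and w: "\<forall>k. norm (w k) \<le> norm v \<and> speed (c k) t = norm ((1/2) *\<^sub>R (v + w k)) \<and> speed (g k) t = norm (v - w k)"
        then have lim0: "(\<lambda>k. norm v - norm ((1/2) *\<^sub>R (v + w (r (s k))))) \<longlonglongrightarrow> 0"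
          unfolding u_def by (simp only: indicator_simps scaleR_one)
        have le: "norm (w (r (s k))) \<le> norm v" for k using w by blast
        have "(\<lambda>k. w (r (s k))) \<longlonglongrightarrow> v"
          by (rule strictly_convex_tendsto[OF _ compact le lim0]) (rule strictly_convex)
        then have "(\<lambda>k. norm (v - w (r (s k)))) \<longlonglongrightarrow> norm (v - v)" by (intro tendsto_intros)
        then show "(\<lambda>k. speed (g (r (s k))) t) \<longlonglongrightarrow> 0" using w by simp
      qed
    qed (use borel_measurable_speed[OF lipg] L in auto)
    then have "\<forall>\<^sub>F k in sequentially. dist (integral {0..1} (speed (g (r (s k))))) 0 < e"
      using e(1) by (auto dest: tendstoD)
    then show False using r(2) by simp
  qed
qed

section \<open>Convex combinations converging almost everywhere\<close>

text \<open>Finitely supported convex weights. Starting at \<open>j\<close> preserves limits of the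
  averaged sequences as \<open>j\<close> grows, and the families shrink with \<open>j\<close>, so
  infima over them increase.\<close>

definition tail_weights :: "nat \<Rightarrow> (nat \<Rightarrow> real) set" where
  "tail_weights j = {w. (\<exists>N. \<forall>k\<ge>N. w k = 0) \<and> (\<forall>k. 0 \<le> w k) \<and> (\<forall>k<j. w k = 0) \<and> (\<Sum>k | w k \<noteq> 0. w k) = 1}"

definition weighted :: "(nat \<Rightarrow> real) \<Rightarrow> (nat \<Rightarrow> real) \<Rightarrow> real" where
  "weighted w a = (\<Sum>k | w k \<noteq> 0. w k * a k)"

lemma tail_weights_finite: "w \<in> tail_weights j \<Longrightarrow> finite {k. w k \<noteq> 0}"
proof -
  assume "w \<in> tail_weights j"
  then obtain N where N: "\<forall>k\<ge>N. w k = 0" by (auto simp: tail_weights_def)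
  have "{k. w k \<noteq> 0} \<subseteq> {..<N}" using N not_le by auto
  then show ?thesis by (rule finite_subset) simp
qed

lemma tail_weights_nonneg: "w \<in> tail_weights j \<Longrightarrow> 0 \<le> w k"
  by (auto simp: tail_weights_def)

lemma tail_weights_ge: "w \<in> tail_weights j \<Longrightarrow> w k \<noteq> 0 \<Longrightarrow> j \<le> k"
  by (auto simp: tail_weights_def not_less[symmetric])

lemma tail_weights_mono: "w \<in> tail_weights j \<Longrightarrow> i \<le> j \<Longrightarrow> w \<in> tail_weights i"
  by (auto simp: tail_weights_def)

lemma weighted_superset:
  assumes "finite A" "{k. w k \<noteq> 0} \<subseteq> A"
  shows "weighted w a = (\<Sum>k\<in>A. w k * a k)"
  unfolding weighted_def using assms by (intro sum.mono_neutral_left) auto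

lemma weighted_const: "w \<in> tail_weights j \<Longrightarrow> weighted w (\<lambda>_. c) = c"
  by (simp add: weighted_def tail_weights_def flip: sum_distrib_right)

lemma weighted_add: "weighted w (\<lambda>k. a k + b k) = weighted w a + weighted w b"
  by (simp add: weighted_def distrib_left sum.distrib)

lemma weighted_cmult: "weighted w (\<lambda>k. c * a k) = c * weighted w a"
  by (simp add: weighted_def sum_distrib_left mult_ac)

lemma weighted_sum: "weighted w (\<lambda>k. \<Sum>i\<in>I. a i k) = (\<Sum>i\<in>I. weighted w (a i))"
  unfolding weighted_def sum_distrib_left by (rule sum.swap)

lemma weighted_mono:
  assumes "w \<in> tail_weights j" "\<And>k. j \<le> k \<Longrightarrow> a k \<le> b k"
  shows "weighted w a \<le> weighted w b"
  unfolding weighted_def using tail_weights_nonneg[OF assms(1)] tail_weights_ge[OF assms(1)] assms(2)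
  by (intro sum_mono mult_left_mono) auto

lemma weighted_bounds:
  assumes "w \<in> tail_weights j" "\<And>k. 0 \<le> a k" "\<And>k. a k \<le> C"
  shows "0 \<le> weighted w a" "weighted w a \<le> C"
  using weighted_mono[OF assms(1), of "\<lambda>_. 0" a] weighted_mono[OF assms(1), of a "\<lambda>_. C"] assms
  by (simp_all add: weighted_const[OF assms(1)])

lemma tail_weights_mid:
  assumes "w \<in> tail_weights j" "w' \<in> tail_weights j"
  shows "(\<lambda>k. (w k + w' k) / 2) \<in> tail_weights j"
    and "weighted (\<lambda>k. (w k + w' k) / 2) a = (weighted w a + weighted w' a) / 2"
proof -
  let ?A = "{k. w k \<noteq> 0} \<union> {k. w' k \<noteq> 0}"
  have A: "finite ?A" using assms by (simp add: tail_weights_finite)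
  have sub: "{k. (w k + w' k) / 2 \<noteq> 0} \<subseteq> ?A" by auto
  show eq: "weighted (\<lambda>k. (w k + w' k) / 2) a = (weighted w a + weighted w' a) / 2" for a
    using weighted_superset[OF A sub, of a] weighted_superset[OF A, of w a] weighted_superset[OF A, of w' a]
    by (simp add: field_simps sum.distrib sum_divide_distrib flip: sum_divide_distrib)
  obtain N M where "\<forall>k\<ge>N. w k = 0" "\<forall>k\<ge>M. w' k = 0"
    using assms by (auto simp: tail_weights_def)
  then have "\<exists>N. \<forall>k\<ge>N. (w k + w' k) / 2 = 0" by (intro exI[of _ "max N M"]) auto
  moreover have "(\<Sum>k | (w k + w' k) / 2 \<noteq> 0. (w k + w' k) / 2) = 1"
    using eq[of "\<lambda>_. 1"] weighted_const[OF assms(1), of 1] weighted_const[OF assms(2), of 1]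
    by (simp add: weighted_def)
  ultimately show "(\<lambda>k. (w k + w' k) / 2) \<in> tail_weights j"
    using assms by (auto simp: tail_weights_def)
qed

lemma tail_weights_nonempty: "(\<lambda>k. if k = j then 1 else 0) \<in> tail_weights j"
proof -
  have "{k. (if k = j then 1 else 0 :: real) \<noteq> 0} = {j}" by auto
  then show ?thesis by (auto simp: tail_weights_def intro: exI[of _ "Suc j"])
qed

text \<open>Near-minimisers of the \<open>L\<^sup>2\<close> norm over the tail hulls form a Cauchy sequence by the parallelogram law.\<close>

lemma convex_combinations_converge_AE:
  fixes g :: "nat \<Rightarrow> 'a \<Rightarrow> real"
  assumes fin: "finite_measure M" and g: "\<And>k. g k \<in> borel_measurable M"
    and g0: "\<And>k x. 0 \<le> g k x" "\<And>k x. g k x \<le> C"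
  obtains \<Lambda> where "\<And>j. \<Lambda> j \<in> tail_weights j"
    "AE x in M. convergent (\<lambda>j. weighted (\<Lambda> j) (\<lambda>k. g k x))"
proof -
  interpret finite_measure M by (rule fin)
  define G where "G w x = weighted w (\<lambda>k. g k x)" for w x
  have Gm[measurable]: "G w \<in> borel_measurable M" for w
    unfolding G_def weighted_def using g by measurable
  have G0: "0 \<le> G w x" "G w x \<le> C" if "w \<in> tail_weights j" for w j x
    unfolding G_def using weighted_bounds[OF that, of "\<lambda>k. g k x" C] g0 by auto
  have int: "integrable M (\<lambda>x. (G w x)\<^sup>2)" if "w \<in> tail_weights j" for w j
    by (rule integrable_const_bound[of _ "C\<^sup>2"]) (use G0[OF that] in \<open>auto intro!: power_mono AE_I2\<close>)
  have bd: "\<bar>G w x - G w' x\<bar> \<le> C" if "w \<in> tail_weights j" "w' \<in> tail_weights i" for w w' i j x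
    using G0[OF that(1), of x] G0[OF that(2), of x] by auto
  define J where "J w = (\<integral>x. (G w x)\<^sup>2 \<partial>M)" for w
  have J0: "0 \<le> J w" for w unfolding J_def by simp
  define a where "a j = (INF w\<in>tail_weights j. J w)" for j
  have bdd: "bdd_below (J ` tail_weights j)" for j using J0 by (intro bdd_belowI2[of _ 0])
  have ne: "tail_weights j \<noteq> {}" for j using tail_weights_nonempty by blast
  have aJ: "a j \<le> J w" if "w \<in> tail_weights j" for j w
    unfolding a_def by (rule cINF_lower[OF bdd that])
  have amono: "a i \<le> a j" if "i \<le> j" for i j
    unfolding a_def[of j] using that by (intro cINF_greatest[OF ne] aJ) (rule tail_weights_mono)
  have aC: "a j \<le> C\<^sup>2 * measure M (space M)" for j
  proof -
    obtain w where l: "w \<in> tail_weights j" using ne by blast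
    have "J w \<le> (\<integral>x. C\<^sup>2 \<partial>M)"
      unfolding J_def using G0[OF l] by (intro integral_mono int[OF l]) (auto intro!: power_mono)
    then show ?thesis using aJ[OF l] by (simp add: mult.commute)
  qed
  have "convergent a"
    using amono aC by (metis convergentI incseq_convergent monoI)
  then have acau: "Cauchy a" by (rule convergent_Cauchy)
  have "\<exists>w\<in>tail_weights j. J w < a j + inverse (real (Suc j))" for j
    using cInf_lessD[of "J ` tail_weights j" "a j + inverse (real (Suc j))"] ne by (auto simp: a_def)
  then obtain \<Lambda> where \<Lambda>: "\<And>j. \<Lambda> j \<in> tail_weights j" "\<And>j. J (\<Lambda> j) < a j + inverse (real (Suc j))" by metis
  define \<delta> where "\<delta> j = inverse (real (Suc j))" for j
  have \<delta>: "\<delta> j \<le> \<delta> i" if "i \<le> j" for i j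
    unfolding \<delta>_def using that by (intro le_imp_inverse_le) auto
  have L2: "(\<integral>x. (G (\<Lambda> i) x - G (\<Lambda> j) x)\<^sup>2 \<partial>M) \<le> 2 * \<bar>a j - a i\<bar> + 4 * \<delta> i" if ij: "i \<le> j" for i j
  proof -
    have l: "\<Lambda> i \<in> tail_weights i" "\<Lambda> j \<in> tail_weights i" using \<Lambda>(1) tail_weights_mono[OF _ ij] by auto
    \<comment> \<open>The midpoint stays in the family of index \<open>i\<close>, so
      \<open>J m \<ge> a i\<close>; in the parallelogram identity this turns near-minimality into
      closeness.\<close>
    define m where "m = (\<lambda>k. (\<Lambda> i k + \<Lambda> j k) / 2)"
    have m: "m \<in> tail_weights i" unfolding m_def by (rule tail_weights_mid(1)[OF l])
    have "(G (\<Lambda> i) x - G (\<Lambda> j) x)\<^sup>2 = 2 * (G (\<Lambda> i) x)\<^sup>2 + 2 * (G (\<Lambda> j) x)\<^sup>2 - 4 * (G m x)\<^sup>2" for x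
      unfolding G_def m_def tail_weights_mid(2)[OF l] by (simp add: power2_eq_square field_simps)
    then have "(\<integral>x. (G (\<Lambda> i) x - G (\<Lambda> j) x)\<^sup>2 \<partial>M) = 2 * J (\<Lambda> i) + 2 * J (\<Lambda> j) - 4 * J m"
      unfolding J_def using int[OF l(1)] int[OF l(2)] int[OF m] by simp
    also have "\<dots> \<le> 2 * (a i + \<delta> i) + 2 * (a j + \<delta> j) - 4 * a i"
      using \<Lambda>(2)[of i] \<Lambda>(2)[of j] aJ[OF m] unfolding \<delta>_def by (smt (verit))
    also have "\<dots> \<le> 2 * \<bar>a j - a i\<bar> + 4 * \<delta> i"
    proof -
      show ?thesis using \<delta>[OF ij] by (smt (verit))
    qed
    finally show ?thesis .
  qed
  have L1: "\<exists>N. \<forall>i\<ge>N. \<forall>j\<ge>N. (\<integral>x. norm (G (\<Lambda> i) x - G (\<Lambda> j) x) \<partial>M) < e" if e: "e > 0" for e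
  proof -
    define m where "m = measure M (space M) + 1"
    have m: "m > 0" by (simp add: m_def add_nonneg_pos)
    \<comment> \<open>The passage from L2 to L1 uses
      \<open>\<bar>y\<bar> \<le> \<eta> + y\<^sup>2 / \<eta>\<close>. This \<open>\<eta>\<close>
      makes the constant part at most \<open>e / 2\<close>, and \<open>\<epsilon>\<close> below
      makes the quadratic part at most \<open>e / 4\<close>.\<close>
    define \<eta> where "\<eta> = e / (2 * m)"
    have \<eta>: "\<eta> > 0" using e m by (simp add: \<eta>_def)
    define \<epsilon> where "\<epsilon> = \<eta> * e / 4"
    have \<epsilon>: "\<epsilon> > 0" using \<eta> e by (simp add: \<epsilon>_def)
    obtain N1 where N1: "\<And>i j. N1 \<le> i \<Longrightarrow> N1 \<le> j \<Longrightarrow> \<bar>a j - a i\<bar> < \<epsilon> / 4"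
      using CauchyD[OF acau, of "\<epsilon> / 4"] \<epsilon> by auto
    obtain N2 where N2: "\<delta> N2 < \<epsilon> / 8" unfolding \<delta>_def using reals_Archimedean[of "\<epsilon> / 8"] \<epsilon> by auto
    have *: "(\<integral>x. norm (G (\<Lambda> i) x - G (\<Lambda> j) x) \<partial>M) < e" if ij: "max N1 N2 \<le> i" "i \<le> j" for i j
    proof -
      have "\<delta> i \<le> \<delta> N2" using ij by (intro \<delta>) auto
      then have lt: "(\<integral>x. (G (\<Lambda> i) x - G (\<Lambda> j) x)\<^sup>2 \<partial>M) < \<epsilon>"
      proof -
        have "\<bar>a j - a i\<bar> < \<epsilon> / 4" using ij by (intro N1) auto
        then show ?thesis using L2[OF ij(2)] N2 \<open>\<delta> i \<le> \<delta> N2\<close> by simp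
      qed
      moreover have i2: "integrable M (\<lambda>x. (G (\<Lambda> i) x - G (\<Lambda> j) x)\<^sup>2)"
        using power_mono[OF bd[OF \<Lambda>(1) \<Lambda>(1)] abs_ge_zero, of _ _ _ 2] by (intro integrable_const_bound[of _ "C\<^sup>2"] AE_I2) auto
      moreover have "(\<integral>x. norm (G (\<Lambda> i) x - G (\<Lambda> j) x) \<partial>M) \<le> (\<integral>x. \<eta> + (G (\<Lambda> i) x - G (\<Lambda> j) x)\<^sup>2 / \<eta> \<partial>M)"
      proof (rule integral_mono)
        show "integrable M (\<lambda>x. norm (G (\<Lambda> i) x - G (\<Lambda> j) x))"
          using bd[OF \<Lambda>(1) \<Lambda>(1)] by (intro integrable_const_bound[of _ C] AE_I2) auto
        show "integrable M (\<lambda>x. \<eta> + (G (\<Lambda> i) x - G (\<Lambda> j) x)\<^sup>2 / \<eta>)" using i2 by simp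
        fix x
        let ?y = "G (\<Lambda> i) x - G (\<Lambda> j) x"
        have "2 * \<eta> * \<bar>?y\<bar> \<le> \<eta>\<^sup>2 + \<bar>?y\<bar>\<^sup>2" by (rule sum_squares_bound)
        moreover have "0 \<le> \<eta> * \<bar>?y\<bar>" using \<eta> by simp
        ultimately have "\<eta> * \<bar>?y\<bar> \<le> \<eta>\<^sup>2 + ?y\<^sup>2" by (simp add: mult.assoc)
        then show "norm ?y \<le> \<eta> + ?y\<^sup>2 / \<eta>" using \<eta> by (simp add: field_simps power2_eq_square)
      qed
      moreover have "(\<integral>x. \<eta> + (G (\<Lambda> i) x - G (\<Lambda> j) x)\<^sup>2 / \<eta> \<partial>M)
          = \<eta> * measure M (space M) + (\<integral>x. (G (\<Lambda> i) x - G (\<Lambda> j) x)\<^sup>2 \<partial>M) / \<eta>"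
        using i2 by simp
      moreover have "\<eta> * measure M (space M) \<le> e / 2"
        using e m by (simp add: \<eta>_def m_def field_simps)
      moreover have "(\<integral>x. (G (\<Lambda> i) x - G (\<Lambda> j) x)\<^sup>2 \<partial>M) / \<eta> \<le> e / 4"
        using lt \<eta> by (simp add: \<epsilon>_def pos_divide_le_eq mult.commute)
      ultimately show ?thesis using e by linarith
    qed
    show ?thesis
    proof (intro exI[of _ "max N1 N2"] allI impI)
      fix i j assume "max N1 N2 \<le> i" "max N1 N2 \<le> j"
      then show "(\<integral>x. norm (G (\<Lambda> i) x - G (\<Lambda> j) x) \<partial>M) < e"
        using *[of i j] *[of j i] by (cases "i \<le> j") (auto simp: abs_minus_commute)
    qed
  qed
  have intG: "integrable M (G (\<Lambda> j))" for j
    using G0[OF \<Lambda>(1)] by (intro integrable_const_bound[of _ C] AE_I2) auto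
  obtain r where r: "strict_mono r" "AE x in M. Cauchy (\<lambda>i. G (\<Lambda> (r i)) x)"
    using cauchy_L1_AE_cauchy_subseq[OF intG L1] by blast
  show thesis
  proof
    \<comment> \<open>A strictly increasing \<open>r\<close> satisfies \<open>r j \<ge> j\<close>,
      so passing to the subsequence keeps the tails.\<close>
    show "\<Lambda> (r j) \<in> tail_weights j" for j
      using \<Lambda>(1)[of "r j"] seq_suble[OF r(1)] by (rule tail_weights_mono)
    show "AE x in M. convergent (\<lambda>j. weighted (\<Lambda> (r j)) (\<lambda>k. g k x))"
      using r(2) by (simp add: G_def Cauchy_convergent_iff)
  qed
qed

section \<open>Measurable fields of subspaces\<close>

lemma countable_dense_span:
  fixes B :: "'v::real_normed_vector set"
  assumes "finite B"
  obtains D where "countable D" "D \<subseteq> span B" "\<And>x \<epsilon>. x \<in> span B \<Longrightarrow> 0 < \<epsilon> \<Longrightarrow> \<exists>y\<in>D. dist x y < \<epsilon>"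
proof
  let ?D = "(\<lambda>c. \<Sum>b\<in>B. c b *\<^sub>R b) ` (B \<rightarrow>\<^sub>E \<rat>)"
  show "countable ?D" using assms by (intro countable_image countable_PiE) (auto intro: countable_rat)
  show "?D \<subseteq> span B" by (auto intro!: span_sum span_scale intro: span_base)
  fix x and \<epsilon> :: real assume x: "x \<in> span B" and \<epsilon>: "0 < \<epsilon>"
  obtain c where c: "x = (\<Sum>b\<in>B. c b *\<^sub>R b)" using x span_finite[OF assms] by auto
  define M where "M = (\<Sum>b\<in>B. norm b) + 1"
  have M: "M > 0" unfolding M_def by (intro add_nonneg_pos sum_nonneg) auto
  have "\<exists>r\<in>\<rat>. \<bar>c b - r\<bar> < \<epsilon> / M" for b
    using Rats_dense_in_real[of "c b - \<epsilon> / M" "c b + \<epsilon> / M"] \<epsilon> M by (force simp: abs_less_iff)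
  then obtain r where r: "\<And>b. r b \<in> \<rat>" "\<And>b. \<bar>c b - r b\<bar> < \<epsilon> / M" by metis
  have "dist x (\<Sum>b\<in>B. restrict r B b *\<^sub>R b) = norm (\<Sum>b\<in>B. (c b - r b) *\<^sub>R b)"
    by (simp add: c dist_norm scaleR_diff_left sum_subtractf)
  also have "\<dots> \<le> (\<Sum>b\<in>B. norm ((c b - r b) *\<^sub>R b))" by (rule norm_sum)
  also have "\<dots> \<le> (\<Sum>b\<in>B. \<epsilon> / M * norm b)"
    unfolding norm_scaleR using r(2) by (intro sum_mono mult_right_mono) (auto intro: less_imp_le)
  also have "\<dots> = \<epsilon> / M * (M - 1)"
  proof -
    have "M - 1 = (\<Sum>b\<in>B. norm b)" by (simp add: M_def)
    then show ?thesis by (simp only: sum_distrib_left)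
  qed
  also have "\<dots> < \<epsilon>" using \<epsilon> M by (simp add: field_simps)
  finally show "\<exists>y\<in>?D. dist x y < \<epsilon>"
    using r(1) by (intro bexI[of _ "\<Sum>b\<in>B. restrict r B b *\<^sub>R b"] imageI) auto
qed

section \<open>Coordinates on \<open>Rn\<close>\<close>

abbreviation Rn_basis :: "nat \<Rightarrow> nat \<Rightarrow>\<^sub>0 real" where
  "Rn_basis i \<equiv> Poly_Mapping.single i 1"

lemma lookup_scaleR: "Poly_Mapping.lookup (r *\<^sub>R v) i = r *\<^sub>R Poly_Mapping.lookup v i"
proof -
  have "finite {i. r *\<^sub>R Poly_Mapping.lookup v i \<noteq> 0}"
    by (rule finite_subset[OF _ finite_keys[of v]]) (auto simp: in_keys_iff)
  then show ?thesis by (simp add: scaleR_poly_mapping_def Abs_poly_mapping_inverse)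
qed

lemma lookup_poly_sum: "Poly_Mapping.lookup (sum f I) i = (\<Sum>j\<in>I. Poly_Mapping.lookup (f j) i)"
  by (induction I rule: infinite_finite_induct) (auto simp: lookup_add)

lemma lookup_sum_Rn_basis:
  "Poly_Mapping.lookup (\<Sum>j<n. c j *\<^sub>R Rn_basis j) i = (if i < n then c i else 0)"
  by (auto simp: lookup_poly_sum lookup_scaleR lookup_single when_def if_distrib[of "(*) _"] cong: if_cong)

lemma indep_upto_Rn_basis: "indep_upto n Rn_basis"
  unfolding indep_upto_def
proof (intro allI impI)
  fix c i assume "(\<Sum>i<n. c i *\<^sub>R Rn_basis i) = 0" "i < n"
  then show "c i = 0" using lookup_sum_Rn_basis[of c n i] by simp
qed

lemma Rn_eq_span: "Rn n = span (Rn_basis ` {..<n})"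
proof (intro equalityI subsetI)
  fix v assume "v \<in> Rn n"
  then have "v = (\<Sum>j<n. Poly_Mapping.lookup v j *\<^sub>R Rn_basis j)"
    by (intro poly_mapping_eqI) (auto simp: lookup_sum_Rn_basis Rn_def in_keys_iff subset_iff)
  then show "v \<in> span (Rn_basis ` {..<n})" unfolding span_image_lessThan by blast
next
  fix v assume "v \<in> span (Rn_basis ` {..<n})"
  then show "v \<in> Rn n" unfolding span_image_lessThan
    by (auto simp: Rn_def in_keys_iff lookup_sum_Rn_basis split: if_splits)
qed

lemma subspace_Rn: "subspace (Rn n)"
  by (simp add: Rn_eq_span)

section \<open>The distance on the Grassmannian and Borel fields of subspaces\<close>

lemma gr_distD:
  assumes VW: "V \<in> Gr n d" "W \<in> Gr n d" and e: "gr_dist V W < e" and v: "v \<in> V" "norm v \<le> 1"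
  obtains w where "w \<in> W" "norm w \<le> 1" "dist v w < e"
proof -
  have W0: "0 \<in> W \<inter> cball 0 1" using VW by (auto simp: Gr_def subspace_0)
  have bdd: "bdd_above ((\<lambda>v. infdist v (W \<inter> cball 0 1)) ` (V \<inter> cball 0 1))"
    by (rule bdd_aboveI2[of _ _ 1]) (auto intro!: infdist_le2[OF W0])
  have "infdist v (W \<inter> cball 0 1) \<le> (SUP v\<in>V \<inter> cball 0 1. infdist v (W \<inter> cball 0 1))"
    using v by (intro cSUP_upper[OF _ bdd]) auto
  also have "\<dots> \<le> gr_dist V W" by (simp add: gr_dist_def)
  also note e
  finally obtain w where "w \<in> W \<inter> cball 0 1" "dist v w < e"
    using W0 by (auto elim!: infdist_lessE)
  with that show thesis by auto
qed

text \<open>A point \<open>v\<close> of \<open>V\<close> near \<open>x\<close> is scaled into the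
  unit ball, which is all that \<open>gr_dist\<close> sees, replaced there by a point of
  \<open>W\<close>, and scaled back; the factor \<open>s\<close> explains the radius. As a
  consequence, the distance to a Borel field of subspaces is a measurable function.\<close>

lemma gr_open_infdist_less: "gr_open n d {V \<in> Gr n d. infdist x V < \<alpha>}"
  unfolding gr_open_def
proof (intro conjI ballI)
  fix V assume V: "V \<in> {V \<in> Gr n d. infdist x V < \<alpha>}"
  then have sub: "subspace V" by (simp add: Gr_def)
  then have "V \<noteq> {}" using subspace_0 by blast
  then obtain v where v: "v \<in> V" "dist x v < \<alpha>" using V by (auto elim!: infdist_lessE)
  define s where "s = norm v + 1"
  have s: "s > 0" by (simp add: s_def add_nonneg_pos)
  have u: "v /\<^sub>R s \<in> V" "norm (v /\<^sub>R s) \<le> 1"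
    using s sub v(1) by (auto simp: subspace_scale s_def field_simps)
  show "\<exists>e>0. \<forall>W\<in>Gr n d. gr_dist V W < e \<longrightarrow> W \<in> {V \<in> Gr n d. infdist x V < \<alpha>}"
  proof (intro exI[of _ "(\<alpha> - dist x v) / s"] conjI ballI impI)
    show "0 < (\<alpha> - dist x v) / s" using v s by simp
    fix W assume W: "W \<in> Gr n d" and "gr_dist V W < (\<alpha> - dist x v) / s"
    then obtain w where w: "w \<in> W" "dist (v /\<^sub>R s) w < (\<alpha> - dist x v) / s"
      using gr_distD[OF _ W _ u] V by auto
    have "dist v (s *\<^sub>R w) = s * dist (v /\<^sub>R s) w"
    proof -
      have "v - s *\<^sub>R w = s *\<^sub>R (v /\<^sub>R s - w)" using s by (simp add: algebra_simps)
      then show ?thesis using s by (simp add: dist_norm del: scaleR_right_diff_distrib)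
    qed
    also have "\<dots> < \<alpha> - dist x v" using w(2) s by (simp add: field_simps)
    finally have "dist x (s *\<^sub>R w) < \<alpha>" using dist_triangle[of x "s *\<^sub>R w" v] by linarith
    moreover have "s *\<^sub>R w \<in> W" using W w(1) by (simp add: Gr_def subspace_scale)
    ultimately show "W \<in> {V \<in> Gr n d. infdist x V < \<alpha>}"
      using W infdist_le[of "s *\<^sub>R w" W x] by auto
  qed
qed auto

lemma space_gr_borel: "space (gr_borel n d) = Gr n d"
  by (simp add: gr_borel_def space_measure_of_conv)

lemma sets_gr_borel_open: "gr_open n d U \<Longrightarrow> U \<in> sets (gr_borel n d)"
  unfolding gr_borel_def by (subst sets_measure_of) (auto simp: gr_open_def)

lemma infdist_tangent_field_measurable:
  assumes \<tau>: "\<tau> \<in> measurable (restrict_space borel S) (gr_borel n d)" and S: "S \<in> sets borel"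
  shows "{x \<in> S. infdist w (\<tau> x) < \<alpha>} \<in> sets borel"
    and "x \<in> S \<Longrightarrow> \<tau> x \<in> Gr n d"
proof -
  show G: "\<tau> x \<in> Gr n d" if "x \<in> S" for x
    using measurable_space[OF \<tau>, of x] that S by (simp add: space_gr_borel space_restrict_space)
  have "\<tau> -` {V \<in> Gr n d. infdist w V < \<alpha>} \<inter> space (restrict_space borel S) \<in> sets (restrict_space borel S)"
    by (rule measurable_sets[OF \<tau> sets_gr_borel_open[OF gr_open_infdist_less]])
  also have "\<tau> -` {V \<in> Gr n d. infdist w V < \<alpha>} \<inter> space (restrict_space borel S) = {x \<in> S. infdist w (\<tau> x) < \<alpha>}"
    using G S by (auto simp: space_restrict_space)
  finally show "{x \<in> S. infdist w (\<tau> x) < \<alpha>} \<in> sets borel"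
    using S by (auto simp: sets_restrict_space_iff)
qed

text \<open>The coefficients of \<open>x\<close> sum to at most \<open>1 / \<kappa>\<close> in
  absolute value, so the combination of the \<open>w i\<close> with the same coefficients is within
  \<open>\<eta> = \<rho> / \<kappa>\<close> of \<open>x\<close>. Scaling it into the unit ball costs
  another \<open>\<eta>\<close>.\<close>

lemma infdist_span_le:
  fixes u w :: "nat \<Rightarrow> 'v::real_normed_vector"
  assumes low: "\<And>c. \<kappa> * (\<Sum>i<d. \<bar>c i\<bar>) \<le> norm (\<Sum>i<d. c i *\<^sub>R u i)" and "\<kappa> > 0"
    and close: "\<And>i. i < d \<Longrightarrow> dist (u i) (w i) \<le> \<rho>" and "\<rho> \<ge> 0"
    and x: "x \<in> span (u ` {..<d}) \<inter> cball 0 1"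
  shows "infdist x (span (w ` {..<d}) \<inter> cball 0 1) \<le> 2 * (\<rho> / \<kappa>)"
proof -
  obtain c where c: "x = (\<Sum>i<d. c i *\<^sub>R u i)" using x unfolding span_image_lessThan by auto
  let ?y = "\<Sum>i<d. c i *\<^sub>R w i"
  define \<eta> where "\<eta> = \<rho> / \<kappa>"
  have \<eta>: "\<eta> \<ge> 0" using assms by (simp add: \<eta>_def)
  have "\<kappa> * (\<Sum>i<d. \<bar>c i\<bar>) \<le> 1" using low[of c] x by (auto simp: c)
  then have c1: "(\<Sum>i<d. \<bar>c i\<bar>) \<le> 1 / \<kappa>" using \<open>\<kappa> > 0\<close> by (simp add: field_simps)
  have "dist x ?y = norm (\<Sum>i<d. c i *\<^sub>R (u i - w i))"
    by (simp add: c dist_norm scaleR_diff_right sum_subtractf)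
  also have "\<dots> \<le> (\<Sum>i<d. norm (c i *\<^sub>R (u i - w i)))" by (rule norm_sum)
  also have "\<dots> \<le> (\<Sum>i<d. \<bar>c i\<bar> * \<rho>)"
    unfolding norm_scaleR using close by (intro sum_mono mult_left_mono) (auto simp: dist_norm)
  also have "\<dots> \<le> 1 / \<kappa> * \<rho>"
    unfolding sum_distrib_right[symmetric] by (intro mult_right_mono c1 \<open>\<rho> \<ge> 0\<close>)
  finally have xy: "dist x ?y \<le> \<eta>" by (simp add: \<eta>_def)
  then have y: "norm ?y \<le> 1 + \<eta>"
    using x norm_triangle_sub[of ?y x] by (auto simp: dist_norm norm_minus_commute)
  let ?z = "?y /\<^sub>R (1 + \<eta>)"
  have "?y \<in> span (w ` {..<d})" unfolding span_image_lessThan by blast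
  then have "?z \<in> span (w ` {..<d})" by (rule span_scale)
  moreover have "norm ?z \<le> 1" using y \<eta> by (simp add: field_simps)
  moreover have "dist ?y ?z \<le> \<eta>"
  proof -
    have "?y - ?z = (\<eta> / (1 + \<eta>)) *\<^sub>R ?y"
    proof -
      have "1 - inverse (1 + \<eta>) = \<eta> / (1 + \<eta>)" using \<eta> by (simp add: field_simps)
      then show ?thesis by (metis scaleR_left_diff_distrib scaleR_one)
    qed
    then have "dist ?y ?z = \<eta> / (1 + \<eta>) * norm ?y" using \<eta> by (simp add: dist_norm del: scaleR_sum_right)
    also have "\<dots> \<le> \<eta> / (1 + \<eta>) * (1 + \<eta>)" using y \<eta> by (intro mult_left_mono) auto
    finally show ?thesis using \<eta> by simp
  qed
  ultimately show ?thesis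
    using xy dist_triangle[of x ?z ?y] by (intro infdist_le2[of ?z]) (auto simp: \<eta>_def)
qed

lemma gr_dist_span_less:
  assumes v: "indep_upto d v" and e: "e > 0"
  obtains \<rho> where "\<rho> > 0" "\<And>w. (\<And>i. i < d \<Longrightarrow> dist (v i) (w i) < \<rho>) \<Longrightarrow>
     gr_dist (span (v ` {..<d})) (span (w ` {..<d})) < e"
proof -
  obtain \<kappa> where \<kappa>: "\<kappa> > 0" "\<And>c. \<kappa> * (\<Sum>i<d. \<bar>c i\<bar>) \<le> norm (\<Sum>i<d. c i *\<^sub>R v i)"
    using indep_upto_lower_bound[OF v] by blast
  \<comment> \<open>With \<open>\<rho> \<le> \<kappa> / 2\<close> the family \<open>w\<close>
    inherits the lower bound with constant \<open>\<kappa> / 2\<close>, so the one-sided estimate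
    applies in both directions; \<open>e * \<kappa> / 8\<close> makes it at most
    \<open>e / 2\<close>.\<close>
  define \<rho> where "\<rho> = min (\<kappa> / 2) (e * \<kappa> / 8)"
  have \<rho>: "\<rho> > 0" using \<kappa> e by (simp add: \<rho>_def)
  have \<rho>e: "2 * (\<rho> / (\<kappa> / 2)) \<le> e / 2" using \<kappa> by (simp add: \<rho>_def min_def field_simps)
  show thesis
  proof (rule that[OF \<rho>])
    fix w assume w: "\<And>i. i < d \<Longrightarrow> dist (v i) (w i) < \<rho>"
    have low: "\<kappa> / 2 * (\<Sum>i<d. \<bar>c i\<bar>) \<le> norm (\<Sum>i<d. c i *\<^sub>R w i)" for c
    proof -
      have "norm (\<Sum>i<d. c i *\<^sub>R (v i - w i)) \<le> (\<Sum>i<d. norm (c i *\<^sub>R (v i - w i)))" by (rule norm_sum)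
      also have "\<dots> \<le> (\<Sum>i<d. \<bar>c i\<bar> * \<rho>)"
        unfolding norm_scaleR using w by (intro sum_mono mult_left_mono) (auto simp: dist_norm intro: less_imp_le)
      also have "\<dots> \<le> (\<Sum>i<d. \<bar>c i\<bar>) * (\<kappa> / 2)"
        unfolding sum_distrib_right[symmetric] by (intro mult_left_mono sum_nonneg) (auto simp: \<rho>_def)
      finally have "norm (\<Sum>i<d. c i *\<^sub>R v i) - norm (\<Sum>i<d. c i *\<^sub>R w i) \<le> (\<Sum>i<d. \<bar>c i\<bar>) * (\<kappa> / 2)"
        using norm_triangle_ineq2[of "\<Sum>i<d. c i *\<^sub>R v i" "\<Sum>i<d. c i *\<^sub>R w i"]
        by (simp add: scaleR_diff_right sum_subtractf)
      then show ?thesis using \<kappa>(2)[of c] by (simp add: algebra_simps)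
    qed
    have low': "\<kappa> / 2 * (\<Sum>i<d. \<bar>c i\<bar>) \<le> norm (\<Sum>i<d. c i *\<^sub>R v i)" for c
    proof -
      have "\<kappa> / 2 * (\<Sum>i<d. \<bar>c i\<bar>) \<le> \<kappa> * (\<Sum>i<d. \<bar>c i\<bar>)"
        using \<kappa>(1) by (intro mult_right_mono sum_nonneg) auto
      then show ?thesis using \<kappa>(2)[of c] by (rule order_trans)
    qed
    have ne: "span A \<inter> cball 0 1 \<noteq> {}" for A :: "(nat \<Rightarrow>\<^sub>0 real) set" using span_0 by (force simp: ex_in_conv[symmetric])
    have "gr_dist (span (v ` {..<d})) (span (w ` {..<d})) \<le> e / 2"
      unfolding gr_dist_def
    proof (intro max.boundedI cSUP_least ne)
      show "infdist x (span (w ` {..<d}) \<inter> cball 0 1) \<le> e / 2" if "x \<in> span (v ` {..<d}) \<inter> cball 0 1" for x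
        using infdist_span_le[OF low' _ _ _ that, of w \<rho>] \<kappa> \<rho> w \<rho>e by (force intro: less_imp_le)
      show "infdist x (span (v ` {..<d}) \<inter> cball 0 1) \<le> e / 2" if "x \<in> span (w ` {..<d}) \<inter> cball 0 1" for x
        using infdist_span_le[OF low _ _ _ that, of v \<rho>] \<kappa> \<rho> w \<rho>e by (force intro: less_imp_le simp: dist_commute)
    qed
    then show "gr_dist (span (v ` {..<d})) (span (w ` {..<d})) < e" using e by simp
  qed
qed

text \<open>Whether an independent frame spans a member of \<open>U\<close> is stable under small
  changes of the frame. So it is tested on countably many boxes around tuples from a dense set;
  \<open>Q\<close> lists the boxes all of whose independent frames span a member of
  \<open>U\<close>.\<close>

lemma span_measurable_gr_open:
  assumes S: "S \<in> sets borel" and U: "gr_open n d U"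
    and b: "\<And>x i. x \<in> S \<Longrightarrow> i < d \<Longrightarrow> b x i \<in> Rn n"
    and ind: "\<And>x. x \<in> S \<Longrightarrow> indep_upto d (b x)"
    and meas: "\<And>i c \<rho>. i < d \<Longrightarrow> c \<in> Rn n \<Longrightarrow> {x \<in> S. dist (b x i) c < \<rho>} \<in> sets borel"
  shows "{x \<in> S. span (b x ` {..<d}) \<in> U} \<in> sets borel"
proof -
  obtain D where D: "countable D" "D \<subseteq> Rn n" "\<And>x \<epsilon>. x \<in> Rn n \<Longrightarrow> 0 < \<epsilon> \<Longrightarrow> \<exists>y\<in>D. dist x y < \<epsilon>"
    unfolding Rn_eq_span using countable_dense_span[of "Rn_basis ` {..<n}"] by auto
  define Q where "Q = {(c, k::nat). c \<in> {..<d} \<rightarrow>\<^sub>E D \<and>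
     (\<forall>v. (\<forall>i<d. v i \<in> Rn n \<and> dist (v i) (c i) < inverse (real (Suc k))) \<and> indep_upto d v \<longrightarrow> span (v ` {..<d}) \<in> U)}"
  have "countable ({..<d} \<rightarrow>\<^sub>E D)" using D(1) by (intro countable_PiE) auto
  then have "countable (({..<d} \<rightarrow>\<^sub>E D) \<times> (UNIV :: nat set))" by simp
  then have Q: "countable Q" by (rule countable_subset[rotated]) (auto simp: Q_def)
  have "{x \<in> S. span (b x ` {..<d}) \<in> U} = (\<Union>(c, k)\<in>Q. S \<inter> (\<Inter>i\<in>{..<d}. {x \<in> S. dist (b x i) (c i) < inverse (real (Suc k))} \<union> - S))"
    (is "?L = ?R")
  proof (intro equalityI subsetI)
    fix x assume "x \<in> ?R"
    then show "x \<in> ?L" using b ind by (auto simp: Q_def)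
  next
    fix x assume "x \<in> ?L"
    then have x: "x \<in> S" "span (b x ` {..<d}) \<in> U" by auto
    obtain e where e: "e > 0" "\<And>W. W \<in> Gr n d \<Longrightarrow> gr_dist (span (b x ` {..<d})) W < e \<Longrightarrow> W \<in> U"
      using U x(2) unfolding gr_open_def by blast
    obtain \<rho> where \<rho>: "\<rho> > 0" "\<And>w. (\<And>i. i < d \<Longrightarrow> dist (b x i) (w i) < \<rho>) \<Longrightarrow>
       gr_dist (span (b x ` {..<d})) (span (w ` {..<d})) < e"
      using gr_dist_span_less[OF ind[OF x(1)] e(1)] by blast
    \<comment> \<open>Half of \<open>\<rho>\<close>, because a frame in the box is compared with
      \<open>b x\<close> through the centre \<open>c\<close>.\<close>
    obtain k where k: "inverse (real (Suc k)) < \<rho> / 2" using reals_Archimedean \<rho>(1) half_gt_zero by blast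
    have "\<exists>c\<in>D. dist (b x i) c < inverse (real (Suc k))" if "i < d" for i
      using D(3)[OF b[OF x(1) that]] by simp
    then obtain c where c: "\<And>i. i < d \<Longrightarrow> c i \<in> D" "\<And>i. i < d \<Longrightarrow> dist (b x i) (c i) < inverse (real (Suc k))"
      by metis
    have "span (v ` {..<d}) \<in> U"
      if v: "\<forall>i<d. v i \<in> Rn n \<and> dist (v i) (restrict c {..<d} i) < inverse (real (Suc k))" "indep_upto d v" for v
    proof -
      have "dist (b x i) (v i) < \<rho>" if "i < d" for i
        using dist_triangle2[of "b x i" "v i" "c i"] c(2)[OF that] v(1) k that by force
      moreover have "span (v ` {..<d}) \<subseteq> Rn n"
        using v subspace_Rn by (intro span_minimal) auto
      then have "span (v ` {..<d}) \<in> Gr n d"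
        using dim_span_image_lessThan[OF v(2)] by (simp add: Gr_def)
      ultimately show ?thesis using e(2) \<rho>(2) by blast
    qed
    then have "(restrict c {..<d}, k) \<in> Q"
      unfolding Q_def using c(1) by auto
    moreover have "x \<in> S \<inter> (\<Inter>i\<in>{..<d}. {x \<in> S. dist (b x i) (restrict c {..<d} i) < inverse (real (Suc k))} \<union> - S)"
      using x(1) c(2) by auto
    ultimately show "x \<in> ?R" by blast
  qed
  also have "\<dots> \<in> sets borel"
  proof -
    have "(case p of (c, k) \<Rightarrow> S \<inter> (\<Inter>i\<in>{..<d}. {x \<in> S. dist (b x i) (c i) < inverse (real (Suc k))} \<union> - S)) \<in> sets borel"
      if p: "p \<in> Q" for p
    proof -
      obtain c k where [simp]: "p = (c, k)" by fastforce
      have c: "c i \<in> Rn n" if "i < d" for i using p that D(2) by (auto simp: Q_def PiE_def Pi_def)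
      have "S \<inter> (\<Inter>i\<in>{..<d}. {x \<in> S. dist (b x i) (c i) < inverse (real (Suc k))} \<union> - S) \<in> sets borel"
      proof (cases "d = 0")
        case False
        then show ?thesis
          using S meas c by (intro sets.Int sets.finite_INT sets.Un borel_comp) auto
      qed (use S in simp)
      then show ?thesis by simp
    qed
    then show ?thesis by (intro sets.countable_UN'' Q)
  qed
  finally show ?thesis .
qed

text \<open>
  With \<open>P\<close> countable, \<open>A\<close> Borel and \<open>U\<close> open this is how a measurable closed-valued map is encoded.
\<close>

definition residual :: "('x set \<times> 'w set) set \<Rightarrow> 'x \<Rightarrow> 'w set" where
  "residual P x = {w. \<forall>(A, U)\<in>P. x \<in> A \<longrightarrow> w \<notin> U}"

lemma closed_residual: "(\<And>A U. (A, U) \<in> P \<Longrightarrow> open U) \<Longrightarrow> closed (residual P x)"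
proof -
  assume "\<And>A U. (A, U) \<in> P \<Longrightarrow> open U"
  then have "closed (\<Inter>p\<in>{p \<in> P. x \<in> fst p}. - snd p)" by (intro closed_INT) auto
  also have "(\<Inter>p\<in>{p \<in> P. x \<in> fst p}. - snd p) = residual P x" by (force simp: residual_def)
  finally show ?thesis .
qed

text \<open>By compactness, \<open>K\<close> misses the residual at \<open>x\<close> exactly if
  finitely many of the open sets discarded at \<open>x\<close> cover \<open>K\<close>, and a
  countable \<open>P\<close> has only countably many finite subfamilies.\<close>

lemma residual_hits_compact_borel:
  assumes P: "countable P" "\<And>A U. (A, U) \<in> P \<Longrightarrow> A \<in> sets borel" "\<And>A U. (A, U) \<in> P \<Longrightarrow> open U"
    and K: "compact K"
  shows "{x. residual P x \<inter> K \<noteq> {}} \<in> sets borel"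
proof -
  let ?F = "{F. finite F \<and> F \<subseteq> P \<and> K \<subseteq> (\<Union>p\<in>F. snd p)}"
  have "- {x. residual P x \<inter> K \<noteq> {}} = (\<Union>F\<in>?F. \<Inter>p\<in>F. fst p)"
  proof (intro equalityI subsetI)
    fix x assume "x \<in> - {x. residual P x \<inter> K \<noteq> {}}"
    then have *: "\<And>w. w \<in> K \<Longrightarrow> w \<notin> residual P x" by blast
    have cover: "K \<subseteq> (\<Union>p\<in>{p \<in> P. x \<in> fst p}. snd p)" using * unfolding residual_def by force
    have op: "\<And>p. p \<in> {p \<in> P. x \<in> fst p} \<Longrightarrow> open (snd p)" using P(3) by auto
    obtain F where "F \<subseteq> {p \<in> P. x \<in> fst p}" "finite F" "K \<subseteq> (\<Union>p\<in>F. snd p)"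
      by (rule compactE_image[OF K op cover])
    then show "x \<in> (\<Union>F\<in>?F. \<Inter>p\<in>F. fst p)" by blast
  next
    fix x assume "x \<in> (\<Union>F\<in>?F. \<Inter>p\<in>F. fst p)"
    then obtain F where F: "F \<subseteq> P" "K \<subseteq> (\<Union>p\<in>F. snd p)" "\<And>p. p \<in> F \<Longrightarrow> x \<in> fst p" by blast
    have "w \<notin> residual P x" if wK: "w \<in> K" for w
    proof -
      obtain p where "p \<in> F" "w \<in> snd p" using F(2) wK by blast
      then show ?thesis using F(1) F(3)[of p] unfolding residual_def by (cases p) auto
    qed
    then show "x \<in> - {x. residual P x \<inter> K \<noteq> {}}" by blast
  qed
  also have "\<dots> \<in> sets borel"
  proof (intro sets.countable_UN'')
    have "countable {F. finite F \<and> F \<subseteq> P}" by (rule countable_Collect_finite_subset[OF P(1)])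
    then show "countable ?F" by (rule countable_subset[rotated]) auto
    fix F assume F: "F \<in> ?F"
    show "(\<Inter>p\<in>F. fst p) \<in> sets borel"
    proof (cases "F = {}")
      case False
      then show ?thesis using F P(2) by (intro sets.finite_INT) auto
    qed simp
  qed
  finally have "- (- {x. residual P x \<inter> K \<noteq> {}}) \<in> sets borel" by (rule borel_comp)
  then show ?thesis by simp
qed

section \<open>Measurable selections from closed-valued maps\<close>

lemma compact_countable_net:
  fixes K :: "'w::metric_space set"
  assumes "compact K"
  obtains c :: "nat \<Rightarrow> 'w" where "\<And>x e. x \<in> K \<Longrightarrow> 0 < e \<Longrightarrow> \<exists>i. dist x (c i) < e"
proof -
  have "\<exists>k. finite k \<and> K \<subseteq> (\<Union>x\<in>k. ball x (inverse (real (Suc n))))" for n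
    using assms unfolding compact_eq_totally_bounded by auto
  then obtain k where k: "\<And>n. finite (k n)" "\<And>n. K \<subseteq> (\<Union>x\<in>k n. ball x (inverse (real (Suc n))))" by metis
  \<comment> \<open>The inserted element keeps the enumeration meaningful when the net is
    empty.\<close>
  let ?c = "from_nat_into (insert undefined (\<Union>n. k n))"
  have "\<exists>i. dist x (?c i) < e" if x: "x \<in> K" "0 < e" for x e
  proof -
    obtain n where "inverse (real (Suc n)) < e" using reals_Archimedean x(2) by blast
    moreover obtain y where "y \<in> k n" "dist y x < inverse (real (Suc n))" using k(2)[of n] x(1) by auto
    moreover have "countable (insert undefined (\<Union>n. k n))" using k(1) by (auto intro: countable_finite)
    then have "y \<in> range ?c" using \<open>y \<in> k n\<close> by (subst range_from_nat_into) auto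
    then obtain i where "y = ?c i" by blast
    ultimately have "dist x (?c i) < e" by (simp add: dist_commute)
    then show ?thesis by blast
  qed
  with that show thesis by blast
qed

text \<open>A greedy selection in the manner of Kuratowski and Ryll-Nardzewski: stage
  \<open>k\<close> cuts the current compact set with the first net ball of radius
  \<open>(1/2) ^ k\<close> that leaves it meeting \<open>T x\<close>. The choices are natural
  numbers, so each stage takes countably many values, each on a Borel set, and the nested sets close
  in on the selected point.\<close>

lemma compact_measurable_selection:
  fixes T :: "'x::topological_space \<Rightarrow> 'w::metric_space set"
  assumes K: "compact K" and closed: "\<And>x. closed (T x)"
    and hits: "\<And>C. compact C \<Longrightarrow> {x. T x \<inter> C \<noteq> {}} \<in> sets borel"
  obtains w where "\<And>x. T x \<inter> K \<noteq> {} \<Longrightarrow> w x \<in> T x \<inter> K"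
    "\<And>G. open G \<Longrightarrow> {x. T x \<inter> K \<noteq> {} \<and> w x \<in> G} \<in> sets borel"
proof -
  obtain c where c: "\<And>x e. x \<in> K \<Longrightarrow> 0 < e \<Longrightarrow> \<exists>i::nat. dist x (c i) < e"
    using compact_countable_net[OF K] by blast
  define H where "H C = {x. T x \<inter> C \<noteq> {}}" for C
  define r where "r j = (1/2::real) ^ j" for j
  have r: "r j > 0" for j by (simp add: r_def)
  define Cs where "Cs l = K \<inter> (\<Inter>j\<in>{..<length l}. cball (c (l ! j)) (r j))" for l
  have Cs: "compact (Cs l)" for l unfolding Cs_def by (intro compact_Int_closed K closed_INT) auto
  have Cs_append: "Cs (l @ [i]) = Cs l \<inter> cball (c i) (r (length l))" for l i
  proof -
    have "(\<Inter>j\<in>{..<length (l @ [i])}. cball (c ((l @ [i]) ! j)) (r j))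
        = cball (c i) (r (length l)) \<inter> (\<Inter>j\<in>{..<length l}. cball (c (l ! j)) (r j))"
      by (simp add: lessThan_Suc nth_append)
    then show ?thesis unfolding Cs_def by blast
  qed
  define L where "L x k = rec_nat [] (\<lambda>_ l. l @ [LEAST i. x \<in> H (Cs (l @ [i]))]) k" for x k
  have L0: "L x 0 = []" and LS: "L x (Suc k) = L x k @ [LEAST i. x \<in> H (Cs (L x k @ [i]))]" for x k
    by (simp_all add: L_def)
  have len: "length (L x k) = k" for x k by (induction k) (simp_all add: L0 LS)
  have ex: "\<exists>i. x \<in> H (Cs (l @ [i]))" if hit: "x \<in> H (Cs l)" for x l
  proof -
    obtain y where y: "y \<in> T x" "y \<in> Cs l" using hit by (auto simp: H_def)
    then have "y \<in> K" by (simp add: Cs_def)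
    then obtain i where "dist y (c i) < r (length l)" using c r by blast
    then have "y \<in> T x \<inter> Cs (l @ [i])" using y by (simp add: Cs_append dist_commute)
    then show ?thesis by (auto simp: H_def)
  qed
  have inv: "x \<in> H (Cs (L x k))" if "x \<in> H K" for x k
  proof (induction k)
    case 0
    then show ?case using that by (simp add: L0 Cs_def)
  next
    case (Suc k)
    then show ?case unfolding LS using LeastI_ex[OF ex] by blast
  qed
  have L_borel: "{x \<in> H K. L x k = l} \<in> sets borel" for k l
  proof (induction k arbitrary: l)
    case 0
    show ?case using hits[OF K] by (cases "l = []") (auto simp: L0 H_def)
  next
    case (Suc k)
    show ?case
    proof (cases "l = []")
      case True
      then show ?thesis by (simp add: LS)
    next
      case False
      then obtain l' j where l: "l = l' @ [j]" by (metis append_butlast_last_id)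
      have "{x \<in> H K. L x (Suc k) = l} = {x \<in> H K. L x k = l'} \<inter> (H (Cs (l' @ [j])) - (\<Union>i\<in>{..<j}. H (Cs (l' @ [i]))))"
      proof (intro equalityI subsetI)
        fix x assume "x \<in> {x \<in> H K. L x (Suc k) = l}"
        then have x: "x \<in> H K" "L x k = l'" "j = (LEAST i. x \<in> H (Cs (l' @ [i])))" by (auto simp: LS l)
        then have "x \<in> H (Cs l')" using inv[OF x(1), of k] by simp
        then show "x \<in> {x \<in> H K. L x k = l'} \<inter> (H (Cs (l' @ [j])) - (\<Union>i\<in>{..<j}. H (Cs (l' @ [i]))))"
          using x LeastI_ex[OF ex] not_less_Least by blast
      next
        fix x assume x: "x \<in> {x \<in> H K. L x k = l'} \<inter> (H (Cs (l' @ [j])) - (\<Union>i\<in>{..<j}. H (Cs (l' @ [i]))))"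
        then have "(LEAST i. x \<in> H (Cs (l' @ [i]))) = j"
          by (intro Least_equality) (auto simp: not_less[symmetric])
        then show "x \<in> {x \<in> H K. L x (Suc k) = l}" using x by (auto simp: LS l)
      qed
      also have "\<dots> \<in> sets borel"
        using Suc hits[OF Cs] by (intro sets.Int sets.Diff sets.finite_UN) (auto simp: H_def)
      finally show ?thesis .
    qed
  qed
  have "\<exists>w. w \<in> T x \<and> (\<forall>k. w \<in> Cs (L x k))" if x: "x \<in> H K" for x
  proof -
    have dec: "Cs (L x k) \<subseteq> Cs (L x j)" if "j \<le> k" for j k
      using that by (induction k rule: dec_induct) (auto simp: LS Cs_append)
    have "K \<inter> (\<Inter>k\<in>UNIV. T x \<inter> Cs (L x k)) \<noteq> {}"
    proof (rule compact_imp_fip_image[OF K])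
      show "closed (T x \<inter> Cs (L x k))" for k using closed compact_imp_closed[OF Cs] by auto
      fix I' :: "nat set" assume I: "finite I'"
      obtain y where y: "y \<in> T x" "y \<in> Cs (L x (Max (insert 0 I')))" using inv[OF x] by (auto simp: H_def)
      then have "y \<in> K \<inter> (\<Inter>k\<in>I'. T x \<inter> Cs (L x k))"
        using dec[of _ "Max (insert 0 I')"] I by (auto simp: Cs_def[of "L x (Max (insert 0 I'))"] subset_iff)
      then show "K \<inter> (\<Inter>k\<in>I'. T x \<inter> Cs (L x k)) \<noteq> {}" by blast
    qed
    then show ?thesis by blast
  qed
  then obtain w where w: "\<And>x. x \<in> H K \<Longrightarrow> w x \<in> T x" "\<And>x k. x \<in> H K \<Longrightarrow> w x \<in> Cs (L x k)" by metis
  show thesis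
  proof
    show "w x \<in> T x \<inter> K" if "T x \<inter> K \<noteq> {}" for x
      using w[of x] that w(2)[of x 0] by (auto simp: H_def Cs_def L0)
    fix G :: "'w set" assume G: "open G"
    \<comment> \<open>For \<open>x\<close> with \<open>T x\<close> meeting \<open>K\<close>, the
      selected point lies in \<open>G\<close> exactly if one of the balls chosen on the way is
      contained in \<open>G\<close>.\<close>
    let ?l = "{l. l \<noteq> [] \<and> cball (c (last l)) (r (length l - 1)) \<subseteq> G}"
    have wb: "w x \<in> cball (c (last (L x (Suc k)))) (r k)" if "x \<in> H K" for x k
      using w(2)[OF that, of "Suc k"] by (simp add: LS Cs_append len)
    have "{x. T x \<inter> K \<noteq> {} \<and> w x \<in> G} = (\<Union>l\<in>?l. {x \<in> H K. L x (length l) = l})"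
    proof (intro equalityI subsetI)
      fix x assume "x \<in> {x. T x \<inter> K \<noteq> {} \<and> w x \<in> G}"
      then have x: "x \<in> H K" "w x \<in> G" by (auto simp: H_def)
      obtain e where e: "e > 0" "ball (w x) e \<subseteq> G" using G x(2) open_contains_ball by blast
      obtain k where k: "r k < e / 2" using real_arch_pow_inv[of "e / 2" "1/2"] e(1) by (auto simp: r_def)
      have "cball (c (last (L x (Suc k)))) (r k) \<subseteq> ball (w x) e"
      proof
        fix y assume "y \<in> cball (c (last (L x (Suc k)))) (r k)"
        then show "y \<in> ball (w x) e"
          using wb[OF x(1), of k] k dist_triangle[of "w x" y "c (last (L x (Suc k)))"] by (simp add: dist_commute)
      qed
      then have "L x (Suc k) \<in> ?l" using e(2) len[of x "Suc k"] by auto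
      then show "x \<in> (\<Union>l\<in>?l. {x \<in> H K. L x (length l) = l})"
        using x(1) len[of x "Suc k"] by (intro UN_I[of "L x (Suc k)"]) auto
    next
      fix x assume "x \<in> (\<Union>l\<in>?l. {x \<in> H K. L x (length l) = l})"
      then obtain l where l: "l \<noteq> []" "cball (c (last l)) (r (length l - 1)) \<subseteq> G" "x \<in> H K" "L x (length l) = l" by blast
      then have "w x \<in> cball (c (last l)) (r (length l - 1))" using wb[OF l(3), of "length l - 1"] by simp
      then show "x \<in> {x. T x \<inter> K \<noteq> {} \<and> w x \<in> G}" using l by (auto simp: H_def)
    qed
    also have "\<dots> \<in> sets borel" using L_borel by (intro sets.countable_UN'') auto
    finally show "{x. T x \<inter> K \<noteq> {} \<and> w x \<in> G} \<in> sets borel" .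
  qed
qed

section \<open>Independence and spans tested with rational coefficients\<close>

lemma rational_coefficients:
  fixes c :: "nat \<Rightarrow> real"
  assumes "\<epsilon> > 0"
  obtains r where "r \<in> {..<d} \<rightarrow>\<^sub>E \<rat>" "(\<Sum>i<d. \<bar>c i - r i\<bar>) < \<epsilon>"
proof -
  define \<delta> where "\<delta> = \<epsilon> / (real d + 1)"
  have \<delta>: "\<delta> > 0" using assms by (simp add: \<delta>_def add_nonneg_pos)
  have "\<exists>r\<in>\<rat>. \<bar>c i - r\<bar> < \<delta>" for i
    using Rats_dense_in_real[of "c i - \<delta>" "c i + \<delta>"] \<delta> by (force simp: abs_less_iff)
  then obtain r where r: "\<And>i. r i \<in> \<rat>" "\<And>i. \<bar>c i - r i\<bar> < \<delta>" by metis
  have "(\<Sum>i<d. \<bar>c i - restrict r {..<d} i\<bar>) \<le> (\<Sum>i<d. \<delta>)"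
    using r(2) by (intro sum_mono) (auto intro: less_imp_le)
  also have "\<dots> = real d * \<delta>" by simp
  also have "\<dots> < \<epsilon>" using assms by (simp add: \<delta>_def field_simps)
  finally show thesis using r(1) by (intro that[of "restrict r {..<d}"]) auto
qed

lemma norm_sum_scaleR_diff_le:
  fixes v :: "nat \<Rightarrow> 'v::real_normed_vector"
  shows "norm ((\<Sum>i<d. c i *\<^sub>R v i) - (\<Sum>i<d. r i *\<^sub>R v i)) \<le> (\<Sum>i<d. \<bar>c i - r i\<bar>) * (\<Sum>i<d. norm (v i))"
proof -
  have "norm ((\<Sum>i<d. c i *\<^sub>R v i) - (\<Sum>i<d. r i *\<^sub>R v i)) = norm (\<Sum>i<d. (c i - r i) *\<^sub>R v i)"
    by (simp add: scaleR_diff_left sum_subtractf)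
  also have "\<dots> \<le> (\<Sum>i<d. norm ((c i - r i) *\<^sub>R v i))" by (rule norm_sum)
  also have "\<dots> \<le> (\<Sum>i<d. \<bar>c i - r i\<bar> * (\<Sum>i<d. norm (v i)))"
    unfolding norm_scaleR by (intro sum_mono mult_left_mono member_le_sum) auto
  finally show ?thesis by (simp add: sum_distrib_right)
qed

text \<open>A countable test, which makes independence of a measurable frame a Borel condition. The
  constant \<open>k\<close> carries the bound from rational to real coefficients; nonvanishing of
  the rational combinations alone would not exclude an irrational relation.\<close>

lemma indep_upto_iff_rational:
  fixes v :: "nat \<Rightarrow> 'v::real_normed_vector"
  shows "indep_upto d v \<longleftrightarrow> (\<exists>k::nat. \<forall>c\<in>{..<d} \<rightarrow>\<^sub>E \<rat>. (\<Sum>i<d. \<bar>c i\<bar>) \<le> real k * norm (\<Sum>i<d. c i *\<^sub>R v i))"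
proof
  assume "indep_upto d v"
  then obtain \<kappa> where \<kappa>: "\<kappa> > 0" "\<And>c. \<kappa> * (\<Sum>i<d. \<bar>c i\<bar>) \<le> norm (\<Sum>i<d. c i *\<^sub>R v i)"
    using indep_upto_lower_bound by blast
  obtain k :: nat where k: "1 / \<kappa> < real k" using reals_Archimedean2 by blast
  have "(\<Sum>i<d. \<bar>c i\<bar>) \<le> real k * norm (\<Sum>i<d. c i *\<^sub>R v i)" for c
  proof -
    have "(\<Sum>i<d. \<bar>c i\<bar>) \<le> 1 / \<kappa> * norm (\<Sum>i<d. c i *\<^sub>R v i)" using \<kappa>(2)[of c] \<kappa>(1) by (simp add: field_simps)
    also have "\<dots> \<le> real k * norm (\<Sum>i<d. c i *\<^sub>R v i)" using k by (intro mult_right_mono) auto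
    finally show ?thesis .
  qed
  then show "\<exists>k::nat. \<forall>c\<in>{..<d} \<rightarrow>\<^sub>E \<rat>. (\<Sum>i<d. \<bar>c i\<bar>) \<le> real k * norm (\<Sum>i<d. c i *\<^sub>R v i)" by blast
next
  assume "\<exists>k::nat. \<forall>c\<in>{..<d} \<rightarrow>\<^sub>E \<rat>. (\<Sum>i<d. \<bar>c i\<bar>) \<le> real k * norm (\<Sum>i<d. c i *\<^sub>R v i)"
  then obtain k :: nat where k: "\<And>c. c \<in> {..<d} \<rightarrow>\<^sub>E \<rat> \<Longrightarrow> (\<Sum>i<d. \<bar>c i\<bar>) \<le> real k * norm (\<Sum>i<d. c i *\<^sub>R v i)"
    by blast
  define M where "M = real k * (\<Sum>i<d. norm (v i)) + 1"
  have M: "M > 0" unfolding M_def by (intro add_nonneg_pos mult_nonneg_nonneg sum_nonneg) auto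
  show "indep_upto d v"
    unfolding indep_upto_def
  proof (intro allI impI)
    fix c i assume c: "(\<Sum>i<d. c i *\<^sub>R v i) = 0" and i: "i < d"
    have "(\<Sum>i<d. \<bar>c i\<bar>) \<le> 0 + e" if "e > 0" for e
    proof -
      obtain r where r: "r \<in> {..<d} \<rightarrow>\<^sub>E \<rat>" "(\<Sum>i<d. \<bar>c i - r i\<bar>) < e / M"
        using rational_coefficients[of "e / M" d c] \<open>e > 0\<close> M by auto
      have "(\<Sum>i<d. \<bar>c i\<bar>) \<le> (\<Sum>i<d. \<bar>r i\<bar> + \<bar>c i - r i\<bar>)" by (intro sum_mono) auto
      also have "\<dots> = (\<Sum>i<d. \<bar>r i\<bar>) + (\<Sum>i<d. \<bar>c i - r i\<bar>)" by (rule sum.distrib)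
      also have "(\<Sum>i<d. \<bar>r i\<bar>) \<le> real k * norm (\<Sum>i<d. r i *\<^sub>R v i)" by (rule k[OF r(1)])
      also have "\<dots> \<le> real k * ((\<Sum>i<d. \<bar>c i - r i\<bar>) * (\<Sum>i<d. norm (v i)))"
        using norm_sum_scaleR_diff_le[where d = d and c = c and v = v and r = r] c by (intro mult_left_mono) auto
      also have "real k * ((\<Sum>i<d. \<bar>c i - r i\<bar>) * (\<Sum>i<d. norm (v i))) + (\<Sum>i<d. \<bar>c i - r i\<bar>)
          = M * (\<Sum>i<d. \<bar>c i - r i\<bar>)" by (simp add: M_def algebra_simps)
      also have "\<dots> \<le> 0 + e" using r(2) M by (simp add: field_simps)
      finally show ?thesis by simp
    qed
    then have "(\<Sum>i<d. \<bar>c i\<bar>) \<le> 0" by (rule field_le_epsilon)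
    moreover have "\<bar>c i\<bar> \<le> (\<Sum>i<d. \<bar>c i\<bar>)" using i by (intro member_le_sum) auto
    ultimately show "c i = 0" by simp
  qed
qed

text \<open>The span is closed, so approximation by rational combinations decides membership, again
  by countably many conditions.\<close>

lemma in_span_iff_rational:
  fixes v :: "nat \<Rightarrow> 'v::real_normed_vector"
  shows "y \<in> span (v ` {..<d}) \<longleftrightarrow>
    (\<forall>k::nat. \<exists>c\<in>{..<d} \<rightarrow>\<^sub>E \<rat>. norm (y - (\<Sum>i<d. c i *\<^sub>R v i)) < inverse (real (Suc k)))"
proof
  assume "y \<in> span (v ` {..<d})"
  then obtain c where c: "y = (\<Sum>i<d. c i *\<^sub>R v i)" unfolding span_image_lessThan by blast
  define M where "M = (\<Sum>i<d. norm (v i)) + 1"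
  have M: "M > 0" unfolding M_def by (intro add_nonneg_pos sum_nonneg) auto
  show "\<forall>k::nat. \<exists>c\<in>{..<d} \<rightarrow>\<^sub>E \<rat>. norm (y - (\<Sum>i<d. c i *\<^sub>R v i)) < inverse (real (Suc k))"
  proof
    fix k :: nat
    have pos: "inverse (real (Suc k)) / M > 0" using M by (intro divide_pos_pos) auto
    obtain r where r: "r \<in> {..<d} \<rightarrow>\<^sub>E \<rat>" "(\<Sum>i<d. \<bar>c i - r i\<bar>) < inverse (real (Suc k)) / M"
      using rational_coefficients[OF pos] by blast
    have "norm (y - (\<Sum>i<d. r i *\<^sub>R v i)) \<le> (\<Sum>i<d. \<bar>c i - r i\<bar>) * (\<Sum>i<d. norm (v i))"
      unfolding c by (rule norm_sum_scaleR_diff_le)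
    also have "\<dots> \<le> (\<Sum>i<d. \<bar>c i - r i\<bar>) * M" by (intro mult_left_mono sum_nonneg) (auto simp: M_def)
    also have "\<dots> < inverse (real (Suc k))" using r(2) M by (simp only: pos_less_divide_eq)
    finally show "\<exists>c\<in>{..<d} \<rightarrow>\<^sub>E \<rat>. norm (y - (\<Sum>i<d. c i *\<^sub>R v i)) < inverse (real (Suc k))"
      using r(1) by blast
  qed
next
  assume *: "\<forall>k::nat. \<exists>c\<in>{..<d} \<rightarrow>\<^sub>E \<rat>. norm (y - (\<Sum>i<d. c i *\<^sub>R v i)) < inverse (real (Suc k))"
  have "y \<in> closure (span (v ` {..<d}))"
    unfolding closure_approachable
  proof (intro allI impI)
    fix e :: real assume "e > 0"
    then obtain k where "inverse (real (Suc k)) < e" using reals_Archimedean by blast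
    then obtain c where "norm (y - (\<Sum>i<d. c i *\<^sub>R v i)) < e" using * less_trans by metis
    then show "\<exists>z\<in>span (v ` {..<d}). dist z y < e"
      unfolding span_image_lessThan by (auto simp: dist_norm norm_minus_commute)
  qed
  then show "y \<in> span (v ` {..<d})" using closed_span_finite[of "v ` {..<d}"] by (simp add: closure_closed)
qed

lemma abs_lookup_diff_le_dist:
  "\<bar>Poly_Mapping.lookup a i - Poly_Mapping.lookup b i\<bar> \<le> dist a (b :: nat \<Rightarrow>\<^sub>0 real)"
proof (cases "i \<in> Poly_Mapping.keys a \<union> Poly_Mapping.keys b")
  case True
  then have "dist (Poly_Mapping.lookup a i) (Poly_Mapping.lookup b i) \<le> dist a b"
    unfolding dist_poly_mapping_def
    by (intro member_le_sum[where f = "\<lambda>i. dist (Poly_Mapping.lookup a i) (Poly_Mapping.lookup b i)"]) auto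
  then show ?thesis by (simp add: dist_real_def)
qed (auto simp: in_keys_iff)

lemma continuous_on_lookup: "continuous_on S (\<lambda>v :: nat \<Rightarrow>\<^sub>0 real. Poly_Mapping.lookup v i)"
  by (rule lipschitz_on_continuous_on[of 1]) (auto intro!: lipschitz_onI simp: dist_real_def abs_lookup_diff_le_dist)

lemma norm_Rn: "v \<in> Rn n \<Longrightarrow> norm v = (\<Sum>i<n. \<bar>Poly_Mapping.lookup v i\<bar>)"
  unfolding norm_poly_mapping_def dist_poly_mapping_def Rn_def
  by (auto intro!: sum.mono_neutral_left simp: in_keys_iff)

lemma borel_measurable_norm_Rn:
  assumes "\<And>x. f x \<in> Rn n" "\<And>i. (\<lambda>x. Poly_Mapping.lookup (f x) i) \<in> borel_measurable M"
  shows "(\<lambda>x. norm (f x)) \<in> borel_measurable M"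
  using assms(2) by (simp add: norm_Rn[OF assms(1)])

lemma compact_Rn_cball: "compact (Rn n \<inter> cball c r)"
proof -
  have "compact (Rn n \<inter> cball 0 (norm c + \<bar>r\<bar>) \<inter> cball c r)"
    unfolding Rn_eq_span by (intro compact_Int_closed compact_span_Int_cball) auto
  also have "Rn n \<inter> cball 0 (norm c + \<bar>r\<bar>) \<inter> cball c r = Rn n \<inter> cball c r"
  proof -
    have "norm x \<le> norm c + \<bar>r\<bar>" if "x \<in> cball c r" for x
      using norm_triangle_sub[of x c] that by (simp add: dist_norm norm_minus_commute)
    then show ?thesis by auto
  qed
  finally show ?thesis .
qed

text \<open>The residual is closed but in general not linear. Countably many measurable selections,
  one for each small compact cell, approximate every second component in \<open>Rn n\<close>. By
  \<open>dim\<close> at most \<open>d\<close> of their values are independent, and standard basis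
  vectors fill up to dimension exactly \<open>d\<close>.\<close>

lemma residual_subspace_selection:
  fixes P :: "('x::topological_space set \<times> ('v::real_normed_vector \<times> (nat \<Rightarrow>\<^sub>0 real)) set) set"
  assumes S: "S \<in> sets borel"
    and P: "countable P" "\<And>A U. (A, U) \<in> P \<Longrightarrow> A \<in> sets borel" "\<And>A U. (A, U) \<in> P \<Longrightarrow> open U"
    and cpt: "\<And>R. compact (cball (0::'v) R)" and dn: "d \<le> n"
    and dim: "\<And>x w. x \<in> S \<Longrightarrow> (\<And>i. i \<le> d \<Longrightarrow> w i \<in> residual P x) \<Longrightarrow> (\<And>i. i \<le> d \<Longrightarrow> snd (w i) \<in> Rn n) \<Longrightarrow>
        \<not> indep_upto (Suc d) (\<lambda>i. snd (w i))"
  obtains \<tau> where "\<tau> \<in> measurable (restrict_space borel S) (gr_borel n d)"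
    "\<And>x v a. x \<in> S \<Longrightarrow> (v, a) \<in> residual P x \<Longrightarrow> a \<in> Rn n \<Longrightarrow> a \<in> \<tau> x"
proof -
  let ?lk = Poly_Mapping.lookup
  obtain D where D: "countable D" "D \<subseteq> Rn n" "\<And>x \<epsilon>. x \<in> Rn n \<Longrightarrow> 0 < \<epsilon> \<Longrightarrow> \<exists>y\<in>D. dist x y < \<epsilon>"
    unfolding Rn_eq_span using countable_dense_span[of "Rn_basis ` {..<n}"] by auto
  have Rn0: "0 \<in> Rn n" using subspace_Rn by (rule subspace_0)
  have "D \<noteq> {}" using D(3)[OF Rn0, of 1] by auto
  define c where "c = from_nat_into D"
  have c: "\<exists>i. dist x (c i) < \<epsilon>" if "x \<in> Rn n" "0 < \<epsilon>" for x \<epsilon>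
    using D(3)[OF that] range_from_nat_into[OF \<open>D \<noteq> {}\<close> D(1)] unfolding c_def by (metis imageE)
  \<comment> \<open>A cell bounds the first component and confines the second to a small ball, so a
    selection through the cell of \<open>(v, a)\<close> has its second component close to
    \<open>a\<close>.\<close>
  define K where "K j = (case from_nat j of (R, i, k) \<Rightarrow> cball (0::'v) (real R) \<times> (Rn n \<inter> cball (c i) (inverse (real (Suc k)))))" for j
  have Kcpt: "compact (K j)" for j
    unfolding K_def by (auto simp: split_beta intro!: compact_Times cpt compact_Rn_cball)
  let ?T = "residual P"
  have cl: "\<And>x. closed (?T x)" by (rule closed_residual[OF P(3)])
  have hits: "\<And>C. compact C \<Longrightarrow> {x. ?T x \<inter> C \<noteq> {}} \<in> sets borel"
    by (rule residual_hits_compact_borel[OF P])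
  have "\<exists>w. (\<forall>x. ?T x \<inter> K j \<noteq> {} \<longrightarrow> w x \<in> ?T x \<inter> K j) \<and> (\<forall>G. open G \<longrightarrow> {x. ?T x \<inter> K j \<noteq> {} \<and> w x \<in> G} \<in> sets borel)" for j
    by (rule compact_measurable_selection[OF Kcpt[of j] cl hits]) blast+
  then have "\<forall>j. \<exists>w. (\<forall>x. ?T x \<inter> K j \<noteq> {} \<longrightarrow> w x \<in> ?T x \<inter> K j) \<and> (\<forall>G. open G \<longrightarrow> {x. ?T x \<inter> K j \<noteq> {} \<and> w x \<in> G} \<in> sets borel)"
    by blast
  from choice[OF this] obtain w where "\<forall>j. (\<forall>x. ?T x \<inter> K j \<noteq> {} \<longrightarrow> w j x \<in> ?T x \<inter> K j) \<and> (\<forall>G. open G \<longrightarrow> {x. ?T x \<inter> K j \<noteq> {} \<and> w j x \<in> G} \<in> sets borel)"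
    by blast
  then have w: "\<And>x j. ?T x \<inter> K j \<noteq> {} \<Longrightarrow> w j x \<in> ?T x \<inter> K j"
    "\<And>j G. open G \<Longrightarrow> {x. ?T x \<inter> K j \<noteq> {} \<and> w j x \<in> G} \<in> sets borel" by blast+
  \<comment> \<open>The default \<open>0\<close> adds nothing to a span, and a nonzero value
    certifies a genuine selection.\<close>
  define b where "b x j = (if ?T x \<inter> K j \<noteq> {} then snd (w j x) else 0)" for x j
  have KRn: "p \<in> K j \<Longrightarrow> snd p \<in> Rn n" for p j by (auto simp: K_def split: prod.splits)
  have bRn: "b x j \<in> Rn n" for x j
    using w(1)[of x j] Rn0 KRn[of "w j x" j] by (simp add: b_def)
  have bmeas: "(\<lambda>x. ?lk (b x j) i) \<in> borel_measurable borel" for j i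
  proof (rule borel_measurableI_less)
    fix r :: real
    have hit: "{x. ?T x \<inter> K j \<noteq> {}} \<in> sets borel" by (rule residual_hits_compact_borel[OF P Kcpt])
    have "open {p :: 'v \<times> (nat \<Rightarrow>\<^sub>0 real). ?lk (snd p) i < r}"
      by (intro open_Collect_less continuous_on_compose2[OF continuous_on_lookup[of UNIV]] continuous_intros) auto
    from w(2)[OF this, of j] have "{x. ?T x \<inter> K j \<noteq> {} \<and> ?lk (snd (w j x)) i < r} \<in> sets borel" by simp
    moreover have "(if 0 < r then - {x. ?T x \<inter> K j \<noteq> {}} else {}) \<in> sets borel"
      using borel_comp[OF hit] by simp
    ultimately have "{x. ?T x \<inter> K j \<noteq> {} \<and> ?lk (snd (w j x)) i < r} \<union> (if 0 < r then - {x. ?T x \<inter> K j \<noteq> {}} else {}) \<in> sets borel"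
      by (rule sets.Un)
    moreover have "{x. ?T x \<inter> K j \<noteq> {} \<and> ?lk (snd (w j x)) i < r} \<union> (if 0 < r then - {x. ?T x \<inter> K j \<noteq> {}} else {})
        = {x. ?lk (b x j) i < r}" by (auto simp: b_def)
    ultimately show "{x \<in> space borel. ?lk (b x j) i < r} \<in> sets borel" by simp
  qed
  \<comment> \<open>Selections sit at even places and standard basis vectors at odd ones; the latter
    guarantee \<open>n \<ge> d\<close> independent vectors at every point.\<close>
  define \<beta> where "\<beta> x m = (if even m then b x (m div 2) else if m div 2 < n then Rn_basis (m div 2) else 0)" for x m
  have \<beta>Rn: "\<beta> x m \<in> Rn n" for x m using bRn Rn0 by (auto simp: \<beta>_def Rn_def)
  have \<beta>meas: "(\<lambda>x. ?lk (\<beta> x m) i) \<in> borel_measurable borel" for m i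
    unfolding \<beta>_def using bmeas by (cases "even m") auto
  have comb_Rn: "(\<Sum>i<d. r i *\<^sub>R \<beta> x (l ! i)) \<in> Rn n" for r x l
    by (intro subspace_sum[OF subspace_Rn] subspace_scale[OF subspace_Rn] \<beta>Rn)
  have norm_meas: "(\<lambda>x. norm (y x - (\<Sum>i<d. r i *\<^sub>R \<beta> x (l ! i)))) \<in> borel_measurable borel"
    if "\<And>x. y x \<in> Rn n" "\<And>i. (\<lambda>x. ?lk (y x) i) \<in> borel_measurable borel" for y r l
    using that \<beta>meas
    by (intro borel_measurable_norm_Rn[of _ n] subspace_diff[OF subspace_Rn] comb_Rn)
      (auto simp: lookup_minus lookup_poly_sum lookup_scaleR)
  define good where "good x l \<longleftrightarrow> indep_upto d (\<lambda>i. \<beta> x (l ! i)) \<and> (\<forall>j. b x j \<in> span ((\<lambda>i. \<beta> x (l ! i)) ` {..<d}))" for x and l :: "nat list"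
  have cPi: "countable ({..<d} \<rightarrow>\<^sub>E (\<rat>::real set))" by (intro countable_PiE) (auto intro: countable_rat)
  have good_borel: "{x. good x l} \<in> sets borel" for l
  proof -
    let ?N = "\<lambda>r y x. norm (y x - (\<Sum>i<d. r i *\<^sub>R \<beta> x (l ! i)))"
    have ne: "{..<d} \<rightarrow>\<^sub>E (\<rat>::real set) \<noteq> {}" using Rats_0 by (simp add: PiE_eq_empty_iff) blast
    have "(\<lambda>x. ?N r (\<lambda>_. 0) x) \<in> borel_measurable borel" for r
      using Rn0 by (intro norm_meas) auto
    then have "(\<lambda>x. real k * ?N r (\<lambda>_. 0) x) \<in> borel_measurable borel" for r and k :: nat
      by (rule borel_measurable_times[OF borel_measurable_const])
    then have 1: "{x. t \<le> real k * ?N r (\<lambda>_. 0) x} \<in> sets borel" for r t and k :: nat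
      unfolding borel_measurable_iff_ge by simp
    have "(\<lambda>x. ?N r (\<lambda>x. b x j) x) \<in> borel_measurable borel" for r j
      using bRn bmeas by (intro norm_meas) auto
    then have 2: "{x. ?N r (\<lambda>x. b x j) x < t} \<in> sets borel" for r j t
      unfolding borel_measurable_iff_less by simp
    have "{x. good x l} = (\<Union>k::nat. \<Inter>r\<in>{..<d} \<rightarrow>\<^sub>E \<rat>. {x. (\<Sum>i<d. \<bar>r i\<bar>) \<le> real k * ?N r (\<lambda>_. 0) x})
        \<inter> (\<Inter>j. \<Inter>k. \<Union>r\<in>{..<d} \<rightarrow>\<^sub>E \<rat>. {x. ?N r (\<lambda>x. b x j) x < inverse (real (Suc k))})"
      unfolding good_def indep_upto_iff_rational in_span_iff_rational by (auto simp del: of_nat_Suc)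
    also have "\<dots> \<in> sets borel"
      by (intro sets.Int sets.countable_UN'' sets.countable_INT' image_subsetI cPi ne 1 2) auto
    finally show ?thesis .
  qed
  have good_ex: "\<exists>l. good x l" if x: "x \<in> S" for x
  proof -
    obtain B0 where B0: "B0 \<subseteq> range (b x)" "independent B0" "range (b x) \<subseteq> span B0"
      using maximal_independent_subset[of "range (b x)"] by blast
    have "B0 \<subseteq> range (\<beta> x)"
    proof
      fix y assume "y \<in> B0"
      then obtain j where "y = b x j" using B0(1) by blast
      then have "y = \<beta> x (2 * j)" by (simp add: \<beta>_def)
      then show "y \<in> range (\<beta> x)" by blast
    qed
    then obtain B where B: "B0 \<subseteq> B" "B \<subseteq> range (\<beta> x)" "independent B" "range (\<beta> x) \<subseteq> span B"
      using maximal_independent_subset_extend[OF _ B0(2)] by blast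
    have "B \<subseteq> span (Rn_basis ` {..<n})" using B(2) \<beta>Rn by (auto simp: Rn_eq_span[symmetric])
    then have finB: "finite B" using independent_span_bound[of "Rn_basis ` {..<n}" B] B(3) by auto
    have "Rn_basis i \<in> span B" if "i < n" for i
    proof -
      have "Rn_basis i = \<beta> x (2 * i + 1)" using that by (simp add: \<beta>_def)
      then show ?thesis using B(4) by blast
    qed
    then have "n \<le> card B" by (intro indep_upto_le_card[OF indep_upto_Rn_basis finB]) auto
    have "card B0 \<le> d"
    proof (rule ccontr)
      assume "\<not> card B0 \<le> d"
      then obtain B' where B': "B' \<subseteq> B0" "card B' = Suc d" "finite B'"
        using obtain_subset_with_card_n[of "Suc d" B0] by auto
      then have "independent B'" using B0(2) independent_mono by blast
      then obtain v where v: "indep_upto (Suc d) v" "v ` {..<Suc d} = B'"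
        using indep_upto_of_independent[OF B'(3)] B'(2) by metis
      have "\<exists>p. p \<in> ?T x \<and> snd p \<in> Rn n \<and> snd p = v i" if i: "i \<le> d" for i
      proof -
        have "v i \<in> B'" using v(2) i by auto
        then obtain j where j: "v i = b x j" using B'(1) B0(1) by blast
        have "v i \<noteq> 0" using \<open>v i \<in> B'\<close> \<open>independent B'\<close> dependent_zero by metis
        then have "?T x \<inter> K j \<noteq> {}" using j by (auto simp: b_def)
        then have "w j x \<in> ?T x" "b x j = snd (w j x)" using w(1)[of x j] by (auto simp: b_def)
        then show ?thesis using bRn[of x j] j by metis
      qed
      then obtain p where "\<And>i. i \<le> d \<Longrightarrow> p i \<in> ?T x \<and> snd (p i) \<in> Rn n \<and> snd (p i) = v i" by metis
      moreover from this have "indep_upto (Suc d) (\<lambda>i. snd (p i))"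
        using v(1) unfolding indep_upto_def by (simp add: less_Suc_eq_le cong: sum.cong_simp)
      ultimately show False using dim[OF x, of p] by blast
    qed
    then obtain B1 where B1: "B0 \<subseteq> B1" "B1 \<subseteq> B" "card B1 = d"
      using exists_subset_between[of B0 d B] dn \<open>n \<le> card B\<close> B(1) finB by auto
    then have "finite B1" "independent B1" using finB B(3) finite_subset independent_mono by blast+
    then obtain v where v: "indep_upto d v" "v ` {..<d} = B1"
      using indep_upto_of_independent[of B1] B1(3) by metis
    have "\<exists>m. v i = \<beta> x m" if "i < d" for i using v(2) B1(2) B(2) that by blast
    then obtain m where m: "\<And>i. i < d \<Longrightarrow> v i = \<beta> x (m i)" by metis
    let ?l = "map m [0..<d]"
    have eq: "\<beta> x (?l ! i) = v i" if "i < d" for i using m[OF that] that by simp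
    have "indep_upto d (\<lambda>i. \<beta> x (?l ! i))" using v(1) eq unfolding indep_upto_def by simp
    moreover have "(\<lambda>i. \<beta> x (?l ! i)) ` {..<d} = B1" using v(2) eq by force
    moreover have "b x j \<in> span B1" for j using B0(3) span_mono[OF B1(1)] by blast
    ultimately show ?thesis unfolding good_def by metis
  qed
  \<comment> \<open>The first good list of indices is constant on Borel pieces of \<open>S\<close>,
    and on each piece the frame is measurable.\<close>
  define lx where "lx x = (LEAST k. good x (from_nat k))" for x
  have lx: "good x (from_nat (lx x))" if xS: "x \<in> S" for x
  proof -
    obtain l where "good x l" using good_ex[OF xS] by blast
    then have "good x (from_nat (to_nat l))" by simp
    then show ?thesis unfolding lx_def by (rule LeastI)
  qed
  have lx_borel: "{x \<in> S. lx x = k} \<in> sets borel" for k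
  proof -
    have "{x \<in> S. lx x = k} = S \<inter> ({x. good x (from_nat k)} - (\<Union>i\<in>{..<k}. {x. good x (from_nat i)}))"
    proof (intro equalityI subsetI)
      fix x assume "x \<in> {x \<in> S. lx x = k}"
      then show "x \<in> S \<inter> ({x. good x (from_nat k)} - (\<Union>i\<in>{..<k}. {x. good x (from_nat i)}))"
        using lx not_less_Least unfolding lx_def by blast
    next
      fix x assume x: "x \<in> S \<inter> ({x. good x (from_nat k)} - (\<Union>i\<in>{..<k}. {x. good x (from_nat i)}))"
      then have "lx x = k" unfolding lx_def by (intro Least_equality) (auto simp: not_less[symmetric])
      then show "x \<in> {x \<in> S. lx x = k}" using x by blast
    qed
    then show ?thesis using good_borel S by (auto intro!: sets.Int sets.Diff sets.finite_UN)
  qed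
  define \<tau> where "\<tau> x = span ((\<lambda>i. \<beta> x (from_nat (lx x) ! i)) ` {..<d})" for x
  show thesis
  proof
    show "\<tau> \<in> measurable (restrict_space borel S) (gr_borel n d)"
      unfolding gr_borel_def
    proof (rule measurable_measure_of)
      show "{U. gr_open n d U} \<subseteq> Pow (Gr n d)" by (auto simp: gr_open_def)
      show "\<tau> \<in> space (restrict_space borel S) \<rightarrow> Gr n d"
      proof
        fix x assume "x \<in> space (restrict_space borel S)"
        then have "x \<in> S" by (simp add: space_restrict_space)
        then have ind: "indep_upto d (\<lambda>i. \<beta> x (from_nat (lx x) ! i))" using lx by (auto simp: good_def)
        have "\<tau> x \<subseteq> Rn n" unfolding \<tau>_def using \<beta>Rn subspace_Rn by (intro span_minimal) auto
        then show "\<tau> x \<in> Gr n d" using dim_span_image_lessThan[OF ind] by (simp add: Gr_def \<tau>_def)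
      qed
      fix U assume "U \<in> {U. gr_open n d U}"
      then have U: "gr_open n d U" by simp
      have "{x \<in> {x \<in> S. lx x = k}. span ((\<lambda>i. \<beta> x (from_nat k ! i)) ` {..<d}) \<in> U} \<in> sets borel" for k
      proof (rule span_measurable_gr_open[OF lx_borel U \<beta>Rn])
        show "indep_upto d (\<lambda>i. \<beta> x (from_nat k ! i))" if "x \<in> {x \<in> S. lx x = k}" for x
          using lx[of x] that by (auto simp: good_def)
        fix i c \<rho> assume c: "c \<in> Rn n"
        have "(\<lambda>x. norm (\<beta> x (from_nat k ! i) - c)) \<in> borel_measurable borel"
          using c \<beta>meas by (intro borel_measurable_norm_Rn[of _ n] subspace_diff[OF subspace_Rn] \<beta>Rn) (auto simp: lookup_minus)
        then have "{x. norm (\<beta> x (from_nat k ! i) - c) < \<rho>} \<in> sets borel" by simp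
        then show "{x \<in> {x \<in> S. lx x = k}. dist (\<beta> x (from_nat k ! i)) c < \<rho>} \<in> sets borel"
          using lx_borel[of k] sets.Int[of "{x \<in> S. lx x = k}" borel "{x. norm (\<beta> x (from_nat k ! i) - c) < \<rho>}"]
          by (simp add: dist_norm Int_def)
      qed
      then have "(\<Union>k. {x \<in> {x \<in> S. lx x = k}. span ((\<lambda>i. \<beta> x (from_nat k ! i)) ` {..<d}) \<in> U}) \<in> sets borel"
        by (intro sets.countable_UN) auto
      also have "(\<Union>k. {x \<in> {x \<in> S. lx x = k}. span ((\<lambda>i. \<beta> x (from_nat k ! i)) ` {..<d}) \<in> U}) = {x \<in> S. \<tau> x \<in> U}"
        by (auto simp: \<tau>_def)
      finally show "\<tau> -` U \<inter> space (restrict_space borel S) \<in> sets (restrict_space borel S)"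
        using S by (auto simp: sets_restrict_space_iff space_restrict_space vimage_def Int_def conj_commute)
    qed
    fix x v a assume x: "x \<in> S" and va: "(v, a) \<in> ?T x" and a: "a \<in> Rn n"
    have "a \<in> closure (\<tau> x)"
      unfolding closure_approachable
    proof (intro allI impI)
      fix e :: real assume "e > 0"
      then obtain k where k: "inverse (real (Suc k)) < e / 2" using reals_Archimedean half_gt_zero by blast
      obtain i where i: "dist a (c i) < inverse (real (Suc k))" using c[OF a] by (metis inverse_positive_iff_positive of_nat_0_less_iff zero_less_Suc)
      obtain R :: nat where R: "norm v \<le> real R" using real_arch_simple by blast
      define j where "j = to_nat (R, i, k)"
      have K: "K j = cball 0 (real R) \<times> (Rn n \<inter> cball (c i) (inverse (real (Suc k))))"
        by (simp add: K_def j_def)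
      have "(v, a) \<in> ?T x \<inter> K j" using va a i R by (simp add: K dist_commute)
      then have hit: "?T x \<inter> K j \<noteq> {}" by blast
      then have "dist (c i) (b x j) \<le> inverse (real (Suc k))" using w(1)[OF hit] by (auto simp: b_def K)
      then have "dist (b x j) a < e" using i k dist_triangle[of "b x j" a "c i"] by (simp add: dist_commute)
      moreover have "b x j \<in> \<tau> x" using lx[OF x] by (auto simp: good_def \<tau>_def)
      ultimately show "\<exists>y\<in>\<tau> x. dist y a < e" by blast
    qed
    moreover have "closed (\<tau> x)" unfolding \<tau>_def by (intro closed_span_finite) simp
    ultimately show "a \<in> \<tau> x" by (simp add: closure_closed)
  qed
qed

section \<open>Curves through sets with prescribed approximate derivatives\<close>

text \<open>The notion of a set that is null for all curves running inside a cone, with the cone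
  replaced by the open ball of velocities at distance less than \<open>\<epsilon>\<close> from
  \<open>u\<close>.\<close>

definition direction_null :: "'a::real_normed_vector set \<Rightarrow> 'a \<Rightarrow> real \<Rightarrow> bool" where
  "direction_null A u \<epsilon> \<longleftrightarrow> (\<forall>K \<gamma>. curve_fragment K \<gamma> \<longrightarrow>
     (AE t in lborel. t \<in> K \<and> \<gamma> t \<in> A \<longrightarrow> (\<forall>v. (\<gamma> has_vector_derivative v) (at t within K) \<longrightarrow> \<epsilon> \<le> norm (v - u))))"

text \<open>Points of \<open>A\<close> that see a gap of \<open>A\<close> in direction \<open>u\<close> at arbitrarily small scales are porosity points
  of every curve through \<open>A\<close> in a direction close to \<open>u\<close>.\<close>

lemma direction_null_gaps:
  fixes A :: "'a::real_normed_vector set"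
  assumes "\<epsilon> > 0" "c \<noteq> 0"
  shows "direction_null (A - (\<Union>k. {x. \<forall>m\<ge>k. \<exists>y\<in>A. norm (y - x - (c * inverse (real (Suc m))) *\<^sub>R u) < 2 * \<epsilon> * \<bar>c\<bar> * inverse (real (Suc m))})) u \<epsilon>"
    (is "direction_null (A - ?G) u \<epsilon>")
  unfolding direction_null_def
proof (intro allI impI)
  fix K and \<gamma> :: "real \<Rightarrow> 'a" assume "curve_fragment K \<gamma>"
  show "AE t in lborel. t \<in> K \<and> \<gamma> t \<in> A - ?G \<longrightarrow> (\<forall>v. (\<gamma> has_vector_derivative v) (at t within K) \<longrightarrow> \<epsilon> \<le> norm (v - u))"
    using AE_not_porous[of "{t \<in> K. \<gamma> t \<in> A}"]
  proof (rule eventually_mono, intro impI allI, elim conjE)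
    fix t v
    assume np: "t \<in> {t \<in> K. \<gamma> t \<in> A} \<longrightarrow> (\<forall>\<eta>>0. \<exists>\<delta>>0. \<forall>s. 0 < \<bar>s\<bar> \<and> \<bar>s\<bar> < \<delta> \<longrightarrow>
        (\<exists>s'. t + s' \<in> {t \<in> K. \<gamma> t \<in> A} \<and> \<bar>s' - s\<bar> < \<eta> * \<bar>s\<bar>))"
      and t: "t \<in> K" "\<gamma> t \<in> A - ?G" and v: "(\<gamma> has_vector_derivative v) (at t within K)"
    show "\<epsilon> \<le> norm (v - u)"
    proof (rule ccontr)
      assume "\<not> \<epsilon> \<le> norm (v - u)"
      then have vu: "norm (v - u) < \<epsilon>" by simp
      \<comment> \<open>Moving from \<open>s\<close> to an available time \<open>s'\<close> then
        costs at most \<open>\<epsilon> / 4\<close> per unit of \<open>\<bar>s\<bar>\<close>, and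
        \<open>\<eta> \<le> 1\<close> gives
        \<open>\<bar>s'\<bar> \<le> 2 * \<bar>s\<bar>\<close>.\<close>
      define \<eta> where "\<eta> = min 1 (\<epsilon> / (4 * (norm v + 1)))"
      have \<eta>: "\<eta> > 0" "\<eta> \<le> 1" "\<eta> * norm v \<le> \<epsilon> / 4"
      proof -
        show "\<eta> > 0" using assms(1) by (simp add: \<eta>_def add_nonneg_pos)
        show "\<eta> \<le> 1" by (simp add: \<eta>_def)
        have "\<eta> * norm v \<le> \<epsilon> / (4 * (norm v + 1)) * (norm v + 1)"
          using assms(1) by (intro mult_mono) (auto simp: \<eta>_def)
        also have "\<dots> = \<epsilon> / 4" using norm_ge_zero[of v] by (simp add: field_simps add_nonneg_eq_0_iff)
        finally show "\<eta> * norm v \<le> \<epsilon> / 4" .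
      qed
      have "t \<in> {t \<in> K. \<gamma> t \<in> A}" using t by simp
      from mp[OF np this, rule_format, OF \<eta>(1)] obtain \<delta>1 where "\<delta>1 > 0" and
        d1: "\<forall>s. 0 < \<bar>s\<bar> \<and> \<bar>s\<bar> < \<delta>1 \<longrightarrow> (\<exists>s'. t + s' \<in> {t \<in> K. \<gamma> t \<in> A} \<and> \<bar>s' - s\<bar> < \<eta> * \<bar>s\<bar>)"
        by blast
      have \<delta>1: "\<delta>1 > 0" "\<And>s. 0 < \<bar>s\<bar> \<Longrightarrow> \<bar>s\<bar> < \<delta>1 \<Longrightarrow>
          \<exists>s'. t + s' \<in> K \<and> \<gamma> (t + s') \<in> A \<and> \<bar>s' - s\<bar> < \<eta> * \<bar>s\<bar>"
      proof -
        show "\<delta>1 > 0" by fact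
        fix s :: real assume "0 < \<bar>s\<bar>" "\<bar>s\<bar> < \<delta>1"
        with d1 have "\<exists>s'. t + s' \<in> {t \<in> K. \<gamma> t \<in> A} \<and> \<bar>s' - s\<bar> < \<eta> * \<bar>s\<bar>" by blast
        then show "\<exists>s'. t + s' \<in> K \<and> \<gamma> (t + s') \<in> A \<and> \<bar>s' - s\<bar> < \<eta> * \<bar>s\<bar>" by blast
      qed
      have e4: "\<epsilon> / 4 > 0" using assms(1) by simp
      obtain \<delta>2 where \<delta>2: "\<delta>2 > 0" "\<And>s. s \<in> K \<Longrightarrow> \<bar>s - t\<bar> < \<delta>2 \<Longrightarrow> norm (\<gamma> s - \<gamma> t - (s - t) *\<^sub>R v) \<le> \<epsilon> / 4 * \<bar>s - t\<bar>"
        using v[unfolded has_vector_derivative_within_alt, rule_format, OF e4] by blast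
      obtain k where k: "inverse (real (Suc k)) < min \<delta>1 (\<delta>2 / 2) / \<bar>c\<bar>"
        using reals_Archimedean[of "min \<delta>1 (\<delta>2 / 2) / \<bar>c\<bar>"] \<delta>1(1) \<delta>2(1) assms(2) by auto
      have "\<exists>y\<in>A. norm (y - \<gamma> t - (c * inverse (real (Suc m))) *\<^sub>R u) < 2 * \<epsilon> * \<bar>c\<bar> * inverse (real (Suc m))" if "m \<ge> k" for m
      proof -
        define s where "s = c * inverse (real (Suc m))"
        have s0: "\<bar>s\<bar> = \<bar>c\<bar> * inverse (real (Suc m))" by (simp add: s_def abs_mult)
        have "inverse (real (Suc m)) \<le> inverse (real (Suc k))" using that by (intro le_imp_inverse_le) auto
        then have "inverse (real (Suc m)) < min \<delta>1 (\<delta>2 / 2) / \<bar>c\<bar>" using k by (rule order_le_less_trans)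
        then have s: "0 < \<bar>s\<bar>" "\<bar>s\<bar> < \<delta>1" "2 * \<bar>s\<bar> < \<delta>2"
          using assms(2) unfolding s0 by (auto simp: pos_less_divide_eq mult.commute)
        obtain s' where s': "t + s' \<in> K" "\<gamma> (t + s') \<in> A" "\<bar>s' - s\<bar> < \<eta> * \<bar>s\<bar>" using \<delta>1(2)[OF s(1,2)] by blast
        have "\<eta> * \<bar>s\<bar> \<le> 1 * \<bar>s\<bar>" using \<eta> by (intro mult_right_mono) auto
        then have s'2: "\<bar>s'\<bar> \<le> 2 * \<bar>s\<bar>" using s'(3) by linarith
        have "\<gamma> (t + s') - \<gamma> t - s *\<^sub>R u = (\<gamma> (t + s') - \<gamma> t - s' *\<^sub>R v) + ((s' - s) *\<^sub>R v + s *\<^sub>R (v - u))"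
          by (simp add: algebra_simps)
        also have "norm \<dots> \<le> norm (\<gamma> (t + s') - \<gamma> t - s' *\<^sub>R v) + (norm ((s' - s) *\<^sub>R v) + norm (s *\<^sub>R (v - u)))"
          by (intro order_trans[OF norm_triangle_ineq] add_left_mono norm_triangle_ineq)
        also have "\<dots> \<le> \<epsilon> / 2 * \<bar>s\<bar> + (\<epsilon> / 4 * \<bar>s\<bar> + \<bar>s\<bar> * norm (v - u))"
        proof (intro add_mono)
          have "norm (\<gamma> (t + s') - \<gamma> t - s' *\<^sub>R v) \<le> \<epsilon> / 4 * \<bar>s'\<bar>"
            using \<delta>2(2)[OF s'(1)] s'2 s(3) by simp
          also have "\<dots> \<le> \<epsilon> / 4 * (2 * \<bar>s\<bar>)" using s'2 e4 by (intro mult_left_mono) auto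
          finally show "norm (\<gamma> (t + s') - \<gamma> t - s' *\<^sub>R v) \<le> \<epsilon> / 2 * \<bar>s\<bar>" by simp
          have "\<bar>s' - s\<bar> * norm v \<le> \<eta> * \<bar>s\<bar> * norm v" using s'(3) by (intro mult_right_mono) auto
          also have "\<dots> = \<bar>s\<bar> * (\<eta> * norm v)" by simp
          also have "\<dots> \<le> \<bar>s\<bar> * (\<epsilon> / 4)" using \<eta>(3) by (intro mult_left_mono) auto
          finally show "norm ((s' - s) *\<^sub>R v) \<le> \<epsilon> / 4 * \<bar>s\<bar>" by (simp add: mult.commute)
        qed simp
        \<comment> \<open>Since \<open>norm (v - u) < \<epsilon>\<close>, the total is below
          \<open>7 * \<epsilon> / 4\<close> per unit of \<open>\<bar>s\<bar>\<close>; the factor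
          \<open>2\<close> in the gap condition leaves room for this.\<close>
        also have "\<dots> = (3 * \<epsilon> / 4 + norm (v - u)) * \<bar>s\<bar>" by (simp add: algebra_simps)
        also have "\<dots> < 2 * \<epsilon> * \<bar>s\<bar>" using vu assms(1) s(1) by (intro mult_strict_right_mono) auto
        finally show ?thesis using s'(2) unfolding s0 by (intro bexI[of _ "\<gamma> (t + s')"]) (simp_all add: s_def mult_ac)
      qed
      then show False using t(2) by blast
    qed
  qed
qed

text \<open>
  Points of \<open>A\<close> with a neighbour of \<open>A\<close> in the last direction at all small scales only start chains that are
  shorter by one step; the remaining points of \<open>A\<close> see gaps in the last direction.
\<close>

lemma direction_null_decomposition:
  fixes A :: "'a::real_normed_vector set" and u :: "nat \<Rightarrow> 'a" and c :: "nat \<Rightarrow> real"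
  assumes \<epsilon>: "\<epsilon> > 0" and c: "\<And>l. l < j \<Longrightarrow> c l \<noteq> 0"
    and A: "A \<in> sets borel" and "\<delta> > 0"
    and no_chain: "\<And>m x. inverse (real (Suc m)) < \<delta> \<Longrightarrow> (\<And>l. l \<le> j \<Longrightarrow> x l \<in> A) \<Longrightarrow>
       (\<And>l. l < j \<Longrightarrow> norm (x (Suc l) - x l - (c l * inverse (real (Suc m))) *\<^sub>R u l) < 2 * \<epsilon> * \<bar>c l\<bar> * inverse (real (Suc m))) \<Longrightarrow> False"
  shows "\<exists>Q. countable Q \<and> A \<subseteq> (\<Union>p\<in>Q. fst p) \<and> (\<forall>(A', l)\<in>Q. A' \<in> sets borel \<and> l < j \<and> direction_null A' (u l) \<epsilon>)"
  using c A \<open>\<delta> > 0\<close> no_chain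
proof (induction j arbitrary: A \<delta>)
  case 0
  obtain m where m: "inverse (real (Suc m)) < \<delta>" using reals_Archimedean 0(3) by blast
  have "A = {}"
  proof (rule ccontr)
    assume "A \<noteq> {}"
    then obtain z where "z \<in> A" by blast
    then show False using 0(4)[OF m, of "\<lambda>_. z"] by simp
  qed
  then show ?case by (intro exI[of _ "{}"]) auto
next
  case (Suc j)
  \<comment> \<open>Only the scales \<open>1 / (m + 1)\<close> are used: this makes
    \<open>G k\<close> a countable intersection of open sets and gives all steps of a chain the same
    factor.\<close>
  define G where "G k = {x. \<forall>m\<ge>k. \<exists>y\<in>A. norm (y - x - (c j * inverse (real (Suc m))) *\<^sub>R u j) < 2 * \<epsilon> * \<bar>c j\<bar> * inverse (real (Suc m))}" for k
  have G_borel: "G k \<in> sets borel" for k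
  proof -
    have "G k = (\<Inter>m\<in>{k..}. \<Union>y\<in>A. ball (y - (c j * inverse (real (Suc m))) *\<^sub>R u j) (2 * \<epsilon> * \<bar>c j\<bar> * inverse (real (Suc m))))"
      by (auto simp: G_def dist_norm algebra_simps)
    also have "\<dots> \<in> sets borel"
      by (intro sets.countable_INT' image_subsetI borel_open open_UN) auto
    finally show ?thesis .
  qed
  have "\<exists>Q. countable Q \<and> A \<inter> G k \<subseteq> (\<Union>p\<in>Q. fst p) \<and> (\<forall>(A', l)\<in>Q. A' \<in> sets borel \<and> l < j \<and> direction_null A' (u l) \<epsilon>)" for k
  proof (rule Suc.IH)
    \<comment> \<open>Below the scale \<open>inverse (real (Suc k))\<close> only indices
      \<open>m \<ge> k\<close> occur, and for these \<open>G k\<close> supplies one more point at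
      the end of the chain.\<close>
    show "min \<delta> (inverse (real (Suc k))) > 0" using Suc.prems(3) by simp
    show "A \<inter> G k \<in> sets borel" using Suc.prems(2) G_borel by (rule sets.Int)
    fix m x
    assume m: "inverse (real (Suc m)) < min \<delta> (inverse (real (Suc k)))" and x: "\<And>l. l \<le> j \<Longrightarrow> x l \<in> A \<inter> G k"
      and ch: "\<And>l. l < j \<Longrightarrow> norm (x (Suc l) - x l - (c l * inverse (real (Suc m))) *\<^sub>R u l) < 2 * \<epsilon> * \<bar>c l\<bar> * inverse (real (Suc m))"
    have "k \<le> m"
    proof (rule ccontr)
      assume "\<not> k \<le> m"
      then have "inverse (real (Suc k)) \<le> inverse (real (Suc m))" by (intro le_imp_inverse_le) auto
      then show False using m by linarith
    qed
    then obtain y where y: "y \<in> A" "norm (y - x j - (c j * inverse (real (Suc m))) *\<^sub>R u j) < 2 * \<epsilon> * \<bar>c j\<bar> * inverse (real (Suc m))"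
      using x[of j] unfolding G_def by blast
    show False
    proof (rule Suc.prems(4)[of m "x(Suc j := y)"])
      show "inverse (real (Suc m)) < \<delta>" using m by simp
      show "(x(Suc j := y)) l \<in> A" if "l \<le> Suc j" for l using that x[of l] y(1) by auto
      show "norm ((x(Suc j := y)) (Suc l) - (x(Suc j := y)) l - (c l * inverse (real (Suc m))) *\<^sub>R u l) < 2 * \<epsilon> * \<bar>c l\<bar> * inverse (real (Suc m))"
        if "l < Suc j" for l
      proof (cases "l = j")
        case True
        then show ?thesis using y(2) by simp
      next
        case False
        then have "l < j" using that by simp
        then show ?thesis using ch[of l] by simp
      qed
    qed
  qed (use Suc.prems(1) in auto)
  then obtain Q where Q: "\<And>k. countable (Q k)" "\<And>k. A \<inter> G k \<subseteq> (\<Union>p\<in>Q k. fst p)"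
    "\<And>k A' l. (A', l) \<in> Q k \<Longrightarrow> A' \<in> sets borel \<and> l < j \<and> direction_null A' (u l) \<epsilon>"
    by (metis (no_types, lifting) case_prodD)
  let ?Q = "insert (A - (\<Union>k. G k), j) (\<Union>k. Q k)"
  show ?case
  proof (intro exI[of _ ?Q] conjI)
    show "countable ?Q" using Q(1) by auto
    show "A \<subseteq> (\<Union>p\<in>?Q. fst p)" using Q(2) by auto
    have "A - (\<Union>k. G k) \<in> sets borel" using Suc.prems(2) G_borel by (intro sets.Diff sets.countable_UN) auto
    moreover have "direction_null (A - (\<Union>k. G k)) (u j) \<epsilon>"
      unfolding G_def using Suc.prems(1) by (intro direction_null_gaps \<epsilon>) auto
    ultimately show "\<forall>(A', l)\<in>?Q. A' \<in> sets borel \<and> l < Suc j \<and> direction_null A' (u l) \<epsilon>"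
      using Q(3) by (fastforce simp: less_Suc_eq)
  qed
qed

text \<open>Fixing the range \<open>\<delta>\<close> of the scales makes the set closed for
  continuous \<open>F\<close>; a point with directional derivative \<open>a\<close> belongs to it,
  for given \<open>\<epsilon> > 0\<close>, once \<open>\<delta>\<close> is small.\<close>

definition approx_derivative :: "('a::real_normed_vector \<Rightarrow> 'b::real_normed_vector) \<Rightarrow> real \<Rightarrow> real \<Rightarrow> 'a \<Rightarrow> 'b \<Rightarrow> 'a set" where
  "approx_derivative F \<epsilon> \<delta> u a = {x. \<forall>s. \<bar>s\<bar> < \<delta> \<longrightarrow> norm (F (x + s *\<^sub>R u) - F x - s *\<^sub>R a) \<le> \<epsilon> * \<bar>s\<bar>}"

lemma closed_approx_derivative:
  assumes "L-lipschitz_on UNIV F"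
  shows "closed (approx_derivative F \<epsilon> \<delta> u a)"
proof -
  have cont: "continuous_on UNIV F" using assms by (rule lipschitz_on_continuous_on)
  have "closed (\<Inter>s\<in>{s. \<bar>s\<bar> < \<delta>}. {x. norm (F (x + s *\<^sub>R u) - F x - s *\<^sub>R a) \<le> \<epsilon> * \<bar>s\<bar>})"
    by (intro closed_INT ballI closed_Collect_le continuous_intros continuous_on_compose2[OF cont]) auto
  also have "(\<Inter>s\<in>{s. \<bar>s\<bar> < \<delta>}. {x. norm (F (x + s *\<^sub>R u) - F x - s *\<^sub>R a) \<le> \<epsilon> * \<bar>s\<bar>}) = approx_derivative F \<epsilon> \<delta> u a"
    by (auto simp: approx_derivative_def)
  finally show ?thesis .
qed

text \<open>
  Along such a chain the increments of \<open>F\<close> add up to about \<open>h \<Sum> c a\<close>, while the endpoints are only about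
  \<open>h \<Sum> c u\<close> apart.
\<close>

lemma approx_derivative_no_chain:
  fixes F :: "'a::real_normed_vector \<Rightarrow> 'b::real_normed_vector"
  assumes lip: "L-lipschitz_on UNIV F" and \<epsilon>: "\<epsilon> > 0"
    and bad: "L * norm (\<Sum>l<N. c l *\<^sub>R u l) + (1 + 4 * L) * \<epsilon> * (\<Sum>l<N. \<bar>c l\<bar>) < norm (\<Sum>l<N. c l *\<^sub>R a l)"
    and h: "0 < h" "\<And>l. l < N \<Longrightarrow> \<bar>c l\<bar> * h < \<delta>"
    and x: "\<And>l. l < N \<Longrightarrow> x l \<in> approx_derivative F \<epsilon> \<delta> (u l) (a l)"
    and chain: "\<And>l. l < N \<Longrightarrow> norm (x (Suc l) - x l - (c l * h) *\<^sub>R u l) < 2 * \<epsilon> * \<bar>c l\<bar> * h"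
  shows False
proof -
  have L: "L \<ge> 0" by (rule lipschitz_on_nonneg[OF lip])
  have Flip: "norm (F y - F z) \<le> L * norm (y - z)" for y z using lipschitz_onD[OF lip, of y z] by (simp add: dist_norm)
  \<comment> \<open>The first estimate follows the positions, the second the values of
    \<open>F\<close>. In units of \<open>\<bar>c j\<bar> * h\<close>, a step adds
    \<open>\<epsilon>\<close> from the approximate derivative and \<open>2 * L * \<epsilon>\<close>
    from the misplacement of the next point.\<close>
  have step: "norm (x j - x 0 - h *\<^sub>R (\<Sum>l<j. c l *\<^sub>R u l)) \<le> 2 * \<epsilon> * h * (\<Sum>l<j. \<bar>c l\<bar>) \<and>
    norm (F (x j) - F (x 0) - h *\<^sub>R (\<Sum>l<j. c l *\<^sub>R a l)) \<le> (1 + 2 * L) * \<epsilon> * h * (\<Sum>l<j. \<bar>c l\<bar>)" if "j \<le> N" for j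
    using that
  proof (induction j)
    case (Suc j)
    then have j: "j < N" by simp
    have "x (Suc j) - x 0 - h *\<^sub>R (\<Sum>l<Suc j. c l *\<^sub>R u l)
       = (x (Suc j) - x j - (c j * h) *\<^sub>R u j) + (x j - x 0 - h *\<^sub>R (\<Sum>l<j. c l *\<^sub>R u l))" by (simp add: algebra_simps)
    also have "norm \<dots> \<le> 2 * \<epsilon> * \<bar>c j\<bar> * h + 2 * \<epsilon> * h * (\<Sum>l<j. \<bar>c l\<bar>)"
      using chain[OF j] Suc by (intro order_trans[OF norm_triangle_ineq] add_mono) auto
    finally have 1: "norm (x (Suc j) - x 0 - h *\<^sub>R (\<Sum>l<Suc j. c l *\<^sub>R u l)) \<le> 2 * \<epsilon> * h * (\<Sum>l<Suc j. \<bar>c l\<bar>)"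
      by (simp add: algebra_simps)
    let ?s = "c j * h"
    have "norm (F (x (Suc j)) - F (x j + ?s *\<^sub>R u j)) \<le> L * norm (x (Suc j) - (x j + ?s *\<^sub>R u j))" by (rule Flip)
    also have "\<dots> \<le> L * (2 * \<epsilon> * \<bar>c j\<bar> * h)" using chain[OF j] L by (intro mult_left_mono) (auto simp: algebra_simps)
    finally have a1: "norm (F (x (Suc j)) - F (x j + ?s *\<^sub>R u j)) \<le> L * (2 * \<epsilon> * \<bar>c j\<bar> * h)" .
    have "\<bar>?s\<bar> < \<delta>" using h(2)[OF j] h(1) by (simp add: abs_mult)
    then have a2: "norm (F (x j + ?s *\<^sub>R u j) - F (x j) - ?s *\<^sub>R a j) \<le> \<epsilon> * (\<bar>c j\<bar> * h)"
      using x[OF j, unfolded approx_derivative_def, THEN CollectD, rule_format, of ?s] h(1) by (simp add: abs_mult)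
    have "F (x (Suc j)) - F (x 0) - h *\<^sub>R (\<Sum>l<Suc j. c l *\<^sub>R a l) =
       (F (x (Suc j)) - F (x j + ?s *\<^sub>R u j)) + ((F (x j + ?s *\<^sub>R u j) - F (x j) - ?s *\<^sub>R a j) + (F (x j) - F (x 0) - h *\<^sub>R (\<Sum>l<j. c l *\<^sub>R a l)))"
      by (simp add: algebra_simps)
    also have "norm \<dots> \<le> L * (2 * \<epsilon> * \<bar>c j\<bar> * h) + (\<epsilon> * (\<bar>c j\<bar> * h) + (1 + 2 * L) * \<epsilon> * h * (\<Sum>l<j. \<bar>c l\<bar>))"
      using a1 a2 Suc by (intro order_trans[OF norm_triangle_ineq] add_mono) auto
    finally have 2: "norm (F (x (Suc j)) - F (x 0) - h *\<^sub>R (\<Sum>l<Suc j. c l *\<^sub>R a l)) \<le> (1 + 2 * L) * \<epsilon> * h * (\<Sum>l<Suc j. \<bar>c l\<bar>)"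
      by (simp add: algebra_simps)
    show ?case using 1 2 by blast
  qed simp
  let ?U = "\<Sum>l<N. c l *\<^sub>R u l" and ?A = "\<Sum>l<N. c l *\<^sub>R a l" and ?C = "\<Sum>l<N. \<bar>c l\<bar>"
  have s1: "norm (x N - x 0 - h *\<^sub>R ?U) \<le> 2 * \<epsilon> * h * ?C" and s2: "norm (F (x N) - F (x 0) - h *\<^sub>R ?A) \<le> (1 + 2 * L) * \<epsilon> * h * ?C"
    using step[of N] by auto
  have "norm (x N - x 0) \<le> norm (h *\<^sub>R ?U) + norm (x N - x 0 - h *\<^sub>R ?U)" by (rule norm_triangle_sub)
  then have "norm (x N - x 0) \<le> h * norm ?U + 2 * \<epsilon> * h * ?C" using s1 h(1) by simp
  \<comment> \<open>The Lipschitz bound between the endpoints contributes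
    \<open>2 * L * \<epsilon>\<close> once more, which turns \<open>1 + 2 * L\<close> into the
    \<open>1 + 4 * L\<close> of \<open>bad\<close>.\<close>
  then have f: "norm (F (x N) - F (x 0)) \<le> L * (h * norm ?U + 2 * \<epsilon> * h * ?C)"
    using Flip[of "x N" "x 0"] L by (meson mult_left_mono order_trans)
  have "norm (h *\<^sub>R ?A) \<le> norm (F (x N) - F (x 0)) + norm (h *\<^sub>R ?A - (F (x N) - F (x 0)))" by (rule norm_triangle_sub)
  then have "h * norm ?A \<le> L * (h * norm ?U + 2 * \<epsilon> * h * ?C) + (1 + 2 * L) * \<epsilon> * h * ?C"
    using s2 f h(1) norm_minus_commute[of "h *\<^sub>R ?A" "F (x N) - F (x 0)"] by simp
  also have "\<dots> = h * (L * norm ?U + (1 + 4 * L) * \<epsilon> * ?C)" by (simp add: algebra_simps)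
  finally show False using bad h(1) by simp
qed

text \<open>Where \<open>K\<close> is not porous, every small \<open>s\<close> has a time
  \<open>t + s'\<close> in \<open>K\<close> with \<open>s'\<close> close to \<open>s\<close>, and
  \<open>F\<close> at \<open>\<gamma> t + s *\<^sub>R v\<close> differs little from \<open>F\<close>
  at \<open>\<gamma> (t + s')\<close>. So the derivative along the fragment is one along a full line
  through the point: information about \<open>F\<close> and the point in which the fragment no
  longer occurs.\<close>

lemma AE_directional_derivative:
  fixes F :: "'a::real_normed_vector \<Rightarrow> 'b::real_normed_vector"
  assumes lip: "L-lipschitz_on UNIV F"
  shows "AE t in lborel. t \<in> K \<longrightarrow> (\<forall>v a. (\<gamma> has_vector_derivative v) (at t within K) \<longrightarrow>
     ((F \<circ> \<gamma>) has_vector_derivative a) (at t within K) \<longrightarrow>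
     (\<forall>e>0. \<exists>\<delta>>0. \<gamma> t \<in> approx_derivative F e \<delta> v a))"
  using AE_not_porous[of K]
proof (rule eventually_mono, intro impI allI)
  fix t v a and e :: real
  assume np: "t \<in> K \<longrightarrow> (\<forall>\<eta>>0. \<exists>\<delta>>0. \<forall>s. 0 < \<bar>s\<bar> \<and> \<bar>s\<bar> < \<delta> \<longrightarrow> (\<exists>s'. t + s' \<in> K \<and> \<bar>s' - s\<bar> < \<eta> * \<bar>s\<bar>))"
    and t: "t \<in> K" and v: "(\<gamma> has_vector_derivative v) (at t within K)"
    and a: "((F \<circ> \<gamma>) has_vector_derivative a) (at t within K)" and e: "0 < e"
  have L: "L \<ge> 0" by (rule lipschitz_on_nonneg[OF lip])
  have Flip: "norm (F y - F z) \<le> L * norm (y - z)" for y z using lipschitz_onD[OF lip, of y z] by (simp add: dist_norm)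
  define M where "M = L * norm v + norm a + 1"
  have M: "M > 0" using L by (simp add: M_def add_nonneg_pos)
  define \<eta> where "\<eta> = min 1 (e / (2 * M))"
  have \<eta>: "\<eta> > 0" "\<eta> \<le> 1" "\<eta> * (L * norm v + norm a) \<le> e / 2"
  proof -
    show "\<eta> > 0" "\<eta> \<le> 1" using e M by (auto simp: \<eta>_def)
    have "\<eta> * (L * norm v + norm a) \<le> e / (2 * M) * M"
      using e M L by (intro mult_mono) (auto simp: \<eta>_def M_def)
    then show "\<eta> * (L * norm v + norm a) \<le> e / 2" using M by simp
  qed
  \<comment> \<open>Half of \<open>e\<close> goes to the errors of the two derivatives;
    \<open>\<eta>\<close> keeps the shift from \<open>s\<close> to \<open>s'\<close> within the
    other half.\<close>
  define e1 where "e1 = e / (4 * (L + 1))"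
  have e1: "e1 > 0" "2 * (L + 1) * e1 = e / 2" using e L by (auto simp: e1_def field_simps add_nonneg_eq_0_iff)
  obtain \<delta>1 where \<delta>1: "\<delta>1 > 0" "\<And>s. 0 < \<bar>s\<bar> \<Longrightarrow> \<bar>s\<bar> < \<delta>1 \<Longrightarrow> \<exists>s'. t + s' \<in> K \<and> \<bar>s' - s\<bar> < \<eta> * \<bar>s\<bar>"
    using np t \<eta>(1) by blast
  obtain \<delta>2 where \<delta>2: "\<delta>2 > 0" "\<And>s. s \<in> K \<Longrightarrow> \<bar>s - t\<bar> < \<delta>2 \<Longrightarrow> norm (\<gamma> s - \<gamma> t - (s - t) *\<^sub>R v) \<le> e1 * \<bar>s - t\<bar>"
    using v[unfolded has_vector_derivative_within_alt, rule_format, OF e1(1)] by blast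
  obtain \<delta>3 where \<delta>3: "\<delta>3 > 0" "\<And>s. s \<in> K \<Longrightarrow> \<bar>s - t\<bar> < \<delta>3 \<Longrightarrow> norm (F (\<gamma> s) - F (\<gamma> t) - (s - t) *\<^sub>R a) \<le> e1 * \<bar>s - t\<bar>"
    using a[unfolded has_vector_derivative_within_alt o_def, rule_format, OF e1(1)] by blast
  show "\<exists>\<delta>>0. \<gamma> t \<in> approx_derivative F e \<delta> v a"
  proof (rule exI[of _ "min \<delta>1 (min \<delta>2 \<delta>3 / 2)"], intro conjI)
    show "0 < min \<delta>1 (min \<delta>2 \<delta>3 / 2)" using \<delta>1 \<delta>2 \<delta>3 by simp
    have "norm (F (\<gamma> t + s *\<^sub>R v) - F (\<gamma> t) - s *\<^sub>R a) \<le> e * \<bar>s\<bar>" if s: "\<bar>s\<bar> < min \<delta>1 (min \<delta>2 \<delta>3 / 2)" for s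
    proof (cases "s = 0")
      case False
      then obtain s' where s': "t + s' \<in> K" "\<bar>s' - s\<bar> < \<eta> * \<bar>s\<bar>" using \<delta>1(2)[of s] s by auto
      have "\<eta> * \<bar>s\<bar> \<le> 1 * \<bar>s\<bar>" using \<eta> by (intro mult_right_mono) auto
      then have s'2: "\<bar>s'\<bar> \<le> 2 * \<bar>s\<bar>" using s'(2) by linarith
      have e1s: "e1 * \<bar>s'\<bar> \<le> 2 * e1 * \<bar>s\<bar>" using s'2 e1(1) by simp
      have d: "norm (\<gamma> (t + s') - \<gamma> t - s' *\<^sub>R v) \<le> 2 * e1 * \<bar>s\<bar>" "norm (F (\<gamma> (t + s')) - F (\<gamma> t) - s' *\<^sub>R a) \<le> 2 * e1 * \<bar>s\<bar>"
        using \<delta>2(2)[OF s'(1)] \<delta>3(2)[OF s'(1)] s'2 s e1s by auto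
      have sv: "norm ((s - s') *\<^sub>R w) \<le> \<eta> * \<bar>s\<bar> * norm w" for w :: "'c::real_normed_vector"
        using s'(2) by (auto simp: abs_minus_commute intro!: mult_right_mono)
      have "norm (\<gamma> t + s *\<^sub>R v - \<gamma> (t + s')) \<le> 2 * e1 * \<bar>s\<bar> + \<eta> * \<bar>s\<bar> * norm v"
      proof -
        have "\<gamma> t + s *\<^sub>R v - \<gamma> (t + s') = (s - s') *\<^sub>R v - (\<gamma> (t + s') - \<gamma> t - s' *\<^sub>R v)" by (simp add: algebra_simps)
        also have "norm \<dots> \<le> norm ((s - s') *\<^sub>R v) + norm (\<gamma> (t + s') - \<gamma> t - s' *\<^sub>R v)" by (rule norm_triangle_ineq4)
        finally show ?thesis using d(1) sv[of v] by linarith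
      qed
      then have f: "norm (F (\<gamma> t + s *\<^sub>R v) - F (\<gamma> (t + s'))) \<le> L * (2 * e1 * \<bar>s\<bar> + \<eta> * \<bar>s\<bar> * norm v)"
        using Flip[of "\<gamma> t + s *\<^sub>R v" "\<gamma> (t + s')"] L by (meson mult_left_mono order_trans)
      have "F (\<gamma> t + s *\<^sub>R v) - F (\<gamma> t) - s *\<^sub>R a = (F (\<gamma> t + s *\<^sub>R v) - F (\<gamma> (t + s'))) +
          ((F (\<gamma> (t + s')) - F (\<gamma> t) - s' *\<^sub>R a) - (s - s') *\<^sub>R a)" by (simp add: algebra_simps)
      also have "norm \<dots> \<le> norm (F (\<gamma> t + s *\<^sub>R v) - F (\<gamma> (t + s'))) +
          (norm (F (\<gamma> (t + s')) - F (\<gamma> t) - s' *\<^sub>R a) + norm ((s - s') *\<^sub>R a))"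
        by (intro order_trans[OF norm_triangle_ineq] add_left_mono norm_triangle_ineq4)
      also have "\<dots> \<le> L * (2 * e1 * \<bar>s\<bar> + \<eta> * \<bar>s\<bar> * norm v) + (2 * e1 * \<bar>s\<bar> + \<eta> * \<bar>s\<bar> * norm a)"
        by (intro add_mono f d(2) sv)
      also have "\<dots> = (2 * (L + 1) * e1 + \<eta> * (L * norm v + norm a)) * \<bar>s\<bar>" by (simp add: algebra_simps)
      also have "\<dots> \<le> e * \<bar>s\<bar>" using e1(2) \<eta>(3) by (intro mult_right_mono) auto
      finally show ?thesis .
    qed simp
    then show "\<gamma> t \<in> approx_derivative F e (min \<delta>1 (min \<delta>2 \<delta>3 / 2)) v a" by (simp add: approx_derivative_def)
  qed
qed

lemma approx_derivative_mono: "\<delta>' \<le> \<delta> \<Longrightarrow> approx_derivative F \<epsilon> \<delta> u a \<subseteq> approx_derivative F \<epsilon> \<delta>' u a"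
  by (auto simp: approx_derivative_def)

text \<open>A third of \<open>e\<close> each goes to the change of direction, the given
  approximation and the change of value; \<open>L + 1\<close> avoids division by zero. This allows
  directions and values to be taken from countable dense sets.\<close>

lemma approx_derivative_perturb:
  fixes F :: "'a::real_normed_vector \<Rightarrow> 'b::real_normed_vector"
  assumes lip: "L-lipschitz_on UNIV F" and x: "x \<in> approx_derivative F (e / 3) \<delta> v a"
    and "norm (v - u) \<le> e / (3 * (L + 1))" "norm (a - b) \<le> e / 3"
  shows "x \<in> approx_derivative F e \<delta> u b"
  unfolding approx_derivative_def
proof safe
  fix s :: real assume s: "\<bar>s\<bar> < \<delta>"
  have L: "L \<ge> 0" by (rule lipschitz_on_nonneg[OF lip])
  have "norm (F (x + s *\<^sub>R u) - F (x + s *\<^sub>R v)) \<le> L * norm ((x + s *\<^sub>R u) - (x + s *\<^sub>R v))"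
    using lipschitz_onD[OF lip, of "x + s *\<^sub>R u" "x + s *\<^sub>R v"] by (simp add: dist_norm)
  also have "\<dots> = \<bar>s\<bar> * (L * norm (v - u))"
    by (simp add: norm_minus_commute flip: scaleR_diff_right)
  also have "\<dots> \<le> \<bar>s\<bar> * ((L + 1) * (e / (3 * (L + 1))))"
    using assms(3) L by (intro mult_left_mono mult_mono) auto
  also have "\<dots> = e / 3 * \<bar>s\<bar>" using L by (simp add: field_simps add_nonneg_eq_0_iff)
  finally have 1: "norm (F (x + s *\<^sub>R u) - F (x + s *\<^sub>R v)) \<le> e / 3 * \<bar>s\<bar>" .
  have 2: "norm (F (x + s *\<^sub>R v) - F x - s *\<^sub>R a) \<le> e / 3 * \<bar>s\<bar>" using x s by (simp add: approx_derivative_def)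
  have 3: "norm (s *\<^sub>R (a - b)) \<le> e / 3 * \<bar>s\<bar>"
    using mult_right_mono[OF assms(4), of "\<bar>s\<bar>"] unfolding norm_scaleR by (simp add: mult.commute)
  have "F (x + s *\<^sub>R u) - F x - s *\<^sub>R b = (F (x + s *\<^sub>R u) - F (x + s *\<^sub>R v)) + ((F (x + s *\<^sub>R v) - F x - s *\<^sub>R a) + s *\<^sub>R (a - b))"
    by (simp add: algebra_simps)
  also have "norm \<dots> \<le> e / 3 * \<bar>s\<bar> + (e / 3 * \<bar>s\<bar> + e / 3 * \<bar>s\<bar>)"
    by (intro order_trans[OF norm_triangle_ineq] add_mono 1 2 3)
  finally show "norm (F (x + s *\<^sub>R u) - F x - s *\<^sub>R b) \<le> e * \<bar>s\<bar>" by simp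
qed

definition velocity_null :: "('a::real_normed_vector \<Rightarrow> 'b::real_normed_vector) \<Rightarrow> 'a set \<Rightarrow> ('a \<times> 'b) set \<Rightarrow> bool" where
  "velocity_null F A U \<longleftrightarrow> (\<forall>K \<gamma>. curve_fragment K \<gamma> \<longrightarrow> (AE t in lborel. t \<in> K \<and> \<gamma> t \<in> A \<longrightarrow>
     (\<forall>v a. (\<gamma> has_vector_derivative v) (at t within K) \<longrightarrow>
        ((F \<circ> \<gamma>) has_vector_derivative a) (at t within K) \<longrightarrow> (v, a) \<notin> U)))"

lemma velocity_null_direction:
  assumes "direction_null A u \<epsilon>"
  shows "velocity_null F A (ball u \<epsilon> \<times> UNIV)"
  unfolding velocity_null_def
proof (intro allI impI)
  fix K and \<gamma> :: "real \<Rightarrow> 'a" assume "curve_fragment K \<gamma>"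
  then have "AE t in lborel. t \<in> K \<and> \<gamma> t \<in> A \<longrightarrow> (\<forall>v. (\<gamma> has_vector_derivative v) (at t within K) \<longrightarrow> \<epsilon> \<le> norm (v - u))"
    using assms by (auto simp: direction_null_def)
  then show "AE t in lborel. t \<in> K \<and> \<gamma> t \<in> A \<longrightarrow> (\<forall>v a. (\<gamma> has_vector_derivative v) (at t within K) \<longrightarrow>
        ((F \<circ> \<gamma>) has_vector_derivative a) (at t within K) \<longrightarrow> (v, a) \<notin> ball u \<epsilon> \<times> UNIV)"
    by (rule eventually_mono) (force simp: dist_norm norm_minus_commute)
qed

text \<open>Velocities in this product of balls are close enough to \<open>(u, b)\<close> for the
  directional derivative along the curve to be an approximate derivative \<open>b\<close> in
  direction \<open>u\<close>, at some scale \<open>1 / (k + 1)\<close>.\<close>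

lemma velocity_null_approx_derivative:
  fixes F :: "'a::real_normed_vector \<Rightarrow> 'b::real_normed_vector"
  assumes lip: "L-lipschitz_on UNIV F" and "\<epsilon> > 0"
  shows "velocity_null F (- (\<Union>k. approx_derivative F \<epsilon> (inverse (real (Suc k))) u b))
     (ball u (\<epsilon> / (3 * (L + 1))) \<times> ball b (\<epsilon> / 3))"
  unfolding velocity_null_def
proof (intro allI impI)
  fix K and \<gamma> :: "real \<Rightarrow> 'a" assume "curve_fragment K \<gamma>"
  show "AE t in lborel. t \<in> K \<and> \<gamma> t \<in> - (\<Union>k. approx_derivative F \<epsilon> (inverse (real (Suc k))) u b) \<longrightarrow>
     (\<forall>v a. (\<gamma> has_vector_derivative v) (at t within K) \<longrightarrow>
        ((F \<circ> \<gamma>) has_vector_derivative a) (at t within K) \<longrightarrow> (v, a) \<notin> ball u (\<epsilon> / (3 * (L + 1))) \<times> ball b (\<epsilon> / 3))"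
    using AE_directional_derivative[OF lip, of K \<gamma>]
  proof (rule eventually_mono, intro impI allI notI, elim conjE)
    fix t v a
    assume dd: "t \<in> K \<longrightarrow> (\<forall>v a. (\<gamma> has_vector_derivative v) (at t within K) \<longrightarrow>
     ((F \<circ> \<gamma>) has_vector_derivative a) (at t within K) \<longrightarrow> (\<forall>e>0. \<exists>\<delta>>0. \<gamma> t \<in> approx_derivative F e \<delta> v a))"
      and t: "t \<in> K" "\<gamma> t \<in> - (\<Union>k. approx_derivative F \<epsilon> (inverse (real (Suc k))) u b)"
      and va: "(\<gamma> has_vector_derivative v) (at t within K)" "((F \<circ> \<gamma>) has_vector_derivative a) (at t within K)"
      and U: "(v, a) \<in> ball u (\<epsilon> / (3 * (L + 1))) \<times> ball b (\<epsilon> / 3)"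
    have "\<epsilon> / 3 > 0" using assms(2) by simp
    then obtain \<delta> where \<delta>: "\<delta> > 0" "\<gamma> t \<in> approx_derivative F (\<epsilon> / 3) \<delta> v a" using dd t(1) va by blast
    have "\<gamma> t \<in> approx_derivative F \<epsilon> \<delta> u b"
      using U by (intro approx_derivative_perturb[OF lip \<delta>(2)]) (auto simp: dist_norm norm_minus_commute intro: less_imp_le)
    moreover obtain k where "inverse (real (Suc k)) < \<delta>" using reals_Archimedean \<delta>(1) by blast
    ultimately have "\<gamma> t \<in> approx_derivative F \<epsilon> (inverse (real (Suc k))) u b"
      using approx_derivative_mono[of "inverse (real (Suc k))" \<delta> F \<epsilon> u b] by auto
    then show False using t(2) by blast
  qed
qed

text \<open>On velocities \<open>q\<close> vanishes, and within the ball it changes by at most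
  \<open>M * \<rho>\<close>.\<close>

lemma velocity_null_kernel:
  fixes q :: "'a::real_normed_vector \<Rightarrow> 'a \<Rightarrow> real"
  assumes q2: "\<And>x u v. x \<in> S \<Longrightarrow> \<bar>q x u - q x v\<bar> \<le> M * norm (u - v)" and "M \<ge> 0"
    and q4: "\<And>K \<gamma>. curve_fragment K \<gamma> \<Longrightarrow> AE t in lborel. t \<in> K \<and> \<gamma> t \<in> S \<longrightarrow>
       (\<forall>v. (\<gamma> has_vector_derivative v) (at t within K) \<longrightarrow> q (\<gamma> t) v = 0)"
  shows "velocity_null F {x \<in> S. q x u > M * \<rho>} (ball u \<rho> \<times> UNIV)"
  unfolding velocity_null_def
proof (intro allI impI)
  fix K and \<gamma> :: "real \<Rightarrow> 'a" assume c: "curve_fragment K \<gamma>"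
  show "AE t in lborel. t \<in> K \<and> \<gamma> t \<in> {x \<in> S. q x u > M * \<rho>} \<longrightarrow>
     (\<forall>v a. (\<gamma> has_vector_derivative v) (at t within K) \<longrightarrow>
        ((F \<circ> \<gamma>) has_vector_derivative a) (at t within K) \<longrightarrow> (v, a) \<notin> ball u \<rho> \<times> UNIV)"
    using q4[OF c]
  proof (rule eventually_mono, intro impI allI notI, elim conjE)
    fix t v a
    assume q: "t \<in> K \<and> \<gamma> t \<in> S \<longrightarrow> (\<forall>v. (\<gamma> has_vector_derivative v) (at t within K) \<longrightarrow> q (\<gamma> t) v = 0)"
      and t: "t \<in> K" "\<gamma> t \<in> {x \<in> S. q x u > M * \<rho>}"
      and v: "(\<gamma> has_vector_derivative v) (at t within K)" and U: "(v, a) \<in> ball u \<rho> \<times> UNIV"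
    have "q (\<gamma> t) v = 0" using q t v by blast
    then have "q (\<gamma> t) u \<le> M * norm (u - v)" using q2[of "\<gamma> t" u v] t(2) by auto
    also have "\<dots> \<le> M * \<rho>" using U assms(2) by (intro mult_left_mono) (auto simp: dist_norm)
    finally show False using t(2) by auto
  qed
qed

text \<open>A pair \<open>(v, a)\<close> in the residual of \<open>P\<close> satisfies
  \<open>q x v = 0\<close> by \<open>P1\<close>; by \<open>P2\<close>, \<open>F\<close> has
  approximate derivatives close to \<open>a\<close> in directions close to \<open>v\<close>; by
  \<open>P3\<close>, \<open>v\<close> is not a direction discarded at a violated relation. For
  \<open>d + 1\<close> independent values \<open>a\<close> the directions obey a relation that the
  values violate, and a rational version of it discards one of these directions, a
  contradiction.\<close>

lemma admits_weak_tangent_field_of_kernel: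
  fixes S :: "'a::real_normed_vector set" and q :: "'a \<Rightarrow> 'a \<Rightarrow> real"
  assumes B: "finite B" "span B = (UNIV :: 'a set)" and S: "S \<in> sets borel" and M: "M \<ge> 0"
    and q0: "\<And>x v. x \<in> S \<Longrightarrow> 0 \<le> q x v"
    and q1: "\<And>v c. {x \<in> S. q x v > c} \<in> sets borel"
    and q2: "\<And>x u v. x \<in> S \<Longrightarrow> \<bar>q x u - q x v\<bar> \<le> M * norm (u - v)"
    and q3: "\<And>x v. x \<in> S \<Longrightarrow> (\<And>i. i \<le> d \<Longrightarrow> q x (v i) = 0) \<Longrightarrow> \<not> indep_upto (Suc d) v"
    and q4: "\<And>K \<gamma>. curve_fragment K \<gamma> \<Longrightarrow> AE t in lborel. t \<in> K \<and> \<gamma> t \<in> S \<longrightarrow>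
       (\<forall>v. (\<gamma> has_vector_derivative v) (at t within K) \<longrightarrow> q (\<gamma> t) v = 0)"
  shows "admits_weak_tangent_field d S"
  unfolding admits_weak_tangent_field_def
proof (intro allI impI, elim conjE exE)
  fix n and F :: "'a \<Rightarrow> nat \<Rightarrow>\<^sub>0 real" and L
  assume dn: "d \<le> n" and FRn: "range F \<subseteq> Rn n" and lip: "L-lipschitz_on UNIV F"
  have L: "L \<ge> 0" by (rule lipschitz_on_nonneg[OF lip])
  obtain DX where "countable DX" "DX \<subseteq> span B" "\<And>x \<epsilon>. x \<in> span B \<Longrightarrow> 0 < \<epsilon> \<Longrightarrow> \<exists>y\<in>DX. dist x y < \<epsilon>"
    by (rule countable_dense_span[OF B(1)]) blast
  then have DX: "countable DX" "\<And>x \<epsilon>. 0 < \<epsilon> \<Longrightarrow> \<exists>y\<in>DX. dist x y < \<epsilon>" using B(2) by auto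
  obtain DR where "countable DR" "DR \<subseteq> span (Rn_basis ` {..<n})"
    "\<And>x \<epsilon>. x \<in> span (Rn_basis ` {..<n}) \<Longrightarrow> 0 < \<epsilon> \<Longrightarrow> \<exists>y\<in>DR. dist x y < \<epsilon>"
    by (rule countable_dense_span[OF finite_imageI[OF finite_lessThan]]) blast
  then have DR: "countable DR" "\<And>x \<epsilon>. x \<in> Rn n \<Longrightarrow> 0 < \<epsilon> \<Longrightarrow> \<exists>y\<in>DR. dist x y < \<epsilon>"
    by (auto simp: Rn_eq_span)
  define e where "e m = inverse (real (Suc m))" for m
  have e0: "e m > 0" for m by (simp add: e_def)
  have elim: "e \<longlonglongrightarrow> 0" unfolding e_def by (rule LIMSEQ_inverse_real_of_nat)
  have earch: "\<exists>m. e m < \<theta>" if "\<theta> > 0" for \<theta> unfolding e_def by (rule reals_Archimedean[OF that])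
  have emono: "e k \<le> e m" if "m \<le> k" for k m unfolding e_def using that by (intro le_imp_inverse_le) auto
  let ?I = "{..<Suc d}"
  define A1 where "A1 u m = {x \<in> S. q x u > M * e m}" for u m
  define P1 where "P1 = (\<lambda>(u, m). (A1 u m, ball u (e m) \<times> (UNIV :: (nat \<Rightarrow>\<^sub>0 real) set))) ` (DX \<times> UNIV)"
  define A2 where "A2 u b m = - (\<Union>k. approx_derivative F (e m) (e k) u b)" for u b m
  define P2 where "P2 = (\<lambda>(u, b, m). (A2 u b m, ball u (e m / (3 * (L + 1))) \<times> ball b (e m / 3))) ` (DX \<times> DR \<times> UNIV)"
  define A3 where "A3 u b m k = (\<Inter>l\<in>?I. approx_derivative F (e m) (e k) (u l) (b l))" for u b m k
  \<comment> \<open>Rational data for a violated relation. The inequality is the one that rules out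
    chains, and the coefficients are nonzero because each is the factor of a step.\<close>
  define I3 where "I3 = {(c, u, b, m, k). c \<in> ?I \<rightarrow>\<^sub>E \<rat> - {0::real} \<and> u \<in> ?I \<rightarrow>\<^sub>E DX \<and> b \<in> ?I \<rightarrow>\<^sub>E DR \<and>
     L * norm (\<Sum>l\<in>?I. c l *\<^sub>R u l) + (1 + 4 * L) * e m * (\<Sum>l\<in>?I. \<bar>c l\<bar>) < norm (\<Sum>l\<in>?I. c l *\<^sub>R b l) \<and> (k::nat) \<in> UNIV \<and> (m::nat) \<in> UNIV}"
  have cl_ad: "closed (approx_derivative F \<epsilon> \<delta> u b)" for \<epsilon> \<delta> u b by (rule closed_approx_derivative[OF lip])
  have "\<exists>Q. countable Q \<and> A3 u b m k \<subseteq> (\<Union>p\<in>Q. fst p) \<and>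
      (\<forall>(A', l)\<in>Q. A' \<in> sets borel \<and> l < Suc d \<and> direction_null A' (u l) (e m))"
    if i: "(c, u, b, m, k) \<in> I3" for c u b m k
  \<comment> \<open>This bound on the scales keeps every step \<open>\<bar>c l\<bar> * e m'\<close>
    below \<open>e k\<close>, the range of the approximate derivatives in \<open>A3\<close>.\<close>
  proof (rule direction_null_decomposition[folded e_def, where \<delta> = "e k / ((\<Sum>l\<in>?I. \<bar>c l\<bar>) + 1)"])
    have C: "(\<Sum>l\<in>?I. \<bar>c l\<bar>) + 1 > 0" by (intro add_nonneg_pos sum_nonneg) auto
    show "c l \<noteq> 0" if "l < Suc d" for l using i that by (auto simp: I3_def PiE_def Pi_def)
    show "A3 u b m k \<in> sets borel" unfolding A3_def by (intro sets.finite_INT borel_closed cl_ad) auto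
    show "e k / ((\<Sum>l\<in>?I. \<bar>c l\<bar>) + 1) > 0" using C e0 by (rule divide_pos_pos[rotated])
    fix m' x
    assume m': "e m' < e k / ((\<Sum>l\<in>?I. \<bar>c l\<bar>) + 1)" and x: "\<And>l. l \<le> Suc d \<Longrightarrow> x l \<in> A3 u b m k"
      and ch: "\<And>l. l < Suc d \<Longrightarrow> norm (x (Suc l) - x l - (c l * e m') *\<^sub>R u l) < 2 * e m * \<bar>c l\<bar> * e m'"
    show False
    proof (rule approx_derivative_no_chain[OF lip e0[of m], where N = "Suc d" and h = "e m'" and \<delta> = "e k" and c = c and u = u and a = b and x = x])
      show "L * norm (\<Sum>l\<in>?I. c l *\<^sub>R u l) + (1 + 4 * L) * e m * (\<Sum>l\<in>?I. \<bar>c l\<bar>) < norm (\<Sum>l\<in>?I. c l *\<^sub>R b l)"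
        using i unfolding I3_def by blast
      show "\<bar>c l\<bar> * e m' < e k" if "l < Suc d" for l
      proof -
        have "\<bar>c l\<bar> \<le> (\<Sum>l\<in>?I. \<bar>c l\<bar>)" using that by (intro member_le_sum) auto
        then have "\<bar>c l\<bar> * e m' \<le> ((\<Sum>l\<in>?I. \<bar>c l\<bar>) + 1) * e m'" using e0[of m'] by (intro mult_right_mono) auto
        also have "\<dots> < e k" using m' C by (simp only: pos_less_divide_eq mult.commute)
        finally show ?thesis .
      qed
      show "x l \<in> approx_derivative F (e m) (e k) (u l) (b l)" if "l < Suc d" for l
        using x[of l] that by (auto simp: A3_def)
    qed (use e0 ch in auto)
  qed (use e0 in auto)
  then have "\<forall>i\<in>I3. \<exists>Q. countable Q \<and> (case i of (c, u, b, m, k) \<Rightarrow> A3 u b m k \<subseteq> (\<Union>p\<in>Q. fst p) \<and>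
      (\<forall>(A', l)\<in>Q. A' \<in> sets borel \<and> l < Suc d \<and> direction_null A' (u l) (e m)))"
    by fastforce
  from bchoice[OF this] obtain Q where Q: "\<forall>i\<in>I3. countable (Q i) \<and> (case i of (c, u, b, m, k) \<Rightarrow> A3 u b m k \<subseteq> (\<Union>p\<in>Q i. fst p) \<and>
      (\<forall>(A', l)\<in>Q i. A' \<in> sets borel \<and> l < Suc d \<and> direction_null A' (u l) (e m)))" by blast
  define P3 where "P3 = (\<Union>i\<in>I3. case i of (c, u, b, m, k) \<Rightarrow> (\<lambda>(A', l). (A', ball (u l) (e m) \<times> (UNIV :: (nat \<Rightarrow>\<^sub>0 real) set))) ` Q i)"
  define P where "P = P1 \<union> P2 \<union> P3"
  have "countable I3"
  proof (rule countable_subset)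
    show "I3 \<subseteq> (?I \<rightarrow>\<^sub>E \<rat> - {0::real}) \<times> (?I \<rightarrow>\<^sub>E DX) \<times> (?I \<rightarrow>\<^sub>E DR) \<times> UNIV \<times> UNIV" by (auto simp: I3_def)
    show "countable ((?I \<rightarrow>\<^sub>E \<rat> - {0::real}) \<times> (?I \<rightarrow>\<^sub>E DX) \<times> (?I \<rightarrow>\<^sub>E DR) \<times> (UNIV::nat set) \<times> (UNIV::nat set))"
      using DX(1) DR(1) countable_rat by (intro countable_SIGMA countable_PiE) auto
  qed
  then have "countable P3" unfolding P3_def using Q by (intro countable_UN) (auto split: prod.splits)
  moreover have "countable P1" "countable P2" unfolding P1_def P2_def using DX(1) DR(1) by auto
  ultimately have cP: "countable P" by (simp add: P_def)
  have Pprops: "A \<in> sets borel \<and> open U \<and> velocity_null F A U" if "(A, U) \<in> P" for A U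
    using that unfolding P_def
  proof (elim UnE)
    assume "(A, U) \<in> P1"
    then obtain u m where "A = A1 u m" "U = ball u (e m) \<times> UNIV" by (auto simp: P1_def)
    then show ?thesis unfolding A1_def using q1 velocity_null_kernel[OF q2 M q4] by (auto intro!: open_Times)
  next
    assume "(A, U) \<in> P2"
    then obtain u b m where AU: "A = A2 u b m" "U = ball u (e m / (3 * (L + 1))) \<times> ball b (e m / 3)" by (auto simp: P2_def)
    have "A \<in> sets borel"
      unfolding AU A2_def by (intro borel_comp sets.countable_UN image_subsetI borel_closed cl_ad)
    moreover have "velocity_null F A U"
      unfolding AU A2_def by (rule velocity_null_approx_derivative[OF lip e0, folded e_def])
    ultimately show ?thesis unfolding AU(2) by (auto intro!: open_Times)
  next
    assume "(A, U) \<in> P3"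
    then obtain c u b m k l where i: "(c, u, b, m, k) \<in> I3" "(A, l) \<in> Q (c, u, b, m, k)" "U = ball (u l) (e m) \<times> UNIV"
      by (auto simp: P3_def)
    then have "A \<in> sets borel" "direction_null A (u l) (e m)" using Q by fastforce+
    then show ?thesis using i(3) velocity_null_direction by (auto intro!: open_Times)
  qed
  have PA: "A \<in> sets borel" and PU: "open U" if "(A, U) \<in> P" for A U using Pprops[OF that] by auto
  have dim: "\<not> indep_upto (Suc d) (\<lambda>i. snd (w i))"
    if x: "x \<in> S" and w: "\<And>i. i \<le> d \<Longrightarrow> w i \<in> residual P x" and wR: "\<And>i. i \<le> d \<Longrightarrow> snd (w i) \<in> Rn n" for x w
  proof
    assume ind: "indep_upto (Suc d) (\<lambda>i. snd (w i))"
    have res: "z \<notin> U" if "(A, U) \<in> P" "x \<in> A" "z \<in> residual P x" for A U z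
      using that by (auto simp: residual_def)
    have ker: "q x (fst (w i)) = 0" if i: "i \<le> d" for i
    proof -
      have "q x (fst (w i)) \<le> 0 + \<theta>" if "\<theta> > 0" for \<theta>
      proof -
        have "\<theta> / (2 * M + 1) > 0" using \<open>\<theta> > 0\<close> M by simp
        then obtain m where m: "e m < \<theta> / (2 * M + 1)" using earch by blast
        obtain u where u: "u \<in> DX" "dist (fst (w i)) u < e m" using DX(2) e0 by blast
        have inP: "(A1 u m, ball u (e m) \<times> UNIV) \<in> P" using u(1) by (auto simp: P_def P1_def)
        have inU: "w i \<in> ball u (e m) \<times> UNIV" using u(2) by (cases "w i") (auto simp: dist_commute)
        have "x \<notin> A1 u m" by (rule notI) (rule notE[OF res[OF inP _ w[OF i]] inU])
        then have "q x u \<le> M * e m" using x by (auto simp: A1_def)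
        moreover have "q x (fst (w i)) - q x u \<le> M * norm (fst (w i) - u)" using q2[OF x, of "fst (w i)" u] by simp
        moreover have "M * norm (fst (w i) - u) \<le> M * e m" using u(2) M by (intro mult_left_mono) (auto simp: dist_norm)
        ultimately have "q x (fst (w i)) \<le> (2 * M) * e m" by simp
        also have "\<dots> \<le> (2 * M + 1) * e m" using e0[of m] by (intro mult_right_mono) auto
        also have "\<dots> \<le> \<theta>" using m M by (simp add: pos_less_divide_eq mult.commute)
        finally show ?thesis by simp
      qed
      then have "q x (fst (w i)) \<le> 0" by (rule field_le_epsilon)
      then show ?thesis using q0[OF x, of "fst (w i)"] by simp
    qed
    have "\<not> indep_upto (Suc d) (\<lambda>i. fst (w i))" using q3[OF x, of "\<lambda>i. fst (w i)"] ker by blast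
    then obtain c i0 where c: "(\<Sum>i\<in>?I. c i *\<^sub>R fst (w i)) = 0" "i0 < Suc d" "c i0 \<noteq> (0::real)"
      by (auto simp: indep_upto_def)
    then have pos: "norm (\<Sum>i\<in>?I. c i *\<^sub>R snd (w i)) > 0" using indep_uptoD[OF ind, of c i0] by auto
    \<comment> \<open>The rationals are nonzero even where \<open>c i = 0\<close>, as
      \<open>I3\<close> demands; the radii are those of the balls in \<open>P2\<close>.\<close>
    have ex: "\<exists>r u b. r \<in> \<rat> - {0} \<and> \<bar>r - c i\<bar> < e m \<and> u \<in> DX \<and> dist (fst (w i)) u < e m / (3 * (L + 1)) \<and>
       (i \<le> d \<longrightarrow> b \<in> DR \<and> dist (snd (w i)) b < e m / 3)" for i m
    proof -
      obtain r where r: "r \<in> \<rat>" "\<bar>r - c i\<bar> < e m" "r \<noteq> 0"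
      proof (cases "c i \<ge> 0")
        case True
        then show ?thesis using Rats_dense_in_real[of "c i" "c i + e m"] e0[of m] that by force
      next
        case False
        then show ?thesis using Rats_dense_in_real[of "c i - e m" "c i"] e0[of m] that by force
      qed
      have "e m / (3 * (L + 1)) > 0" "e m / 3 > 0" using e0[of m] L by (auto intro!: divide_pos_pos)
      then show ?thesis using r DX(2)[of "e m / (3 * (L + 1))" "fst (w i)"] DR(2)[OF wR, of i "e m / 3"] by blast
    qed
    then obtain r u b where rub: "\<And>i m. r i m \<in> \<rat> - {0}" "\<And>i m. \<bar>r i m - c i\<bar> < e m"
      "\<And>i m. u i m \<in> DX" "\<And>i m. dist (fst (w i)) (u i m) < e m / (3 * (L + 1))"
      "\<And>i m. i \<le> d \<Longrightarrow> b i m \<in> DR" "\<And>i m. i \<le> d \<Longrightarrow> dist (snd (w i)) (b i m) < e m / 3"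
      by metis
      have rl: "(\<lambda>m. r i m) \<longlonglongrightarrow> c i" for i
      by (rule metric_tendsto_imp_tendsto[OF elim]) (auto simp: dist_real_def intro!: always_eventually less_imp_le order_less_le_trans[OF rub(2) abs_ge_self])
    have ul: "(\<lambda>m. u i m) \<longlonglongrightarrow> fst (w i)" for i
    proof (rule metric_tendsto_imp_tendsto[OF elim], intro always_eventually allI)
      fix m
      have "e m / (3 * (L + 1)) \<le> e m / 1" using L e0[of m] by (intro divide_left_mono) auto
      then have "dist (fst (w i)) (u i m) \<le> e m" using rub(4)[of i m] by linarith
      then show "dist (u i m) (fst (w i)) \<le> dist (e m) 0" using e0[of m] by (simp add: dist_commute)
    qed
    have bl: "(\<lambda>m. b i m) \<longlonglongrightarrow> snd (w i)" if "i \<in> ?I" for i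
    proof (rule metric_tendsto_imp_tendsto[OF elim], intro always_eventually allI)
      fix m
      show "dist (b i m) (snd (w i)) \<le> dist (e m) 0"
        using rub(6)[of i m] that e0[of m] by (simp add: dist_commute less_Suc_eq_le)
    qed
    \<comment> \<open>In the limit the relation among the directions holds exactly while the values
      violate it, so the strict inequality of \<open>I3\<close> holds for some
      \<open>m\<close>.\<close>
    have "(\<lambda>m. norm (\<Sum>i\<in>?I. r i m *\<^sub>R b i m) - (L * norm (\<Sum>i\<in>?I. r i m *\<^sub>R u i m) + (1 + 4 * L) * e m * (\<Sum>i\<in>?I. \<bar>r i m\<bar>)))
      \<longlonglongrightarrow> norm (\<Sum>i\<in>?I. c i *\<^sub>R snd (w i)) - (L * norm (\<Sum>i\<in>?I. c i *\<^sub>R fst (w i)) + (1 + 4 * L) * 0 * (\<Sum>i\<in>?I. \<bar>c i\<bar>))"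
      by (intro tendsto_intros rl ul bl elim)
    then have "\<forall>\<^sub>F m in sequentially. 0 < norm (\<Sum>i\<in>?I. r i m *\<^sub>R b i m) - (L * norm (\<Sum>i\<in>?I. r i m *\<^sub>R u i m) + (1 + 4 * L) * e m * (\<Sum>i\<in>?I. \<bar>r i m\<bar>))"
      by (rule order_tendstoD(1)) (use pos c(1) in simp)
    then obtain m where m: "0 < norm (\<Sum>i\<in>?I. r i m *\<^sub>R b i m) - (L * norm (\<Sum>i\<in>?I. r i m *\<^sub>R u i m) + (1 + 4 * L) * e m * (\<Sum>i\<in>?I. \<bar>r i m\<bar>))"
      using eventually_happens' sequentially_bot by blast
    have "\<exists>k. x \<in> approx_derivative F (e m) (e k) (u i m) (b i m)" if i: "i \<le> d" for i
    proof -
      have inP: "(A2 (u i m) (b i m) m, ball (u i m) (e m / (3 * (L + 1))) \<times> ball (b i m) (e m / 3)) \<in> P"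
        unfolding P_def P2_def using rub(3)[of i m] rub(5)[OF i, of m]
        by (intro UnI1 UnI2 image_eqI[of _ _ "(u i m, b i m, m)"]) auto
      have inU: "w i \<in> ball (u i m) (e m / (3 * (L + 1))) \<times> ball (b i m) (e m / 3)"
        using rub(4)[of i m] rub(6)[OF i, of m] by (cases "w i") (auto simp: dist_commute)
      have "x \<notin> A2 (u i m) (b i m) m" by (rule notI) (rule notE[OF res[OF inP _ w[OF i]] inU])
      then show ?thesis by (auto simp: A2_def)
    qed
    then obtain kk where kk: "\<And>i. i \<le> d \<Longrightarrow> x \<in> approx_derivative F (e m) (e (kk i)) (u i m) (b i m)" by metis
    \<comment> \<open>The smallest of finitely many scales serves all directions.\<close>
    define k where "k = Max (kk ` {..d})"
    have kmax: "x \<in> approx_derivative F (e m) (e k) (u i m) (b i m)" if i: "i \<le> d" for i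
    proof -
      have "kk i \<le> k" unfolding k_def using i by (intro Max_ge) auto
      then have "e k \<le> e (kk i)" by (rule emono)
      then show ?thesis using approx_derivative_mono kk[OF i] by blast
    qed
    let ?r = "restrict (\<lambda>i. r i m) ?I" and ?u = "restrict (\<lambda>i. u i m) ?I" and ?b = "restrict (\<lambda>i. b i m) ?I"
    have I3: "(?r, ?u, ?b, m, k) \<in> I3"
      using m rub(1,3,5) unfolding I3_def by (auto simp: less_Suc_eq_le cong: sum.cong_simp)
    have "x \<in> A3 ?u ?b m k" using kmax by (auto simp: A3_def)
    moreover have QQ: "A3 ?u ?b m k \<subseteq> (\<Union>p\<in>Q (?r, ?u, ?b, m, k). fst p)"
      "\<forall>(A', l)\<in>Q (?r, ?u, ?b, m, k). A' \<in> sets borel \<and> l < Suc d \<and> direction_null A' (?u l) (e m)"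
      using bspec[OF Q I3] by simp_all
    ultimately obtain p where p: "p \<in> Q (?r, ?u, ?b, m, k)" "x \<in> fst p" by blast
    obtain A' l where Al: "p = (A', l)" by fastforce
    have l: "l < Suc d" using QQ(2) p(1) Al by auto
    have inP: "(A', ball (?u l) (e m) \<times> UNIV) \<in> P"
      unfolding P_def P3_def using p(1) Al
      by (intro UnI2 UN_I[OF I3]) (force intro: image_eqI[of _ _ "(A', l)"])
    have "e m / (3 * (L + 1)) \<le> e m / 1" using L e0[of m] by (intro divide_left_mono) auto
    then have "dist (fst (w l)) (u l m) < e m" using rub(4)[of l m] by linarith
    then have inU: "w l \<in> ball (?u l) (e m) \<times> UNIV"
      using l by (cases "w l") (auto simp: dist_commute)
    show False using res[OF inP _ w[of l]] inU p(2) Al l by auto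
  qed
  have cpt: "compact (cball (0::'a) R)" for R using compact_span_Int_cball[OF B(1), of R] B(2) by simp
  have "\<exists>\<tau>. \<tau> \<in> measurable (restrict_space borel S) (gr_borel n d) \<and>
      (\<forall>x v a. x \<in> S \<longrightarrow> (v, a) \<in> residual P x \<longrightarrow> a \<in> Rn n \<longrightarrow> a \<in> \<tau> x)"
    by (rule residual_subspace_selection[OF S cP PA PU cpt dn dim]) blast+
  then obtain \<tau> where \<tau>: "\<tau> \<in> measurable (restrict_space borel S) (gr_borel n d)"
    "\<And>x v a. x \<in> S \<Longrightarrow> (v, a) \<in> residual P x \<Longrightarrow> a \<in> Rn n \<Longrightarrow> a \<in> \<tau> x" by blast
  have "weak_tangent_field n d S F \<tau>"
    unfolding weak_tangent_field_def
  proof (intro conjI \<tau>(1) allI impI)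
    fix K and \<gamma> :: "real \<Rightarrow> 'a" assume cf: "curve_fragment K \<gamma>"
    then obtain L' where lip\<gamma>: "L'-lipschitz_on K \<gamma>" by (auto simp: curve_fragment_def)
    have "AE t in lborel. t \<in> K \<longrightarrow> (\<exists>v\<in>span B. (\<gamma> has_vector_derivative v) (at t within K))"
      using B by (intro Lipschitz_curve_differentiable_AE[OF lip\<gamma>]) auto
    moreover have "AE t in lborel. t \<in> K \<longrightarrow> (\<exists>a\<in>span (Rn_basis ` {..<n}). ((F \<circ> \<gamma>) has_vector_derivative a) (at t within K))"
    proof (rule Lipschitz_curve_differentiable_AE)
      show "(L * L')-lipschitz_on K (F \<circ> \<gamma>)"
        using lip\<gamma> lipschitz_on_subset[OF lip] by (intro lipschitz_on_compose) auto
      show "(F \<circ> \<gamma>) ` K \<subseteq> span (Rn_basis ` {..<n})" using FRn by (auto simp: Rn_eq_span[symmetric])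
    qed simp
    moreover have "AE t in lborel. \<forall>p\<in>P. t \<in> K \<and> \<gamma> t \<in> fst p \<longrightarrow> (\<forall>v a. (\<gamma> has_vector_derivative v) (at t within K) \<longrightarrow>
        ((F \<circ> \<gamma>) has_vector_derivative a) (at t within K) \<longrightarrow> (v, a) \<notin> snd p)"
      unfolding AE_ball_countable[OF cP]
    proof
      fix p assume "p \<in> P"
      then have "velocity_null F (fst p) (snd p)" using Pprops[of "fst p" "snd p"] by simp
      then show "AE t in lborel. t \<in> K \<and> \<gamma> t \<in> fst p \<longrightarrow> (\<forall>v a. (\<gamma> has_vector_derivative v) (at t within K) \<longrightarrow>
        ((F \<circ> \<gamma>) has_vector_derivative a) (at t within K) \<longrightarrow> (v, a) \<notin> snd p)"
        using cf unfolding velocity_null_def by blast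
    qed
    ultimately have "AE t in lborel. t \<in> K \<and> \<gamma> t \<in> S \<longrightarrow> (\<exists>v. ((F \<circ> \<gamma>) has_vector_derivative v) (at t within K) \<and> v \<in> \<tau> (\<gamma> t))"
    proof (eventually_elim, intro impI, elim conjE)
      fix t
      assume v: "t \<in> K \<longrightarrow> (\<exists>v\<in>span B. (\<gamma> has_vector_derivative v) (at t within K))"
        and a: "t \<in> K \<longrightarrow> (\<exists>a\<in>span (Rn_basis ` {..<n}). ((F \<circ> \<gamma>) has_vector_derivative a) (at t within K))"
        and p: "\<forall>p\<in>P. t \<in> K \<and> \<gamma> t \<in> fst p \<longrightarrow> (\<forall>v a. (\<gamma> has_vector_derivative v) (at t within K) \<longrightarrow>
        ((F \<circ> \<gamma>) has_vector_derivative a) (at t within K) \<longrightarrow> (v, a) \<notin> snd p)"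
        and t: "t \<in> K" "\<gamma> t \<in> S"
      obtain v where v: "(\<gamma> has_vector_derivative v) (at t within K)" using v t(1) by blast
      obtain a where a: "a \<in> Rn n" "((F \<circ> \<gamma>) has_vector_derivative a) (at t within K)"
        using a t(1) by (auto simp: Rn_eq_span)
      have "(v, a) \<in> residual P (\<gamma> t)" using p t(1) v a(2) by (fastforce simp: residual_def)
      then show "\<exists>v. ((F \<circ> \<gamma>) has_vector_derivative v) (at t within K) \<and> v \<in> \<tau> (\<gamma> t)"
        using \<tau>(2)[OF t(2) _ a(1)] a(2) by blast
    qed
    then show "AE t in lebesgue. t \<in> K \<and> \<gamma> t \<in> S \<longrightarrow> (\<exists>v. ((F \<circ> \<gamma>) has_vector_derivative v) (at t within K) \<and> v \<in> \<tau> (\<gamma> t))"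
      by (rule AE_completion)
  qed
  then show "\<exists>\<tau>. weak_tangent_field n d S F \<tau>" by blast
qed

section \<open>Stability of the tangential dimension\<close>

text \<open>Weak tangent fields only speak of maps into \<open>Rn\<close>. An injective Lipschitz
  linear map makes them speak of the directions of the space itself.\<close>

lemma finite_dimensional_coordinates:
  fixes B :: "'a::real_normed_vector set"
  assumes "finite B" "span B = UNIV"
  obtains \<Phi> :: "'a \<Rightarrow> nat \<Rightarrow>\<^sub>0 real" and M where "linear \<Phi>" "range \<Phi> \<subseteq> Rn (card B)" "inj \<Phi>" "M \<ge> 0"
    "\<And>x. norm (\<Phi> x) \<le> M * norm x"
proof -
  obtain B' where B': "B' \<subseteq> B" "independent B'" "B \<subseteq> span B'"
    using maximal_independent_subset[of B] by blast
  then have finB': "finite B'" using assms(1) finite_subset by blast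
  have spanB': "span B' = UNIV" using span_mono[OF B'(3)] assms(2) by (auto simp: span_span)
  let ?m = "card B'"
  have mB: "?m \<le> card B" by (rule card_mono[OF assms(1) B'(1)])
  obtain b where b: "indep_upto ?m b" "b ` {..<?m} = B'"
    using indep_upto_of_independent[OF finB' B'(2)] by blast
  obtain \<kappa> where \<kappa>: "\<kappa> > 0" "\<And>c. \<kappa> * (\<Sum>i<?m. \<bar>c i\<bar>) \<le> norm (\<Sum>i<?m. c i *\<^sub>R b i)"
    using indep_upto_lower_bound[OF b(1)] by blast
  obtain \<Phi> where \<Phi>: "linear \<Phi>" "\<And>x. x \<in> B' \<Longrightarrow> \<Phi> x = Rn_basis (the_inv_into {..<?m} b x)"
    using linear_independent_extend[OF B'(2), of "\<lambda>x. Rn_basis (the_inv_into {..<?m} b x)"] by blast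
  have \<Phi>b: "\<Phi> (b i) = Rn_basis i" if "i < ?m" for i
  proof -
    have "b i \<in> B'" using b(2) that by blast
    then show ?thesis using \<Phi>(2) indep_upto_inj_independent(1)[OF b(1)] that by (simp add: the_inv_into_f_f)
  qed
  have \<Phi>sum: "\<Phi> (\<Sum>i<?m. c i *\<^sub>R b i) = (\<Sum>i<?m. c i *\<^sub>R Rn_basis i)" for c
    using \<Phi>b by (simp add: linear_sum[OF \<Phi>(1)] linear_scale[OF \<Phi>(1)])
  have repr: "\<exists>c. x = (\<Sum>i<?m. c i *\<^sub>R b i)" for x
  proof -
    have "x \<in> span (b ` {..<?m})" using spanB' b(2) by simp
    then show ?thesis unfolding span_image_lessThan by blast
  qed
  have Rm: "(\<Sum>i<?m. c i *\<^sub>R Rn_basis i) \<in> Rn ?m" for c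
    unfolding Rn_eq_span span_image_lessThan by blast
  have normc: "norm (\<Sum>i<?m. c i *\<^sub>R Rn_basis i) = (\<Sum>i<?m. \<bar>c i\<bar>)" for c
    by (simp add: norm_Rn[OF Rm] lookup_sum_Rn_basis)
  show thesis
  proof
    show "linear \<Phi>" by fact
    show "range \<Phi> \<subseteq> Rn (card B)"
    proof safe
      fix x
      obtain c where "x = (\<Sum>i<?m. c i *\<^sub>R b i)" using repr by blast
      then have "\<Phi> x \<in> Rn ?m" using \<Phi>sum Rm by simp
      then show "\<Phi> x \<in> Rn (card B)" using mB by (auto simp: Rn_def)
    qed
    show "inj \<Phi>"
      unfolding linear_injective_0[OF \<Phi>(1)]
    proof (intro allI impI)
      fix x assume "\<Phi> x = 0"
      obtain c where c: "x = (\<Sum>i<?m. c i *\<^sub>R b i)" using repr by blast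
      then have "c i = 0" if "i < ?m" for i
        using indep_uptoD[OF indep_upto_Rn_basis, of c ?m i] \<Phi>sum[of c] \<open>\<Phi> x = 0\<close> that by simp
      then show "x = 0" by (simp add: c)
    qed
    show "0 \<le> 1 / \<kappa>" using \<kappa>(1) by simp
    show "norm (\<Phi> x) \<le> 1 / \<kappa> * norm x" for x
    proof -
      obtain c where c: "x = (\<Sum>i<?m. c i *\<^sub>R b i)" using repr by blast
      then show ?thesis using \<kappa>(2)[of c] \<kappa>(1) by (simp add: \<Phi>sum normc field_simps)
    qed
  qed
qed

text \<open>If all \<open>d + 1\<close> distances were below \<open>\<kappa> / 2\<close>, nearby
  vectors of \<open>V\<close> would still be independent, too many for dimension \<open>d\<close>.
  Unlike a dimension, a lower bound on a sum of distances passes to averages over several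
  \<open>V\<close>.\<close>

lemma sum_infdist_Gr_lower_bound:
  assumes u: "indep_upto (Suc d) u"
  shows "\<exists>\<kappa>>0. \<forall>V\<in>Gr n d. \<kappa> \<le> (\<Sum>i<Suc d. infdist (u i) V)"
proof -
  obtain \<kappa> where \<kappa>: "\<kappa> > 0" "\<And>c. \<kappa> * (\<Sum>i<Suc d. \<bar>c i\<bar>) \<le> norm (\<Sum>i<Suc d. c i *\<^sub>R u i)"
    using indep_upto_lower_bound[OF u] by blast
  have "\<kappa> / 2 \<le> (\<Sum>i<Suc d. infdist (u i) V)" if V: "V \<in> Gr n d" for V
  proof (rule ccontr)
    assume "\<not> ?thesis"
    then have lt: "(\<Sum>i<Suc d. infdist (u i) V) < \<kappa> / 2" by simp
    have sub: "subspace V" and VR: "V \<subseteq> Rn n" and dimV: "dim V = d" using V by (auto simp: Gr_def)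
    have "\<exists>v\<in>V. dist (u i) v < \<kappa> / 2" if i: "i < Suc d" for i
    proof -
      have "infdist (u i) V \<le> (\<Sum>i<Suc d. infdist (u i) V)"
        using i by (intro member_le_sum) (auto simp: infdist_nonneg)
      then have "infdist (u i) V < \<kappa> / 2" using lt by simp
      then show ?thesis using subspace_0[OF sub] by (blast elim: infdist_lessE)
    qed
    then obtain v where v: "\<And>i. i < Suc d \<Longrightarrow> v i \<in> V" "\<And>i. i < Suc d \<Longrightarrow> dist (u i) (v i) < \<kappa> / 2" by metis
    have "indep_upto (Suc d) v"
      unfolding indep_upto_def
    proof (intro allI impI)
      fix c i assume c: "(\<Sum>i<Suc d. c i *\<^sub>R v i) = 0" and i: "i < Suc d"
      have "norm (\<Sum>i<Suc d. c i *\<^sub>R u i) = norm (\<Sum>i<Suc d. c i *\<^sub>R (u i - v i))"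
        unfolding scaleR_diff_right sum_subtractf c by simp
      also have "\<dots> \<le> (\<Sum>i<Suc d. norm (c i *\<^sub>R (u i - v i)))" by (rule norm_sum)
      also have "\<dots> \<le> (\<Sum>i<Suc d. \<bar>c i\<bar> * (\<kappa> / 2))"
        unfolding norm_scaleR using v(2) by (intro sum_mono mult_left_mono) (auto simp: dist_norm intro: less_imp_le)
      also have "\<dots> = (\<Sum>i<Suc d. \<bar>c i\<bar>) * (\<kappa> / 2)" by (rule sum_distrib_right[symmetric])
      finally have "\<kappa> * (\<Sum>i<Suc d. \<bar>c i\<bar>) \<le> (\<Sum>i<Suc d. \<bar>c i\<bar>) * (\<kappa> / 2)" using \<kappa>(2)[of c] by (rule order_trans[rotated])
      then have "(\<Sum>i<Suc d. \<bar>c i\<bar>) * \<kappa> \<le> 0" by (simp add: field_simps)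
      then have "(\<Sum>i<Suc d. \<bar>c i\<bar>) \<le> 0" using \<kappa>(1) by (simp add: mult_le_0_iff)
      moreover have "\<bar>c i\<bar> \<le> (\<Sum>i<Suc d. \<bar>c i\<bar>)" using i by (intro member_le_sum) auto
      ultimately show "c i = 0" by simp
    qed
    moreover obtain B where B: "B \<subseteq> V" "independent B" "V \<subseteq> span B" "card B = dim V" using basis_exists by blast
    moreover have "finite B"
      using independent_span_bound[of "Rn_basis ` {..<n}" B] B VR by (auto simp: Rn_eq_span)
    ultimately have "Suc d \<le> card B" using v(1) by (intro indep_upto_le_card[of _ v]) auto
    then show False using B(4) dimV by simp
  qed
  then show ?thesis using \<kappa>(1) by (intro exI[of _ "\<kappa> / 2"]) auto
qed

lemma convergent_of_dense:
  fixes h :: "nat \<Rightarrow> 'v::metric_space \<Rightarrow> real"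
  assumes lip: "\<And>j u v. \<bar>h j u - h j v\<bar> \<le> M * dist u v" and M: "M \<ge> 0"
    and dense: "\<And>v \<epsilon>. 0 < \<epsilon> \<Longrightarrow> \<exists>u\<in>D. dist v u < \<epsilon>" and conv: "\<And>u. u \<in> D \<Longrightarrow> convergent (\<lambda>j. h j u)"
  shows "convergent (\<lambda>j. h j v)"
proof -
  have "Cauchy (\<lambda>j. h j v)"
  proof (rule metric_CauchyI)
    fix e :: real assume "e > 0"
    then have "e / (3 * (M + 1)) > 0" using M by (intro divide_pos_pos) auto
    then obtain u where u: "u \<in> D" "dist v u < e / (3 * (M + 1))" using dense by blast
    have "M * dist v u \<le> (M + 1) * dist v u" by (simp add: distrib_right)
    also have "\<dots> < e / 3" using u(2) M by (simp add: field_simps)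
    finally have vu: "M * dist v u < e / 3" .
    have "Cauchy (\<lambda>j. h j u)" using conv[OF u(1)] by (rule convergent_Cauchy)
    then obtain N where N: "\<And>i j. N \<le> i \<Longrightarrow> N \<le> j \<Longrightarrow> dist (h i u) (h j u) < e / 3"
      using \<open>e > 0\<close> by (metis metric_CauchyD divide_pos_pos zero_less_numeral)
    show "\<exists>N. \<forall>i\<ge>N. \<forall>j\<ge>N. dist (h i v) (h j v) < e"
    proof (intro exI[of _ N] allI impI)
      fix i j assume "N \<le> i" "N \<le> j"
      then have "\<bar>h i u - h j u\<bar> < e / 3" using N[of i j] by (simp add: dist_real_def)
      then show "dist (h i v) (h j v) < e"
        using lip[of i v u] lip[of j v u] vu unfolding dist_real_def by linarith
    qed
  qed
  then show ?thesis by (simp add: Cauchy_convergent_iff)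
qed

lemma infdist_subspace_lipschitz:
  assumes \<Phi>: "linear \<Phi>" "\<And>x. norm (\<Phi> x) \<le> M * norm x"
  shows "\<bar>infdist (\<Phi> u) V - infdist (\<Phi> v) V\<bar> \<le> M * norm (u - v)"
proof -
  have "\<bar>infdist (\<Phi> u) V - infdist (\<Phi> v) V\<bar> \<le> dist (\<Phi> u) (\<Phi> v)" by (rule infdist_triangle_abs)
  also have "\<dots> = norm (\<Phi> (u - v))" by (simp add: dist_norm linear_diff[OF \<Phi>(1)])
  also have "\<dots> \<le> M * norm (u - v)" by (rule \<Phi>(2))
  finally show ?thesis .
qed

lemma not_porous_imp_at_within_ne_bot:
  fixes K :: "real set"
  assumes np: "\<forall>\<eta>>0. \<exists>\<delta>>0. \<forall>s. 0 < \<bar>s\<bar> \<and> \<bar>s\<bar> < \<delta> \<longrightarrow> (\<exists>s'. t + s' \<in> K \<and> \<bar>s' - s\<bar> < \<eta> * \<bar>s\<bar>)"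
  shows "at t within K \<noteq> bot"
  unfolding trivial_limit_within not_not islimpt_approachable
proof (intro allI impI)
  fix e :: real assume "e > 0"
  obtain \<delta> where \<delta>: "\<delta> > 0" "\<And>s. 0 < \<bar>s\<bar> \<Longrightarrow> \<bar>s\<bar> < \<delta> \<Longrightarrow> \<exists>s'. t + s' \<in> K \<and> \<bar>s' - s\<bar> < 1 * \<bar>s\<bar>"
    using np[rule_format, of 1] by auto
  define s where "s = min \<delta> e / 3"
  have s: "s > 0" "s < \<delta>" "2 * s < e" using \<delta>(1) \<open>e > 0\<close> by (auto simp: s_def)
  then obtain s' where s': "t + s' \<in> K" "\<bar>s' - s\<bar> < s" using \<delta>(2)[of s] by auto
  then show "\<exists>x'\<in>K. x' \<noteq> t \<and> dist x' t < e"
    using s by (intro bexI[of _ "t + s'"]) (auto simp: dist_real_def)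
qed

text \<open>The composition of \<open>f\<close> with \<open>\<gamma>\<close> is again a curve
  fragment, so the field applies to it. At non-porous times the derivative relative to
  \<open>K\<close> is unique, and tangency carries over to the two-sided derivative of the extended
  curve.\<close>

lemma AE_derivative_tangent:
  fixes \<gamma> :: "real \<Rightarrow> 'a::real_normed_vector" and \<Phi> :: "'a \<Rightarrow> nat \<Rightarrow>\<^sub>0 real"
  assumes \<tau>: "weak_tangent_field n d S \<Phi> \<tau>" and \<Phi>: "linear \<Phi>" "\<And>x. norm (\<Phi> x) \<le> M * norm x"
    and K: "curve_fragment K \<gamma>" and f: "1-lipschitz_on UNIV f"
    and ext: "L-lipschitz_on UNIV \<gamma>'" "\<And>t. t \<in> K \<Longrightarrow> \<gamma>' t = \<gamma> t"
  shows "AE t in lborel. t \<in> K \<and> f (\<gamma> t) \<in> S \<longrightarrow>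
    (\<forall>w. ((\<lambda>t. f (\<gamma>' t)) has_vector_derivative w) (at t) \<longrightarrow> \<Phi> w \<in> \<tau> (f (\<gamma> t)))"
proof -
  obtain L' where L': "L'-lipschitz_on K \<gamma>" using K by (auto simp: curve_fragment_def)
  have "curve_fragment K (f \<circ> \<gamma>)"
    using K lipschitz_on_compose[OF L' lipschitz_on_subset[OF f, of "\<gamma> ` K"]] by (auto simp: curve_fragment_def)
  then have "AE t in lborel. t \<in> K \<and> (f \<circ> \<gamma>) t \<in> S \<longrightarrow>
      (\<exists>v. ((\<Phi> \<circ> (f \<circ> \<gamma>)) has_vector_derivative v) (at t within K) \<and> v \<in> \<tau> ((f \<circ> \<gamma>) t))"
    using \<tau> unfolding weak_tangent_field_def AE_completion_iff by blast
  then show ?thesis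
    using AE_not_porous[of K]
  proof (eventually_elim, intro impI allI, elim conjE)
    fix t w
    assume ex: "t \<in> K \<and> (f \<circ> \<gamma>) t \<in> S \<longrightarrow>
      (\<exists>v. ((\<Phi> \<circ> (f \<circ> \<gamma>)) has_vector_derivative v) (at t within K) \<and> v \<in> \<tau> ((f \<circ> \<gamma>) t))"
      and np: "t \<in> K \<longrightarrow> (\<forall>\<eta>>0. \<exists>\<delta>>0. \<forall>s. 0 < \<bar>s\<bar> \<and> \<bar>s\<bar> < \<delta> \<longrightarrow> (\<exists>s'. t + s' \<in> K \<and> \<bar>s' - s\<bar> < \<eta> * \<bar>s\<bar>))"
      and t: "t \<in> K" "f (\<gamma> t) \<in> S" and w: "((\<lambda>t. f (\<gamma>' t)) has_vector_derivative w) (at t)"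
    have lim: "at t within K \<noteq> bot" by (rule not_porous_imp_at_within_ne_bot[OF mp[OF np t(1)]])
    obtain v where v: "((\<Phi> \<circ> (f \<circ> \<gamma>)) has_vector_derivative v) (at t within K)" "v \<in> \<tau> (f (\<gamma> t))"
      using ex t by auto
    have "bounded_linear \<Phi>" using \<Phi> by (auto simp: bounded_linear_def bounded_linear_axioms_def mult.commute linear_linear intro!: exI[of _ M])
    then have "((\<lambda>t. \<Phi> (f (\<gamma>' t))) has_vector_derivative \<Phi> w) (at t within K)"
      using bounded_linear.has_vector_derivative[OF _ has_vector_derivative_at_within[OF w]] by blast
    then have "((\<Phi> \<circ> (f \<circ> \<gamma>)) has_vector_derivative \<Phi> w) (at t within K)"
      by (rule has_vector_derivative_transform[OF t(1), rotated]) (use ext(2) in auto)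
    then have "v = \<Phi> w" using vector_derivative_unique_within[OF lim v(1)] by blast
    then show "\<Phi> w \<in> \<tau> (f (\<gamma> t))" using v(2) by simp
  qed
qed

lemma tail_weighted_tendsto_0:
  assumes \<Lambda>: "\<And>j. \<Lambda> j \<in> tail_weights j" and I: "I \<longlonglongrightarrow> 0" and I0: "\<And>k. 0 \<le> I k"
  shows "(\<lambda>j. weighted (\<Lambda> j) I) \<longlonglongrightarrow> 0"
proof (rule LIMSEQ_I)
  fix e :: real assume e: "e > 0"
  then have "\<forall>\<^sub>F k in sequentially. I k < e / 2" by (intro order_tendstoD(2)[OF I]) simp
  then obtain N where N: "\<And>k. N \<le> k \<Longrightarrow> I k < e / 2" unfolding eventually_sequentially by blast
  have "norm (weighted (\<Lambda> j) I - 0) < e" if "N \<le> j" for j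
  proof -
    have "weighted (\<Lambda> j) I \<le> weighted (\<Lambda> j) (\<lambda>_. e / 2)"
      using N that by (intro weighted_mono[OF \<Lambda>]) (auto intro: less_imp_le)
    moreover have "weighted (\<Lambda> j) (\<lambda>_. 0) \<le> weighted (\<Lambda> j) I"
      using I0 by (intro weighted_mono[OF \<Lambda>])
    ultimately show ?thesis using e unfolding weighted_const[OF \<Lambda>] by simp
  qed
  then show "\<exists>no. \<forall>n\<ge>no. norm (weighted (\<Lambda> n) I - 0) < e" by blast
qed

lemma weighted_lipschitz:
  assumes w: "w \<in> tail_weights j" and "\<And>k. \<bar>a k - b k\<bar> \<le> C"
  shows "\<bar>weighted w a - weighted w b\<bar> \<le> C"
proof -
  have "weighted w a \<le> weighted w (\<lambda>k. b k + C)" "weighted w b \<le> weighted w (\<lambda>k. a k + C)"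
    using assms(2) by (auto intro!: weighted_mono[OF w] simp: abs_le_iff algebra_simps)
  then show ?thesis unfolding weighted_add weighted_const[OF w] by linarith
qed

lemma borel_measurable_weighted:
  assumes "\<And>k. g k \<in> borel_measurable M"
  shows "(\<lambda>x. weighted w (\<lambda>k. g k x)) \<in> borel_measurable M"
  unfolding weighted_def using assms by measurable

text \<open>Radius and tolerance are tied to one number \<open>k\<close>, so that failure for every
  \<open>k\<close> produces a sequence of maps converging to the identity.\<close>

lemma dim_stability_upto:
  fixes \<mu> :: "'a::real_normed_vector measure"
  assumes B: "finite B" "span B = (UNIV::'a set)"
    and strictly_convex: "\<And>x y::'a. closed_segment x y \<subseteq> sphere 0 1 \<Longrightarrow> x = y"
    and \<mu>: "sets \<mu> = sets borel" "finite_measure \<mu>"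
  shows "\<exists>k::nat. \<forall>f N. 1-lipschitz_on UNIV f \<longrightarrow> (\<forall>x\<in>cball 0 (real k). norm (f x - x) \<le> inverse (real (Suc k))) \<longrightarrow>
     N \<in> sets borel \<longrightarrow> emeasure \<mu> (f -` N) = 0 \<longrightarrow> admits_weak_tangent_field d (UNIV - N) \<longrightarrow>
     (\<exists>N\<in>sets borel. emeasure \<mu> N = 0 \<and> admits_weak_tangent_field d (UNIV - N))"
proof (rule ccontr)
  assume contra: "\<not> ?thesis"
  then have "\<forall>k::nat. \<exists>f N. 1-lipschitz_on UNIV f \<and> (\<forall>x\<in>cball 0 (real k). norm (f x - x) \<le> inverse (real (Suc k))) \<and>
     N \<in> sets borel \<and> emeasure \<mu> (f -` N) = 0 \<and> admits_weak_tangent_field d (UNIV - N)"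
    by blast
  then obtain f N where fN: "\<And>k. 1-lipschitz_on UNIV (f k)"
    "\<And>k x. x \<in> cball 0 (real k) \<Longrightarrow> norm (f k x - x) \<le> inverse (real (Suc k))"
    "\<And>k. N k \<in> sets borel" "\<And>k. emeasure \<mu> (f k -` N k) = 0" "\<And>k. admits_weak_tangent_field d (UNIV - N k)"
    by metis
  have no: "\<not> admits_weak_tangent_field d (UNIV - N')" if "N' \<in> sets borel" "emeasure \<mu> N' = 0" for N'
    using contra that by blast
  have lim: "(\<lambda>k. f k x) \<longlonglongrightarrow> x" for x
  proof (rule LIM_zero_cancel, rule Lim_null_comparison)
    obtain k0 :: nat where k0: "norm x \<le> real k0" using real_arch_simple by blast
    then have "norm (f k x - x) \<le> inverse (real (Suc k))" if "k0 \<le> k" for k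
      using that by (intro fN(2)) simp
    then show "\<forall>\<^sub>F k in sequentially. norm (f k x - x) \<le> inverse (real (Suc k))"
      unfolding eventually_sequentially by blast
  qed (rule LIMSEQ_inverse_real_of_nat)
  obtain \<Phi>0 :: "'a \<Rightarrow> nat \<Rightarrow>\<^sub>0 real" and M where \<Phi>0: "linear \<Phi>0" "range \<Phi>0 \<subseteq> Rn (card B)" "inj \<Phi>0" "M \<ge> 0"
    "\<And>x. norm (\<Phi>0 x) \<le> M * norm x"
    by (rule finite_dimensional_coordinates[OF B]) blast
  define \<Phi> where "\<Phi> = \<Phi>0"
  note \<Phi> = \<Phi>0[folded \<Phi>_def]
  \<comment> \<open>Admissibility of \<open>d\<close> provides fields only for maps into
    \<open>Rn n\<close> with \<open>n \<ge> d\<close>.\<close>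
  define n where "n = max d (card B)"
  have "\<exists>\<tau>. weak_tangent_field n d (UNIV - N k) \<Phi> \<tau>" for k
  proof -
    have "Rn (card B) \<subseteq> Rn n" by (auto simp: Rn_def n_def)
    then have "range \<Phi> \<subseteq> Rn n" using \<Phi>(2) by (rule order_trans[rotated])
    moreover have "M-lipschitz_on UNIV \<Phi>"
      using \<Phi> by (intro lipschitz_onI) (auto simp: dist_norm simp flip: linear_diff)
    moreover have "d \<le> n" by (simp add: n_def)
    ultimately show ?thesis using fN(5)[of k] unfolding admits_weak_tangent_field_def by blast
  qed
  then obtain \<tau> where \<tau>: "\<And>k. weak_tangent_field n d (UNIV - N k) \<Phi> (\<tau> k)" by metis
  have \<tau>m: "\<tau> k \<in> measurable (restrict_space borel (UNIV - N k)) (gr_borel n d)" for k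
    using \<tau> by (simp add: weak_tangent_field_def)
  have compl: "UNIV - N k \<in> sets borel" for k using fN(3) by (intro sets.Diff) auto
  have fm: "f k \<in> borel_measurable borel" for k
    by (intro borel_measurable_continuous_onI lipschitz_on_continuous_on[OF fN(1)])
  \<comment> \<open>Off this null set every \<open>\<tau> k\<close> is defined at
    \<open>f k x\<close>.\<close>
  define N0 where "N0 = (\<Union>k. f k -` N k)"
  have fN_borel: "f k -` N k \<in> sets borel" for k using measurable_sets[OF fm fN(3)] by simp
  have N0: "N0 \<in> null_sets \<mu>"
    unfolding N0_def using fN(4) fN_borel \<mu>(1) by (intro null_sets_UN null_setsI) auto
  have N0b: "N0 \<in> sets borel" using N0 \<mu>(1) by (auto simp: null_sets_def)
  have fS: "f k x \<in> UNIV - N k" if "x \<notin> N0" for x k using that by (auto simp: N0_def)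
  have GV: "\<tau> k (f k x) \<in> Gr n d" if "x \<notin> N0" for x k
    by (rule infdist_tangent_field_measurable(2)[OF \<tau>m compl fS[OF that]])
  \<comment> \<open>The value \<open>0\<close> on \<open>N0\<close> keeps measurability and the
    bounds valid at every point.\<close>
  define Q where "Q k x v = (if x \<in> N0 then 0 else infdist (\<Phi> v) (\<tau> k (f k x)))" for k x v
  have Q0: "0 \<le> Q k x v" for k x v by (simp add: Q_def infdist_nonneg)
  have Qlip: "\<bar>Q k x u - Q k x v\<bar> \<le> M * norm (u - v)" for k x u v
    unfolding Q_def using infdist_subspace_lipschitz[OF \<Phi>(1,5)] \<Phi>(4) by simp
  have Qle: "Q k x v \<le> M * norm v" for k x v
  proof (cases "x \<in> N0")
    case False
    then have "0 \<in> \<tau> k (f k x)" using GV[OF False, of k] by (simp add: Gr_def subspace_0)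
    then have "infdist (\<Phi> v) (\<tau> k (f k x)) \<le> dist (\<Phi> v) 0" by (rule infdist_le)
    also have "\<dots> \<le> M * norm v" using \<Phi>(5) by simp
    finally show ?thesis using False by (simp add: Q_def)
  qed (use \<Phi>(4) in \<open>simp add: Q_def\<close>)
  have Qmeas: "(\<lambda>x. Q k x v) \<in> borel_measurable borel" for k v
  proof (rule borel_measurableI_less)
    fix r
    have "{y \<in> UNIV - N k. infdist (\<Phi> v) (\<tau> k y) < r} \<in> sets borel"
      by (rule infdist_tangent_field_measurable(1)[OF \<tau>m compl])
    then have "f k -` {y \<in> UNIV - N k. infdist (\<Phi> v) (\<tau> k y) < r} \<in> sets borel"
      by (rule measurable_sets_borel[OF fm])
    then have "(f k -` {y \<in> UNIV - N k. infdist (\<Phi> v) (\<tau> k y) < r} - N0) \<union> (if 0 < r then N0 else {}) \<in> sets borel"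
      using N0b by (intro sets.Un sets.Diff) auto
    moreover have "(f k -` {y \<in> UNIV - N k. infdist (\<Phi> v) (\<tau> k y) < r} - N0) \<union> (if 0 < r then N0 else {})
       = {x \<in> space borel. Q k x v < r}"
      using fS by (auto simp: Q_def)
    ultimately show "{x \<in> space borel. Q k x v < r} \<in> sets borel" by simp
  qed
  obtain DX where "countable DX" "DX \<subseteq> span B" "\<And>x \<epsilon>. x \<in> span B \<Longrightarrow> 0 < \<epsilon> \<Longrightarrow> \<exists>y\<in>DX. dist x y < \<epsilon>"
    by (rule countable_dense_span[OF B(1)]) blast
  then have DX: "countable DX" "\<And>x \<epsilon>. 0 < \<epsilon> \<Longrightarrow> \<exists>y\<in>DX. dist x y < \<epsilon>" using B(2) by auto
  have "DX \<noteq> {}" using DX(2)[of 1] by auto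
  define V where "V = from_nat_into DX"
  have V: "range V = DX" unfolding V_def using DX(1) \<open>DX \<noteq> {}\<close> by (rule range_from_nat_into[rotated])
  \<comment> \<open>The geometric distribution charges every index, so one application of the
    convergence theorem on the product gives weights \<open>\<Lambda>\<close> that serve all vectors
    \<open>V i\<close> of a dense sequence at once.\<close>
  let ?geo = "measure_pmf (geometric_pmf (1/2))"
  let ?M = "\<mu> \<Otimes>\<^sub>M ?geo"
  interpret \<mu>: finite_measure \<mu> by (rule \<mu>(2))
  interpret P: pair_sigma_finite \<mu> ?geo ..
  \<comment> \<open>The denominator bounds the functions by \<open>1\<close>, uniformly in the index
    \<open>i\<close> of the vector.\<close>
  define g where "g k p = Q k (fst p) (V (snd p)) / (1 + M * norm (V (snd p)))" for k and p :: "'a \<times> nat"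
  have den: "0 < 1 + M * norm v" for v :: 'a using \<Phi>(4) by (intro add_pos_nonneg) auto
  have "finite_measure ?M"
  proof (rule finite_measureI)
    have "emeasure ?M (space ?M) = emeasure \<mu> (space \<mu>) * emeasure ?geo (space ?geo)"
      unfolding space_pair_measure by (intro measure_pmf.emeasure_pair_measure_Times) auto
    then show "emeasure ?M (space ?M) \<noteq> \<infinity>"
      using \<mu>.finite_emeasure_space measure_pmf.emeasure_space_1[of "geometric_pmf (1/2)"] by simp
  qed
  moreover have "g k \<in> borel_measurable ?M" for k
  proof -
    have fstm: "fst \<in> measurable ?M borel"
      using measurable_fst[of \<mu> ?geo] measurable_cong_sets[OF refl \<mu>(1), of ?M] by simp
    have sndm: "snd \<in> measurable ?M (count_space UNIV)"
      using measurable_snd[of \<mu> ?geo] by simp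
    have "(\<lambda>p. (\<lambda>i p. Q k (fst p) (V i) / (1 + M * norm (V i))) (snd p) p) \<in> borel_measurable ?M"
      by (rule measurable_compose_countable[OF _ sndm])
        (intro borel_measurable_divide borel_measurable_const measurable_compose[OF fstm Qmeas])
    then show ?thesis by (simp add: g_def[abs_def])
  qed
  moreover have "0 \<le> g k p" "g k p \<le> 1" for k p
    unfolding g_def using Q0 den Qle[of k "fst p" "V (snd p)"]
    by (auto simp: pos_divide_le_eq intro!: divide_nonneg_pos)
  ultimately obtain \<Lambda> where \<Lambda>: "\<And>j. \<Lambda> j \<in> tail_weights j"
    "AE p in ?M. convergent (\<lambda>j. weighted (\<Lambda> j) (\<lambda>k. g k p))"
    by (rule convex_combinations_converge_AE[of ?M g 1]) blast
  have "AE x in \<mu>. \<forall>i. convergent (\<lambda>j. weighted (\<Lambda> j) (\<lambda>k. Q k x (V i)))"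
    using P.AE_pair[OF \<Lambda>(2)] unfolding AE_measure_pmf_iff
  proof (rule eventually_mono, intro allI)
    fix x i
    assume "\<forall>i\<in>set_pmf (geometric_pmf (1/2)). convergent (\<lambda>j. weighted (\<Lambda> j) (\<lambda>k. g k (x, i)))"
    then have conv: "convergent (\<lambda>j. weighted (\<Lambda> j) (\<lambda>k. g k (x, i)))" by (simp add: set_pmf_geometric)
    have "weighted w (\<lambda>k. Q k x (V i)) = (1 + M * norm (V i)) * weighted w (\<lambda>k. g k (x, i))" for w
      using den[of "V i"] by (simp add: g_def flip: weighted_cmult)
    then show "convergent (\<lambda>j. weighted (\<Lambda> j) (\<lambda>k. Q k x (V i)))"
      using convergent_mult[OF convergent_const conv] by simp
  qed
  then obtain N1 where N1: "{x \<in> space \<mu>. \<not> (\<forall>i. convergent (\<lambda>j. weighted (\<Lambda> j) (\<lambda>k. Q k x (V i))))} \<subseteq> N1"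
    "emeasure \<mu> N1 = 0" "N1 \<in> sets \<mu>" by (rule AE_E)
  define N' where "N' = N0 \<union> N1"
  have N'b: "N' \<in> sets borel" using N0b N1(3) \<mu>(1) by (auto simp: N'_def)
  have "N' \<in> null_sets \<mu>" unfolding N'_def using N0 N1 by (intro null_sets.Un) (auto simp: null_sets_def)
  then have N'0: "emeasure \<mu> N' = 0" by auto
  define S where "S = UNIV - N'"
  have Sb: "S \<in> sets borel" unfolding S_def using N'b by auto
  have S0: "x \<notin> N0" if "x \<in> S" for x using that by (auto simp: S_def N'_def)
  have Wlip: "\<bar>weighted (\<Lambda> j) (\<lambda>k. Q k x u) - weighted (\<Lambda> j) (\<lambda>k. Q k x v)\<bar> \<le> M * norm (u - v)" for j x u v
    by (rule weighted_lipschitz[OF \<Lambda>(1) Qlip])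
  have conv: "convergent (\<lambda>j. weighted (\<Lambda> j) (\<lambda>k. Q k x v))" if x: "x \<in> S" for x v
  proof (rule convergent_of_dense[of "\<lambda>j v. weighted (\<Lambda> j) (\<lambda>k. Q k x v)" M DX])
    show "\<bar>weighted (\<Lambda> j) (\<lambda>k. Q k x u) - weighted (\<Lambda> j) (\<lambda>k. Q k x v)\<bar> \<le> M * dist u v" for j u v
      using Wlip by (simp add: dist_norm)
    have "space \<mu> = UNIV" using sets_eq_imp_space_eq[OF \<mu>(1)] by simp
    then have "\<forall>i. convergent (\<lambda>j. weighted (\<Lambda> j) (\<lambda>k. Q k x (V i)))"
      using N1(1) x by (auto simp: S_def N'_def)
    then show "convergent (\<lambda>j. weighted (\<Lambda> j) (\<lambda>k. Q k x u))" if "u \<in> DX" for u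
      using that V by auto
  qed (use \<Phi>(4) DX(2) in auto)
  define q where "q x v = lim (\<lambda>j. weighted (\<Lambda> j) (\<lambda>k. Q k x v))" for x v
  have qlim: "(\<lambda>j. weighted (\<Lambda> j) (\<lambda>k. Q k x v)) \<longlonglongrightarrow> q x v" if "x \<in> S" for x v
    unfolding q_def using conv[OF that] by (simp add: convergent_LIMSEQ_iff)
  have W0: "0 \<le> weighted (\<Lambda> j) (\<lambda>k. Q k x v)" for j x v
    using weighted_mono[OF \<Lambda>(1), of j "\<lambda>_. 0" "\<lambda>k. Q k x v"] Q0 weighted_const[OF \<Lambda>(1), of j 0] by simp
  have "admits_weak_tangent_field d S"
  proof (rule admits_weak_tangent_field_of_kernel[OF B Sb \<Phi>(4), of q])
    show "0 \<le> q x v" if "x \<in> S" for x v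
      using W0 by (intro LIMSEQ_le_const[OF qlim[OF that]]) auto
    show "{x \<in> S. c < q x v} \<in> sets borel" for c v
    proof -
      have "(\<lambda>x. q x v) \<in> borel_measurable borel"
        unfolding q_def by (intro borel_measurable_lim_metric borel_measurable_weighted Qmeas)
      then have "{x. c < q x v} \<in> sets borel" by simp
      then have "S \<inter> {x. c < q x v} \<in> sets borel" using Sb by (intro sets.Int)
      then show ?thesis by (simp add: Int_def)
    qed
    show "\<bar>q x u - q x v\<bar> \<le> M * norm (u - v)" if "x \<in> S" for x u v
      by (rule LIMSEQ_le_const2[OF tendsto_rabs[OF tendsto_diff[OF qlim[OF that] qlim[OF that]]]])
        (use Wlip in blast)
    show "\<not> indep_upto (Suc d) v" if x: "x \<in> S" and v: "\<And>i. i \<le> d \<Longrightarrow> q x (v i) = 0" for x v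
    proof
      assume ind: "indep_upto (Suc d) v"
      have "indep_upto (Suc d) (\<lambda>i. \<Phi> (v i))"
        unfolding indep_upto_def
      proof (intro allI impI)
        fix c i assume "(\<Sum>i<Suc d. c i *\<^sub>R \<Phi> (v i)) = 0" "i < Suc d"
        moreover have "(\<Sum>i<Suc d. c i *\<^sub>R \<Phi> (v i)) = \<Phi> (\<Sum>i<Suc d. c i *\<^sub>R v i)"
          by (simp only: linear_sum[OF \<Phi>(1)] linear_scale[OF \<Phi>(1)])
        ultimately have "\<Phi> (\<Sum>i<Suc d. c i *\<^sub>R v i) = \<Phi> 0" using linear_0[OF \<Phi>(1)] by simp
        then have "(\<Sum>i<Suc d. c i *\<^sub>R v i) = 0" by (rule injD[OF \<Phi>(3)])
        then show "c i = 0" using indep_uptoD[OF ind] \<open>i < Suc d\<close> by blast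
      qed
      then obtain \<kappa> where \<kappa>: "\<kappa> > 0" "\<And>V. V \<in> Gr n d \<Longrightarrow> \<kappa> \<le> (\<Sum>i<Suc d. infdist (\<Phi> (v i)) V)"
        using sum_infdist_Gr_lower_bound by blast
      \<comment> \<open>One \<open>\<kappa>\<close> works for all the subspaces
        \<open>\<tau> k (f k x)\<close>, hence for their averages and the limit.\<close>
      have "\<kappa> \<le> (\<Sum>i<Suc d. weighted (\<Lambda> j) (\<lambda>k. Q k x (v i)))" for j
      proof -
        have "\<kappa> = weighted (\<Lambda> j) (\<lambda>_. \<kappa>)" by (rule weighted_const[OF \<Lambda>(1), symmetric])
        also have "\<dots> \<le> weighted (\<Lambda> j) (\<lambda>k. \<Sum>i<Suc d. Q k x (v i))"
          using \<kappa>(2)[OF GV[OF S0[OF x]]] S0[OF x] by (intro weighted_mono[OF \<Lambda>(1)]) (simp add: Q_def)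
        finally show ?thesis by (simp only: weighted_sum)
      qed
      moreover have "(\<lambda>j. \<Sum>i<Suc d. weighted (\<Lambda> j) (\<lambda>k. Q k x (v i))) \<longlonglongrightarrow> (\<Sum>i<Suc d. q x (v i))"
        by (intro tendsto_sum qlim x)
      ultimately have "\<kappa> \<le> (\<Sum>i<Suc d. q x (v i))" by (intro LIMSEQ_le_const) auto
      also have "(\<Sum>i<Suc d. q x (v i)) = 0" using v by (intro sum.neutral) auto
      finally show False using \<kappa>(1) by simp
    qed
    fix K and \<gamma> :: "real \<Rightarrow> 'a" assume K: "curve_fragment K \<gamma>"
    then obtain L where L: "L-lipschitz_on K \<gamma>" and K01: "K \<subseteq> {0..1}" by (auto simp: curve_fragment_def)
    obtain \<gamma>' L' where ext: "L'-lipschitz_on UNIV \<gamma>'" "\<And>t. t \<in> K \<Longrightarrow> \<gamma>' t = \<gamma> t"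
      "AE t in lborel. \<exists>v\<in>span B. (\<gamma>' has_vector_derivative v) (at t)"
      by (rule Lipschitz_curve_extension[OF L B(1)]) (use B(2) in simp, blast)
    define s where "s k = speed (\<lambda>t. \<gamma>' t - f k (\<gamma>' t))" for k
    have lipf: "L'-lipschitz_on UNIV (\<lambda>t. f k (\<gamma>' t))" for k
      using lipschitz_on_compose2[OF ext(1), of 1 "f k"] lipschitz_on_subset[OF fN(1)[of k]] by simp
    have lipg: "(2 * L')-lipschitz_on UNIV (\<lambda>t. \<gamma>' t - f k (\<gamma>' t))" for k
      using lipschitz_on_diff[OF ext(1) lipf[of k]] by simp
    have sm: "s k \<in> borel_measurable borel" for k unfolding s_def by (rule borel_measurable_speed[OF lipg])
    have s0: "0 \<le> s k t" "s k t \<le> 2 * L'" for k t unfolding s_def by (rule speed_bounds[OF lipg])+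
    have sint: "set_integrable lborel {0..1} (s k)" "s k integrable_on {0..1}" for k
      using s0 by (auto intro!: bounded_measurable_integrable_Icc[OF sm, of _ "2 * L'"])
    \<comment> \<open>The weights were fixed before the curve. As they move to infinity, they also
      average the integrals of the speeds, which tend to \<open>0\<close>.\<close>
    define h where "h j t = weighted (\<Lambda> j) (\<lambda>k. indicator {0..1} t *\<^sub>R s k t)" for j and t :: real
    have hint: "integrable lborel (h j)" for j
      unfolding h_def weighted_def using sint(1)
      by (intro Bochner_Integration.integrable_sum integrable_mult_right) (simp add: set_integrable_def)
    have hI: "(\<integral>t. norm (h j t) \<partial>lborel) = weighted (\<Lambda> j) (\<lambda>k. integral {0..1} (s k))" for j
    proof -
      have "0 \<le> h j t" for t
        unfolding h_def using s0 weighted_mono[OF \<Lambda>(1), of j "\<lambda>_. 0" "\<lambda>k. indicator {0..1} t *\<^sub>R s k t"]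
          weighted_const[OF \<Lambda>(1), of j 0] by (simp add: indicator_def)
      then have "(\<integral>t. norm (h j t) \<partial>lborel) = (\<integral>t. h j t \<partial>lborel)" by simp
      also have "\<dots> = weighted (\<Lambda> j) (\<lambda>k. \<integral>t. indicator {0..1} t *\<^sub>R s k t \<partial>lborel)"
        unfolding h_def weighted_def using sint(1)
        by (subst Bochner_Integration.integral_sum) (auto simp: set_integrable_def)
      also have "(\<lambda>k. \<integral>t. indicator {0..1} t *\<^sub>R s k t \<partial>lborel) = (\<lambda>k. integral {0..1} (s k))"
        using set_borel_integral_eq_integral(2)[OF sint(1)] by (simp add: set_lebesgue_integral_def)
      finally show ?thesis .
    qed
    have "(\<lambda>j. \<integral>t. norm (h j t) \<partial>lborel) \<longlonglongrightarrow> 0"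
      unfolding hI
    proof (rule tail_weighted_tendsto_0[OF \<Lambda>(1)])
      show "(\<lambda>k. integral {0..1} (s k)) \<longlonglongrightarrow> 0"
        unfolding s_def by (rule integral_speed_diff_tendsto_0[OF strictly_convex B ext(1) fN(1) lim])
      show "0 \<le> integral {0..1} (s k)" for k
        using sint(2) s0 by (intro Henstock_Kurzweil_Integration.integral_nonneg) auto
    qed
    \<comment> \<open>The subsequence depends on the curve; this is harmless because
      \<open>q\<close> is a limit along the full sequence.\<close>
    from tendsto_L1_AE_subseq[OF hint this] obtain r where r: "strict_mono r" "AE t in lborel. (\<lambda>j. h (r j) t) \<longlonglongrightarrow> 0" by blast
    have tan: "AE t in lborel. \<forall>k. t \<in> K \<and> f k (\<gamma> t) \<in> UNIV - N k \<longrightarrow>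
       (\<forall>w. ((\<lambda>t. f k (\<gamma>' t)) has_vector_derivative w) (at t) \<longrightarrow> \<Phi> w \<in> \<tau> k (f k (\<gamma> t)))"
      unfolding AE_all_countable
      using AE_derivative_tangent[OF \<tau> \<Phi>(1,5) K fN(1) ext(1,2)] by blast
    have fd: "AE t in lborel. \<forall>k. \<exists>w\<in>span B. ((\<lambda>t. f k (\<gamma>' t)) has_vector_derivative w) (at t)"
      unfolding AE_all_countable using Lipschitz_curve_differentiable_AE[OF lipf B(1)] B(2) by simp
    show "AE t in lborel. t \<in> K \<and> \<gamma> t \<in> S \<longrightarrow> (\<forall>v. (\<gamma> has_vector_derivative v) (at t within K) \<longrightarrow> q (\<gamma> t) v = 0)"
      using ext(3) r(2) tan fd AE_not_porous[of K]
    proof (eventually_elim, intro impI allI, elim conjE)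
      fix t v
      assume "\<exists>v\<in>span B. (\<gamma>' has_vector_derivative v) (at t)" and h0: "(\<lambda>j. h (r j) t) \<longlonglongrightarrow> 0"
        and tan: "\<forall>k. t \<in> K \<and> f k (\<gamma> t) \<in> UNIV - N k \<longrightarrow>
           (\<forall>w. ((\<lambda>t. f k (\<gamma>' t)) has_vector_derivative w) (at t) \<longrightarrow> \<Phi> w \<in> \<tau> k (f k (\<gamma> t)))"
        and fd: "\<forall>k. \<exists>w\<in>span B. ((\<lambda>t. f k (\<gamma>' t)) has_vector_derivative w) (at t)"
        and np: "t \<in> K \<longrightarrow> (\<forall>\<eta>>0. \<exists>\<delta>>0. \<forall>s. 0 < \<bar>s\<bar> \<and> \<bar>s\<bar> < \<delta> \<longrightarrow> (\<exists>s'. t + s' \<in> K \<and> \<bar>s' - s\<bar> < \<eta> * \<bar>s\<bar>))"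
        and t: "t \<in> K" "\<gamma> t \<in> S" and v: "(\<gamma> has_vector_derivative v) (at t within K)"
      then obtain v' where v': "(\<gamma>' has_vector_derivative v') (at t)" by blast
      have ne: "at t within K \<noteq> bot" by (rule not_porous_imp_at_within_ne_bot[OF mp[OF np t(1)]])
      have "(\<gamma> has_vector_derivative v') (at t within K)"
        by (rule has_vector_derivative_transform[OF t(1) _ has_vector_derivative_at_within[OF v']]) (use ext(2) in auto)
      then have vv: "v' = v" using vector_derivative_unique_within[OF ne _ v] by blast
      \<comment> \<open>Since \<open>\<Phi> w\<close> lies in the subspace, the distance of
        \<open>\<Phi> v\<close> to it is at most \<open>M * norm (v - w)\<close>, and
        \<open>norm (v - w)\<close> is the speed of the difference curve.\<close>
      have Qs: "Q k (\<gamma> t) v \<le> M * s k t" for k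
      proof -
        obtain w where w: "((\<lambda>t. f k (\<gamma>' t)) has_vector_derivative w) (at t)" using fd by blast
        have "\<Phi> w \<in> \<tau> k (f k (\<gamma> t))" using tan t(1) fS[OF S0[OF t(2)]] w by blast
        then have "infdist (\<Phi> v) (\<tau> k (f k (\<gamma> t))) \<le> dist (\<Phi> v) (\<Phi> w)" by (rule infdist_le)
        also have "\<dots> = norm (\<Phi> (v - w))" by (simp add: dist_norm linear_diff[OF \<Phi>(1)])
        also have "\<dots> \<le> M * norm (v - w)" by (rule \<Phi>(5))
        also have "norm (v - w) = s k t"
          unfolding s_def by (rule speed_eq[symmetric]) (intro has_vector_derivative_diff w v'[unfolded vv])
        finally show ?thesis using S0[OF t(2)] by (simp add: Q_def)
      qed
      have "weighted (\<Lambda> j) (\<lambda>k. Q k (\<gamma> t) v) \<le> M * h j t" for j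
      proof -
        have "weighted (\<Lambda> j) (\<lambda>k. Q k (\<gamma> t) v) \<le> weighted (\<Lambda> j) (\<lambda>k. M * s k t)"
          by (rule weighted_mono[OF \<Lambda>(1) Qs])
        also have "\<dots> = M * h j t" using t(1) K01 by (auto simp: h_def weighted_cmult)
        finally show ?thesis .
      qed
      moreover have "(\<lambda>j. M * h (r j) t) \<longlonglongrightarrow> M * 0" by (intro tendsto_intros h0)
      moreover have "(\<lambda>j. weighted (\<Lambda> (r j)) (\<lambda>k. Q k (\<gamma> t) v)) \<longlonglongrightarrow> q (\<gamma> t) v"
        using LIMSEQ_subseq_LIMSEQ[OF qlim[OF t(2)] r(1)] by (simp add: o_def)
      ultimately have "q (\<gamma> t) v \<le> M * 0" by (intro LIMSEQ_le) auto
      moreover have "0 \<le> q (\<gamma> t) v" using W0 by (intro LIMSEQ_le_const[OF qlim[OF t(2)]]) auto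
      ultimately show "q (\<gamma> t) v = 0" by simp
    qed
  qed
  then show False using no[OF N'b N'0] by (simp add: S_def)
qed

section \<open>Passage from admissible dimensions to the tangential dimension\<close>

lemma dim_T_leD:
  assumes "dim_T S \<le> enat d"
  obtains d' where "d' \<le> d" "admits_weak_tangent_field d' S"
proof -
  let ?A = "{enat d | d. admits_weak_tangent_field d S}"
  have "?A \<noteq> {}" using assms unfolding dim_T_def by (auto simp: Inf_enat_def split: if_splits)
  then have "Inf ?A \<in> ?A" unfolding Inf_enat_def by (auto intro: LeastI)
  then show thesis using assms that unfolding dim_T_def by auto
qed

lemma dim_T_measure_leI:
  assumes "N \<in> sets borel" "emeasure \<mu> N = 0" "admits_weak_tangent_field d (UNIV - N)"
  shows "dim_T_measure \<mu> \<le> enat d"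
proof -
  have "dim_T (UNIV - N) \<le> enat d" unfolding dim_T_def using assms(3) by (intro Inf_lower) auto
  then show ?thesis unfolding dim_T_measure_def using assms(1,2) by (intro Inf_lower) auto
qed

theorem theorem1p5:
  fixes \<mu> :: "'a::banach measure"
  assumes finite_dimensional: "\<exists>B::'a set. finite B \<and> span B = UNIV"
    and strictly_convex: "\<And>x y::'a. closed_segment x y \<subseteq> sphere 0 1 \<Longrightarrow> x = y"
    and borel_measure: "sets \<mu> = sets borel"
    and finite: "finite_measure \<mu>"
  shows "\<exists>(C::'a set) \<epsilon>::real. compact C \<and> convex C \<and> \<epsilon> > 0 \<and>
           (\<forall>f::'a \<Rightarrow> 'a. 1-lipschitz_on UNIV f \<and> (\<forall>x\<in>C. norm (f x - x) \<le> \<epsilon>) \<longrightarrow>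
              dim_T_measure (distr \<mu> borel f) \<ge> dim_T_measure \<mu>)"
proof -
  obtain B :: "'a set" where B: "finite B" "span B = UNIV" using finite_dimensional by blast
  have "\<forall>d. \<exists>k::nat. \<forall>f N. 1-lipschitz_on UNIV f \<longrightarrow> (\<forall>x\<in>cball 0 (real k). norm (f x - x) \<le> inverse (real (Suc k))) \<longrightarrow>
     N \<in> sets borel \<longrightarrow> emeasure \<mu> (f -` N) = 0 \<longrightarrow> admits_weak_tangent_field d (UNIV - N) \<longrightarrow>
     (\<exists>N\<in>sets borel. emeasure \<mu> N = 0 \<and> admits_weak_tangent_field d (UNIV - N))"
    using dim_stability_upto[OF B strictly_convex borel_measure finite] by blast
  then obtain k :: "nat \<Rightarrow> nat" where k: "\<And>d f N. 1-lipschitz_on UNIV f \<Longrightarrow>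
     (\<forall>x\<in>cball 0 (real (k d)). norm (f x - x) \<le> inverse (real (Suc (k d)))) \<Longrightarrow>
     N \<in> sets borel \<Longrightarrow> emeasure \<mu> (f -` N) = 0 \<Longrightarrow> admits_weak_tangent_field d (UNIV - N) \<Longrightarrow>
     \<exists>N\<in>sets borel. emeasure \<mu> N = 0 \<and> admits_weak_tangent_field d (UNIV - N)" by metis
  \<comment> \<open>A larger index means a larger ball and a smaller tolerance, so the maximum over
    the finitely many relevant dimensions serves all of them.\<close>
  define m where "m = Max (k ` {..card B})"
  have km: "k d \<le> m" if "d \<le> card B" for d unfolding m_def using that by (intro Max_ge) auto
  \<comment> \<open>With \<open>q = 0\<close> the kernel is the whole space, which holds at most
    \<open>card B\<close> independent vectors.\<close>
  have high: "admits_weak_tangent_field d (UNIV :: 'a set)" if d: "card B \<le> d" for d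
  proof (rule admits_weak_tangent_field_of_kernel[OF B, of UNIV 0 "\<lambda>_ _. 0"])
    show "\<not> indep_upto (Suc d) v" for v :: "nat \<Rightarrow> 'a"
      using indep_upto_le_card[of "Suc d" v B] B d by auto
  qed auto
  show ?thesis
  proof (intro exI conjI allI impI)
    show "compact (cball (0::'a) (real m))" using compact_span_Int_cball[OF B(1), of "real m"] B(2) by simp
    show "convex (cball (0::'a) (real m))" by (rule convex_cball)
    show "inverse (real (Suc m)) > 0" by simp
    fix f :: "'a \<Rightarrow> 'a"
    assume f: "1-lipschitz_on UNIV f \<and> (\<forall>x\<in>cball 0 (real m). norm (f x - x) \<le> inverse (real (Suc m)))"
    have "f \<in> borel_measurable borel"
      using f by (intro borel_measurable_continuous_onI lipschitz_on_continuous_on[of 1]) auto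
    then have fm: "f \<in> measurable \<mu> borel"
      using measurable_cong_sets[OF borel_measure refl, of borel] by blast
    have space: "space \<mu> = UNIV" using sets_eq_imp_space_eq[OF borel_measure] by simp
    show "dim_T_measure \<mu> \<le> dim_T_measure (distr \<mu> borel f)"
      unfolding dim_T_measure_def[of "distr \<mu> borel f"]
    proof (rule Inf_greatest, safe)
      fix d N assume N: "N \<in> sets borel" "emeasure (distr \<mu> borel f) N = 0" "dim_T (UNIV - N) \<le> enat d"
      have fN: "emeasure \<mu> (f -` N) = 0" using N(2) emeasure_distr[OF fm N(1)] space by simp
      \<comment> \<open>The infimum in \<open>dim_T\<close> may be attained below \<open>d\<close>,
        so the argument is carried out for \<open>d'\<close> itself.\<close>
      obtain d' where d': "d' \<le> d" "admits_weak_tangent_field d' (UNIV - N)" using dim_T_leD[OF N(3)] by blast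
      have "dim_T_measure \<mu> \<le> enat d'"
      proof (cases "d' \<le> card B")
        case True
        have "\<forall>x\<in>cball 0 (real (k d')). norm (f x - x) \<le> inverse (real (Suc (k d')))"
        proof
          fix x :: 'a assume "x \<in> cball 0 (real (k d'))"
          then have "norm (f x - x) \<le> inverse (real (Suc m))" using f km[OF True] by auto
          also have "\<dots> \<le> inverse (real (Suc (k d')))" using km[OF True] by (intro le_imp_inverse_le) auto
          finally show "norm (f x - x) \<le> inverse (real (Suc (k d')))" .
        qed
        then obtain N' where "N' \<in> sets borel" "emeasure \<mu> N' = 0" "admits_weak_tangent_field d' (UNIV - N')"
          using k[of f d' N] f N(1) fN d'(2) by blast
        then show ?thesis by (rule dim_T_measure_leI)
      next
        case False
        then show ?thesis using high[of d'] by (intro dim_T_measure_leI[of "{}"]) auto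
      qed
      also have "enat d' \<le> enat d" using d'(1) by simp
      finally show "dim_T_measure \<mu> \<le> enat d" .
    qed
  qed
qed

end
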